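(* Let $r\ge1$, let $N$ be a non-negative integer, and let $a,b_1,\dots,b_r,x_1,\dots,x_r$ be generic nonzero complex parameters. Then $$\sum_{\substack{k_1,\dots,k_r\ge0\\ |\mathbf k|\le N}}\frac{\Delta(\mathbf xq^{3\mathbf k};p)}{\Delta(\mathbf x;p)}q^{|\mathbf k|-2e_2(\mathbf k)}\prod_{1\le i<j\le r}\frac1{(a^2x_ix_jq^{-N};q^3,p)_{k_i+k_j}}$$ $$\times\prod_{i=1}^r\left(\frac{\theta(ax_iq^{|\mathbf k|+3k_i};p)}{\theta(ax_i;p)}\frac{(ax_i;q,p)_{|\mathbf k|}\,(q^{N+1}/ax_i;q,p)_{|\mathbf k|-k_i}}{(aq/b_i,b_iq^{N+1}/a;q,p)_{|\mathbf k|}\,(q^{k_i-|\mathbf k|-N}ax_i;q,p)_{2k_i}}\right)$$ $$\times\frac{(q^{-N};q,p)_{|\mathbf k|}\,(q^{N+1};q,p)_{2|\mathbf k|}}{\prod_{i=1}^r(ax_iq^{N+3};q^3,p)_{k_i}}\prod_{i,j=1}^r\frac{(b_jx_i,a^2x_iq^{-N}/b_j;q^3,p)_{k_i}}{(q^3x_i/x_j;q^3,p)_{k_i}}$$ $$=\prod_{i=1}^r\frac{(b_i/a;q,p)_{N+1}\,(q^{-N}/ax_i;q^3,p)_{N+1}}{(1/ax_i;q,p)_{N+1}\,(b_iq^{-N}/a;q^3,p)_{N+1}}.$$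
   Context: $p,q$ are complex numbers with $|p|<1$, $q\ne0$, and $q^k\notin p^{\mathbb Z}$ for all integers $k>0$ (if $p=0$: $q^k\ne1$). For $x\ne0$, $\theta(x;p)=\prod_{j=0}^\infty(1-p^jx)(1-p^{j+1}/x)$. Elliptic shifted factorials: $(a;q,p)_k=\prod_{j=0}^{k-1}\theta(aq^j;p)$ for $k\in\mathbb Z_{\ge0}$ (similarly with base $q^3$), and $(a_1,\dots,a_m;q,p)_k=(a_1;q,p)_k\cdots(a_m;q,p)_k$. For $\mathbf k=(k_1,\dots,k_r)$, $|\mathbf k|=k_1+\cdots+k_r$ and $e_2(\mathbf k)=\sum_{1\le i<j\le r}k_ik_j$. For $\mathbf x=(x_1,\dots,x_r)$, $\Delta(\mathbf x;p)=\prod_{1\le i<j\le r}x_j\theta(x_i/x_j;p)$, and $\mathbf xq^{3\mathbf k}=(x_1q^{3k_1},\dots,x_rq^{3k_r})$. In expressions such as $q^{N+1}/ax_i$, everything after the slash is in the denominator. All parameters are assumed generic so that no denominator vanishes. *)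

theory Defs
  imports "HOL-Analysis.Analysis" "HOL-Library.FuncSet"
begin

(* Since 0 powi 0 = 1 and 0 powi m = 0 for every integer m \<noteq> 0, the last condition
   reads q ^ k \<noteq> 1 for all k > 0 when p = 0, given q \<noteq> 0. *)
definition elliptic_base :: "complex \<Rightarrow> complex \<Rightarrow> bool" where
  "elliptic_base p q \<longleftrightarrow>
     norm p < 1 \<and> q \<noteq> 0 \<and> (\<forall>k::nat. k > 0 \<longrightarrow> (\<forall>m::int. q ^ k \<noteq> p powi m))"

definition theta :: "complex \<Rightarrow> complex \<Rightarrow> complex" where
  "theta x p = (\<Prod>j. (1 - p ^ j * x) * (1 - p ^ Suc j / x))"

lemma theta_convergent:
  fixes p x :: complex
  assumes "norm p < 1"
  shows "convergent_prod (\<lambda>j. (1 - p ^ j * x) * (1 - p ^ Suc j / x))"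
proof -
  have geo: "summable (\<lambda>j. norm p ^ j * c)" for c
    using assms by (intro summable_mult2 summable_geometric) simp
  have "(\<lambda>j. norm (- (p ^ j * x))) = (\<lambda>j. norm p ^ j * norm x)"
    and "(\<lambda>j. norm (- (p ^ Suc j / x))) = (\<lambda>j. norm p ^ j * (norm p / norm x))"
    by (simp_all only: norm_minus_cancel norm_mult norm_divide norm_power power_Suc
          times_divide_eq_right mult.commute)
  then have "summable (\<lambda>j. norm (- (p ^ j * x)))" "summable (\<lambda>j. norm (- (p ^ Suc j / x)))"
    using geo by simp_all
  then have "convergent_prod (\<lambda>j. 1 + - (p ^ j * x))"
    and "convergent_prod (\<lambda>j. 1 + - (p ^ Suc j / x))"
    by (intro abs_convergent_prod_imp_convergent_prod summable_imp_abs_convergent_prod; simp)+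
  from convergent_prod_mult[OF this] show ?thesis by simp
qed

(* ell_poch a q p k is the elliptic shifted factorial (a; q, p)_k. *)
definition ell_poch :: "complex \<Rightarrow> complex \<Rightarrow> complex \<Rightarrow> nat \<Rightarrow> complex" where
  "ell_poch a q p k = (\<Prod>j<k. theta (a * q ^ j) p)"

(* ell_pochs [a1, ..., am] q p k is (a1, ..., am; q, p)_k. *)
definition ell_pochs :: "complex list \<Rightarrow> complex \<Rightarrow> complex \<Rightarrow> nat \<Rightarrow> complex" where
  "ell_pochs as q p k = (\<Prod>a\<leftarrow>as. ell_poch a q p k)"

(* Vectors of length r are functions on nat of which only the values at 1, ..., r matter. *)
definition ell_Delta :: "nat \<Rightarrow> (nat \<Rightarrow> complex) \<Rightarrow> complex \<Rightarrow> complex" where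
  "ell_Delta r x p = (\<Prod>i=1..r. \<Prod>j=i+1..r. x j * theta (x i / x j) p)"

definition vsum :: "nat \<Rightarrow> (nat \<Rightarrow> nat) \<Rightarrow> nat" where
  "vsum r k = (\<Sum>i=1..r. k i)"

definition e2 :: "nat \<Rightarrow> (nat \<Rightarrow> nat) \<Rightarrow> nat" where
  "e2 r k = (\<Sum>i=1..r. \<Sum>j=i+1..r. k i * k j)"

(* Extensional functions, so that each (k_1, ..., k_r) is represented exactly once. *)
definition simplex_indices :: "nat \<Rightarrow> nat \<Rightarrow> (nat \<Rightarrow> nat) set" where
  "simplex_indices r N = {k \<in> {1..r} \<rightarrow>\<^sub>E UNIV. vsum r k \<le> N}"

lemma finite_simplex_indices: "finite (simplex_indices r N)"
proof (rule finite_subset)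
  show "simplex_indices r N \<subseteq> {1..r} \<rightarrow>\<^sub>E {..N}"
  proof
    fix k assume k: "k \<in> simplex_indices r N"
    have "k i \<le> N" if "i \<in> {1..r}" for i
    proof -
      have "k i \<le> vsum r k" unfolding vsum_def using that by (intro member_le_sum) auto
      then show ?thesis using k by (simp add: simplex_indices_def)
    qed
    then show "k \<in> {1..r} \<rightarrow>\<^sub>E {..N}"
      using k by (auto simp: simplex_indices_def PiE_iff)
  qed
qed (auto intro: finite_PiE)

end

(* Write q = exp (4 \<zeta>) and replace \<theta> by the odd entire function S u = exp (-u) \<theta> (exp (2u); p). All that
   is used of S is the three-term relation, continuity and the countability of its zeros: by the
   relation the functions s2 v u = S (v + u) S (v - u) of u lie in a plane, so products of m of them
   behave like polynomials of degree m in one variable.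

   In the new variables the right-hand side is a product of values F (w_j), and the left-hand side is
   its Newton-type expansion with nodes c_i(s) = \<xi>_i + 6 \<zeta> s in which k_i counts the nodes used of
   the i-th chain. Both sides, times a common denominator, have degree N in each w_j, so it suffices to
   compare them at the nodes. The triangular matrix of the expansion is inverted explicitly:
   orthogonality is a partial fraction identity in one coordinate combined with antisymmetry in the
   coordinates. This turns each coefficient into a sum over the nodes, a multiple Jackson sum, which
   arises from a sum over all choices of signs \<plusminus> z_x by letting the z_x run through arithmetic
   progressions. The sum over signs is evaluated by interpolation in its parameters and induction. *)

theory Submission
  imports Defs "HOL-Complex_Analysis.Complex_Analysis"
begin

section \<open>Odd functions satisfying the three-term relation\<close>

text \<open>Expansion and inversion would work for any right-hand side of degree N; that the
  coefficients have a closed form rests on special features of \<open>run_ratio\<close>. Its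
  numerator has offsets -N, -N+2, ..., N (in units of \<zeta>), its denominator -3N, -3N+6, ..., 3N.
  The denominator points \<open>h N y\<close> prolong the numerator to -3N, ..., 3N in steps of 2;
  removing the denominator leaves two residue classes modulo 6 that w -> -w interchanges, hence a
  product of N functions \<open>s2\<close>. Moreover a step of 6 \<zeta>, one node further along a
  chain, exchanges three factors of the numerator and one of the denominator: these four are the
  parameters of the signed sum, and they satisfy its balancing condition. The value of that sum
  contains \<sigma> 0 once |k| > N, which cuts the cube of indices down to the simplex and keeps the
  expansion of degree N. Inversion needs \<xi> in general position, whereas the theorem only
  excludes vanishing denominators. The gap is bridged by continuity, along a line with at most
  countably many bad parameters.\<close>

locale odd_sigma =
  fixes \<sigma> :: "complex \<Rightarrow> complex"
  assumes odd: "\<sigma> (- x) = - \<sigma> x"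
    and three_term: "\<sigma> (x + y) * \<sigma> (x - y) * (\<sigma> (u + v) * \<sigma> (u - v))
      - \<sigma> (x + v) * \<sigma> (x - v) * (\<sigma> (u + y) * \<sigma> (u - y))
      = \<sigma> (x + u) * \<sigma> (x - u) * (\<sigma> (y + v) * \<sigma> (y - v))"
    and cont: "continuous_on UNIV \<sigma>"
    and countable_zeros: "countable {x. \<sigma> x = 0}"
begin

text \<open>The elliptic substitute for the difference of two coordinates: it is antisymmetric, and
  the three-term relation is the Pluecker relation of 2 x 2 determinants.\<close>

definition s2 :: "complex \<Rightarrow> complex \<Rightarrow> complex" where
  "s2 x y = \<sigma> (x + y) * \<sigma> (x - y)"

lemma zero [simp]: "\<sigma> 0 = 0"
  using odd[of 0] by simp

lemma odd_diff: "\<sigma> (x - y) = - \<sigma> (y - x)"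
  using odd[of "y - x"] by simp

lemma s2_swap: "s2 x y = - s2 y x"
  unfolding s2_def using odd_diff[of x y] by (simp add: add.commute)

lemma s2_self [simp]: "s2 x x = 0"
  by (simp add: s2_def)

lemma s2_plucker: "s2 x y * s2 u v - s2 x v * s2 u y = s2 x u * s2 y v"
  unfolding s2_def by (rule three_term)

lemma s2_basis:
  assumes "s2 e f \<noteq> 0"
  shows "s2 v x = (s2 v f / s2 e f) * s2 e x + (- s2 v e / s2 e f) * s2 f x"
proof -
  have "s2 v x * s2 e f = s2 v f * s2 e x - s2 v e * s2 f x"
    using s2_plucker[of v x e f] s2_swap[of x f] by (simp add: algebra_simps)
  then show ?thesis using assms by (simp add: field_simps)
qed

text \<open>In a suitable coordinate, \<open>H m\<close> consists of the polynomials of degree at most \<open>m\<close>: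
  all the functions \<open>s2 v\<close> lie in a plane.\<close>

inductive_set H :: "(nat \<times> (complex \<Rightarrow> complex)) set" where
  const: "(0, \<lambda>x. c) \<in> H"
| mult: "(m, f) \<in> H \<Longrightarrow> (Suc m, \<lambda>x. f x * s2 v x) \<in> H"
| add: "(m, f) \<in> H \<Longrightarrow> (m, g) \<in> H \<Longrightarrow> (m, \<lambda>x. f x + g x) \<in> H"
| scale: "(m, f) \<in> H \<Longrightarrow> (m, \<lambda>x. c * f x) \<in> H"

lemma H_zero: "(m, \<lambda>x. 0) \<in> H"
proof (induction m)
  case 0 show ?case by (rule H.const)
next
  case (Suc m) from H.mult[OF this, of 0] show ?case by simp
qed

lemma H_sum:
  assumes "finite A" "\<And>a. a \<in> A \<Longrightarrow> (m, f a) \<in> H"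
  shows "(m, \<lambda>x. \<Sum>a\<in>A. f a x) \<in> H"
  using assms by (induction A rule: finite_induct) (auto intro: H.add H_zero)

lemma H_mult_prod:
  assumes "finite A" "(m, f) \<in> H"
  shows "(m + card A, \<lambda>x. f x * (\<Prod>a\<in>A. s2 (v a) x)) \<in> H"
  using assms
proof (induction A rule: finite_induct)
  case empty then show ?case by simp
next
  case (insert a A)
  from H.mult[OF insert.IH[OF insert.prems], of "v a"] insert.hyps show ?case
    by (simp add: mult_ac)
qed

lemma H_prod:
  assumes "finite A"
  shows "(card A, \<lambda>x. c * (\<Prod>a\<in>A. s2 (v a) x)) \<in> H"
  using H_mult_prod[OF assms H.const[of c], of v] by simp

lemma H_const_unique: "(m, f) \<in> H \<Longrightarrow> m = 0 \<Longrightarrow> \<exists>c. \<forall>x. f x = c"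
  by (induction rule: H.induct) auto

text \<open>Division with remainder by the linear form \<open>s2 b\<close>: each new factor
  \<open>s2 v\<close> is split along \<open>s2 b\<close> and \<open>s2 e\<close>, and only the pure
  power of \<open>s2 e\<close> is not divisible. In degree 0 the quotient would have degree -1, so
  it is the zero function.\<close>

lemma H_decompose:
  assumes "(m, f) \<in> H" "s2 b e \<noteq> 0"
  shows "\<exists>c g. (if m = 0 then g = (\<lambda>x. 0) else (m - 1, g) \<in> H)
           \<and> (\<forall>x. f x = c * s2 e x ^ m + s2 b x * g x)"
  using assms(1)
proof (induction rule: H.induct)
  case (const c)
  show ?case by (rule exI[of _ c], rule exI[of _ "\<lambda>x. 0"]) simp
next
  case (mult m f v)
  then obtain c g where g: "if m = 0 then g = (\<lambda>x. 0) else (m - 1, g) \<in> H"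
    and f: "\<And>x. f x = c * s2 e x ^ m + s2 b x * g x" by blast
  define A where "A = s2 v e / s2 b e"
  define B where "B = - s2 v b / s2 b e"
  have v: "s2 v x = A * s2 b x + B * s2 e x" for x
    unfolding A_def B_def by (rule s2_basis[OF assms(2)])
  define g' where "g' x = c * A * s2 e x ^ m + g x * s2 v x" for x
  have pw: "(m, \<lambda>x. c * A * s2 e x ^ m) \<in> H"
    using H_prod[of "{..<m}" "c * A" "\<lambda>_. e"] by simp
  have "(m, \<lambda>x. g x * s2 v x) \<in> H"
  proof (cases "m = 0")
    case True then show ?thesis using g by (simp add: H_zero)
  next
    case False then show ?thesis using g H.mult[of "m - 1" g v] by simp
  qed
  from H.add[OF pw this] have "(m, g') \<in> H" by (simp add: g'_def [abs_def])
  moreover have "f x * s2 v x = c * B * s2 e x ^ Suc m + s2 b x * g' x" for x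
  proof -
    have "f x * s2 v x = c * s2 e x ^ m * s2 v x + s2 b x * (g x * s2 v x)"
      by (simp add: f algebra_simps)
    also have "c * s2 e x ^ m * s2 v x = c * s2 e x ^ m * (A * s2 b x + B * s2 e x)"
      by (simp only: v)
    finally show ?thesis by (simp add: g'_def algebra_simps)
  qed
  ultimately show ?case by (intro exI[of _ "c * B"] exI[of _ g']) simp
next
  case (add m f g)
  then obtain c1 g1 c2 g2 where
    *: "if m = 0 then g1 = (\<lambda>x. 0) else (m - 1, g1) \<in> H"
    "if m = 0 then g2 = (\<lambda>x. 0) else (m - 1, g2) \<in> H"
    "\<And>x. f x = c1 * s2 e x ^ m + s2 b x * g1 x"
    "\<And>x. g x = c2 * s2 e x ^ m + s2 b x * g2 x" by blast
  show ?case
    by (rule exI[of _ "c1 + c2"], rule exI[of _ "\<lambda>x. g1 x + g2 x"])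
       (use * in \<open>auto simp: algebra_simps intro: H.add split: if_splits\<close>)
next
  case (scale m f d)
  then obtain c g where
    *: "if m = 0 then g = (\<lambda>x. 0) else (m - 1, g) \<in> H"
    "\<And>x. f x = c * s2 e x ^ m + s2 b x * g x" by blast
  show ?case
    by (rule exI[of _ "d * c"], rule exI[of _ "\<lambda>x. d * g x"])
       (use * in \<open>auto simp: algebra_simps intro: H.scale split: if_splits\<close>)
qed

text \<open>At a zero b the remainder of the division by \<open>s2 b\<close> vanishes; the quotient
  has degree one less and keeps the other zeros, because \<open>s2 b\<close> does not vanish
  there.\<close>

lemma H_vanish:
  assumes "(m, f) \<in> H" "finite B" "card B > m"
    and "\<And>x y. x \<in> B \<Longrightarrow> y \<in> B \<Longrightarrow> x \<noteq> y \<Longrightarrow> s2 x y \<noteq> 0"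
    and "\<And>x. x \<in> B \<Longrightarrow> f x = 0"
  shows "f x = 0"
  using assms
proof (induction m arbitrary: f B x)
  case 0
  then obtain b where "b \<in> B" by (metis card.empty equals0I not_less_zero)
  with 0 H_const_unique[of 0 f] show ?case by metis
next
  case (Suc m)
  then obtain b where b: "b \<in> B" by (metis card.empty equals0I not_less_zero)
  have "card (B - {b}) > m" using Suc.prems b by simp
  then obtain e where e: "e \<in> B - {b}" by (metis card.empty equals0I not_less_zero)
  have nz: "s2 b e \<noteq> 0" "s2 e b \<noteq> 0" using Suc.prems b e by auto
  obtain c g where g: "(m, g) \<in> H" and f: "\<And>x. f x = c * s2 e x ^ Suc m + s2 b x * g x"
    using H_decompose[OF Suc.prems(1) nz(1)] by auto
  have "c = 0" using f[of b] Suc.prems(5)[OF b] nz by simp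
  then have f': "f x = s2 b x * g x" for x using f by simp
  have "g x = 0" for x
  proof (rule Suc.IH[OF g, of "B - {b}"])
    show "g y = 0" if "y \<in> B - {b}" for y
      using f'[of y] Suc.prems(5)[of y] Suc.prems(4)[of b y] b that by auto
  qed (use Suc.prems \<open>card (B - {b}) > m\<close> in auto)
  then show ?case using f' by simp
qed

text \<open>Lagrange interpolation through all points but one, x0, reproduces f since m + 1 points
  suffice; its value at x0 supplies the missing term of the sum.\<close>

lemma H_partial_fractions:
  assumes f: "(m, f) \<in> H" and X: "finite X" "card X = m + 2"
    and nz: "\<And>x y. x \<in> X \<Longrightarrow> y \<in> X \<Longrightarrow> x \<noteq> y \<Longrightarrow> s2 (c x) (c y) \<noteq> 0"
  shows "(\<Sum>x\<in>X. f (c x) / (\<Prod>y\<in>X-{x}. s2 (c y) (c x))) = 0"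
proof -
  from X obtain x0 where x0: "x0 \<in> X" by fastforce
  define X' where "X' = X - {x0}"
  have X': "finite X'" "card X' = m + 1" "X = insert x0 X'" "x0 \<notin> X'"
    using X x0 by (auto simp: X'_def)
  have inj: "inj_on c X" by (rule inj_onI) (metis nz s2_self)
  define L where "L t = (\<Sum>x\<in>X'. f (c x) / (\<Prod>y\<in>X'-{x}. s2 (c y) (c x))
      * (\<Prod>y\<in>X'-{x}. s2 (c y) t))" for t
  have LH: "(m, L) \<in> H"
  proof -
    have "(m, \<lambda>t. f (c x) / (\<Prod>y\<in>X'-{x}. s2 (c y) (c x)) * (\<Prod>y\<in>X'-{x}. s2 (c y) t)) \<in> H"
      if "x \<in> X'" for x
      using H_prod[of "X' - {x}" "f (c x) / (\<Prod>y\<in>X'-{x}. s2 (c y) (c x))" c] X' that by simp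
    from H_sum[OF X'(1) this] show ?thesis unfolding L_def .
  qed
  have L_at: "L (c x) = f (c x)" if x: "x \<in> X'" for x
  proof -
    have "(\<Prod>y\<in>X'-{z}. s2 (c y) (c x)) = 0" if "z \<in> X' - {x}" for z
      using that x X'(1) by (auto intro!: bexI[of _ x])
    then have "L (c x) = f (c x) / (\<Prod>y\<in>X'-{x}. s2 (c y) (c x)) * (\<Prod>y\<in>X'-{x}. s2 (c y) (c x))"
      unfolding L_def by (subst sum.remove[OF X'(1) x]) simp
    moreover have "(\<Prod>y\<in>X'-{x}. s2 (c y) (c x)) \<noteq> 0"
      using X' x nz by auto
    ultimately show ?thesis by simp
  qed
  have "(m, \<lambda>t. f t + (-1) * L t) \<in> H" by (intro H.add H.scale f LH)
  then have "f t + (-1) * L t = 0" for t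
  proof (rule H_vanish[where B = "c ` X'"])
    show "card (c ` X') > m" using inj X' by (subst card_image) (auto intro: inj_on_subset)
  qed (use X' L_at nz in auto)
  then have eq: "f (c x0) = L (c x0)" by (simp add: add_eq_0_iff)
  define P where "P = (\<Prod>y\<in>X'. s2 (c y) (c x0))"
  have P: "P \<noteq> 0" unfolding P_def using X' nz by auto
  have "f (c x) / (\<Prod>y\<in>X-{x}. s2 (c y) (c x))
      = - (f (c x) / (\<Prod>y\<in>X'-{x}. s2 (c y) (c x)) * (\<Prod>y\<in>X'-{x}. s2 (c y) (c x0))) / P"
    if x: "x \<in> X'" for x
  proof -
    have "X - {x} = insert x0 (X' - {x})" "x0 \<notin> X' - {x}" using X' x by auto
    then have 1: "(\<Prod>y\<in>X-{x}. s2 (c y) (c x)) = s2 (c x0) (c x) * (\<Prod>y\<in>X'-{x}. s2 (c y) (c x))"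
      using X'(1) by simp
    have 2: "P = s2 (c x) (c x0) * (\<Prod>y\<in>X'-{x}. s2 (c y) (c x0))"
      unfolding P_def by (rule prod.remove[OF X'(1) x])
    have "s2 (c x) (c x0) \<noteq> 0" "(\<Prod>y\<in>X'-{x}. s2 (c y) (c x0)) \<noteq> 0"
      using P 2 by auto
    then show ?thesis unfolding 1 2 s2_swap[of "c x0" "c x"] by (simp add: field_simps)
  qed
  then have "(\<Sum>x\<in>X'. f (c x) / (\<Prod>y\<in>X-{x}. s2 (c y) (c x))) = - L (c x0) / P"
    unfolding L_def by (simp add: sum_divide_distrib sum_negf)
  moreover have "f (c x0) / (\<Prod>y\<in>X-{x0}. s2 (c y) (c x0)) = f (c x0) / P"
    by (simp add: P_def X'_def)
  ultimately have "f (c x0) / (\<Prod>y\<in>X-{x0}. s2 (c y) (c x0))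
      + (\<Sum>x\<in>X'. f (c x) / (\<Prod>y\<in>X-{x}. s2 (c y) (c x))) = 0"
    using eq by simp
  then show ?thesis using sum.remove[OF X(1) x0, of "\<lambda>x. f (c x) / (\<Prod>y\<in>X-{x}. s2 (c y) (c x))"]
    by (simp only: X'_def)
qed

end

section \<open>Signed sums\<close>

text \<open>Every unordered pair occurs once, oriented by the enumeration \<open>to_nat\<close>.
  This serves symmetric and antisymmetric B alike; for antisymmetric B another enumeration would
  change only the sign.\<close>

definition pprod :: "('i::countable \<Rightarrow> 'i \<Rightarrow> 'a::comm_monoid_mult) \<Rightarrow> 'i set \<Rightarrow> 'a" where
  "pprod B I = (\<Prod>(x, y)\<in>{(x, y). x \<in> I \<and> y \<in> I \<and> to_nat x < to_nat y}. B x y)"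

lemma pprod_empty [simp]: "pprod B {} = 1"
  by (simp add: pprod_def)

lemma finite_pairs: "finite I \<Longrightarrow> finite {(x, y). x \<in> I \<and> y \<in> I \<and> R x y}"
  by (rule finite_subset[of _ "I \<times> I"]) auto

lemma pprod_cong:
  assumes "\<And>x y. x \<in> I \<Longrightarrow> y \<in> I \<Longrightarrow> B x y = B' x y"
  shows "pprod B I = pprod B' I"
  unfolding pprod_def by (intro prod.cong) (use assms in auto)

lemma pprod_insert:
  fixes a :: "'i::countable"
  assumes "finite I" "a \<notin> I"
  shows "pprod B (insert a I) = pprod B I * (\<Prod>y\<in>I. if to_nat a < to_nat y then B a y else B y a)"
proof -
  let ?P = "{(x, y). x \<in> I \<and> y \<in> I \<and> to_nat x < to_nat y}"
  define f where "f y = (if to_nat a < to_nat y then (a, y) else (y, a))" for y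
  have eq: "{(x, y). x \<in> insert a I \<and> y \<in> insert a I \<and> to_nat x < to_nat y} = ?P \<union> f ` I"
  proof -
    have "to_nat y < to_nat a" if "\<not> to_nat a < to_nat y" "y \<in> I" for y
      using that assms(2) injD[OF inj_to_nat, of y a] linorder_neqE_nat by blast
    then show ?thesis by (auto simp: image_iff f_def)
  qed
  have disj: "?P \<inter> f ` I = {}" using assms(2) by (auto simp: f_def split: if_splits)
  have inj: "inj_on f I" using assms(2) by (auto simp: inj_on_def f_def split: if_splits)
  have "pprod B (insert a I) = pprod B I * (\<Prod>y\<in>I. case f y of (x, y) \<Rightarrow> B x y)"
    unfolding pprod_def eq using assms(1)
    by (subst prod.union_disjoint[OF _ _ disj]) (simp_all add: finite_pairs prod.reindex[OF inj])
  also have "(\<Prod>y\<in>I. case f y of (x, y) \<Rightarrow> B x y)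
      = (\<Prod>y\<in>I. if to_nat a < to_nat y then B a y else B y a)"
    by (intro prod.cong) (auto simp: f_def)
  finally show ?thesis .
qed

lemma pprod_insert_sym:
  assumes "finite I" "a \<notin> I" "\<And>x y. B x y = B y x"
  shows "pprod B (insert a I) = pprod B I * (\<Prod>y\<in>I. B a y)"
  unfolding pprod_insert[OF assms(1,2)] using assms(3) by (metis (no_types, lifting))

text \<open>The sign \<kappa> is obtained before B is chosen: one sign serves all antisymmetric B,
  so it cancels when two products over the same index set are compared.\<close>

lemma pprod_insert_antisym:
  fixes a :: "'i::countable"
  assumes "finite I" "a \<notin> I"
  obtains \<kappa> :: "'a::comm_ring_1" where "\<kappa> * \<kappa> = 1"
    "\<And>B. (\<And>x y. B x y = - B y x) \<Longrightarrow> pprod B (insert a I) = \<kappa> * pprod B I * (\<Prod>y\<in>I. B a y)"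
proof
  let ?\<kappa> = "\<Prod>y\<in>I. if to_nat a < to_nat y then 1 else (-1 :: 'a)"
  show "?\<kappa> * ?\<kappa> = 1"
    unfolding prod.distrib[symmetric] by (intro prod.neutral) auto
  fix B :: "'i \<Rightarrow> 'i \<Rightarrow> 'a" assume B: "\<And>x y. B x y = - B y x"
  have "(\<Prod>y\<in>I. if to_nat a < to_nat y then B a y else B y a) = ?\<kappa> * (\<Prod>y\<in>I. B a y)"
    unfolding prod.distrib[symmetric] by (intro prod.cong) (use B[of a] in auto)
  then show "pprod B (insert a I) = ?\<kappa> * pprod B I * (\<Prod>y\<in>I. B a y)"
    unfolding pprod_insert[OF assms] by (simp add: mult_ac)
qed

text \<open>Discs are uncountable, so the complement of a countable set is dense. This is the common
  device for discarding exceptional parameters.\<close>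

lemma isCont_zero_off_countable:
  fixes G :: "complex \<Rightarrow> complex"
  assumes "isCont G a" "countable {t. G t \<noteq> 0}"
  shows "G a = 0"
proof (rule ccontr)
  assume "G a \<noteq> 0"
  then obtain e where e: "e > 0" "\<And>t. dist t a < e \<Longrightarrow> G t \<noteq> 0"
    using continuous_at_avoid[of a G 0] assms(1) by (auto simp: dist_commute)
  then have "ball a e \<subseteq> {t. G t \<noteq> 0}" by (auto simp: dist_commute)
  then have "countable (ball a e)" using assms(2) countable_subset by blast
  then show False using uncountable_ball[OF e(1), of a] by simp
qed

section \<open>Weights of sign choices and the evaluation of their sum\<close>

context odd_sigma
begin

lemma countable_zeros_affine:
  assumes "c \<noteq> 0"
  shows "countable {t. \<sigma> (a + c * t) = 0}"
proof -
  have "{t. \<sigma> (a + c * t) = 0} \<subseteq> (\<lambda>x. (x - a) / c) ` {x. \<sigma> x = 0}"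
    using assms by (auto simp: image_iff intro!: exI[of _ "a + c * _"])
  then show ?thesis using countable_zeros by (meson countable_image countable_subset)
qed

text \<open>v carries the signs. The factor of a pair vanishes where v x + v y = - \<delta>; for
  variables in arithmetic progression of step \<delta> this eliminates most sign choices.\<close>

definition wt :: "complex \<Rightarrow> complex \<Rightarrow> complex \<Rightarrow> complex
    \<Rightarrow> 'i::countable set \<Rightarrow> ('i \<Rightarrow> complex) \<Rightarrow> complex \<Rightarrow> complex" where
  "wt b1 b2 b3 b4 I v \<delta> =
     (\<Prod>x\<in>I. \<sigma> (b1 + v x) * \<sigma> (b2 + v x) * \<sigma> (b3 + v x) * \<sigma> (b4 + v x) / \<sigma> (2 * v x))
     * pprod (\<lambda>x y. \<sigma> (\<delta> + v x + v y) / \<sigma> (v x + v y)) I"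

definition flip :: "('i \<Rightarrow> complex) \<Rightarrow> 'i set \<Rightarrow> 'i \<Rightarrow> complex" where
  "flip z S x = (if x \<in> S then z x else - z x)"

lemma wt_cong:
  assumes "\<And>x. x \<in> I \<Longrightarrow> v x = v' x"
  shows "wt b1 b2 b3 b4 I v \<delta> = wt b1 b2 b3 b4 I v' \<delta>"
proof -
  have "pprod (\<lambda>x y. \<sigma> (\<delta> + v x + v y) / \<sigma> (v x + v y)) I
      = pprod (\<lambda>x y. \<sigma> (\<delta> + v' x + v' y) / \<sigma> (v' x + v' y)) I"
    by (rule pprod_cong) (simp add: assms)
  then show ?thesis unfolding wt_def using assms by simp
qed

lemma wt_insert:
  assumes "finite I" "a \<notin> I"
  shows "wt b1 b2 b3 b4 (insert a I) v \<delta>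
    = \<sigma> (b1 + v a) * \<sigma> (b2 + v a) * \<sigma> (b3 + v a) * \<sigma> (b4 + v a) / \<sigma> (2 * v a)
      * (\<Prod>y\<in>I. \<sigma> (\<delta> + v a + v y) / \<sigma> (v a + v y)) * wt b1 b2 b3 b4 I v \<delta>"
  unfolding wt_def using assms
  by (subst pprod_insert_sym) (auto simp: add_ac)

lemma wt_zero: 
  assumes "finite I" "a \<in> I" "v a = - b1"
  shows "wt b1 b2 b3 b4 I v \<delta> = 0"
  unfolding wt_def using assms by (auto intro!: bexI[of _ a])

text \<open>With v a = b1 the denominators \<sigma> (b1 + v y) of the pairs containing a cancel the
  first factor of each remaining y, and the numerators \<sigma> (b1 + \<delta> + v y) take its
  place.\<close>

lemma wt_reduce:
  assumes "finite I" "a \<notin> I" "v a = b1" "\<sigma> (2 * b1) \<noteq> 0"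
    "\<And>y. y \<in> I \<Longrightarrow> \<sigma> (b1 + v y) \<noteq> 0"
  shows "wt b1 b2 b3 b4 (insert a I) v \<delta>
    = \<sigma> (b1 + b2) * \<sigma> (b1 + b3) * \<sigma> (b1 + b4) * wt (b1 + \<delta>) b2 b3 b4 I v \<delta>"
proof -
  let ?P = "\<lambda>b x. \<sigma> (b + v x) * \<sigma> (b2 + v x) * \<sigma> (b3 + v x) * \<sigma> (b4 + v x) / \<sigma> (2 * v x)"
  let ?Q = "pprod (\<lambda>x y. \<sigma> (\<delta> + v x + v y) / \<sigma> (v x + v y)) I"
  have "\<sigma> (\<delta> + b1 + v x) / \<sigma> (b1 + v x) * ?P b1 x = ?P (b1 + \<delta>) x" if "x \<in> I" for x
  proof -
    have "\<sigma> (\<delta> + b1 + v x) = \<sigma> (b1 + \<delta> + v x)" by (simp add: add.commute)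
    then show ?thesis using assms(5)[OF that] by simp
  qed
  then have "(\<Prod>x\<in>I. \<sigma> (\<delta> + b1 + v x) / \<sigma> (b1 + v x)) * prod (?P b1) I = prod (?P (b1 + \<delta>)) I"
    unfolding prod.distrib[symmetric] by (rule prod.cong[OF refl])
  then have 1: "(\<Prod>y\<in>I. \<sigma> (\<delta> + v a + v y) / \<sigma> (v a + v y)) * wt b1 b2 b3 b4 I v \<delta>
      = wt (b1 + \<delta>) b2 b3 b4 I v \<delta>"
    unfolding wt_def assms(3) mult.assoc[symmetric] by (rule arg_cong[where f = "\<lambda>t. t * ?Q"])
  have 2: "\<sigma> (b1 + b1) * \<sigma> (b2 + b1) * \<sigma> (b3 + b1) * \<sigma> (b4 + b1) / \<sigma> (2 * b1)
      = \<sigma> (b1 + b2) * \<sigma> (b1 + b3) * \<sigma> (b1 + b4)"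
    using assms(4) unfolding mult_2[of b1]
    by (simp add: add.commute[of b2 b1] add.commute[of b3 b1] add.commute[of b4 b1])
  show ?thesis
    unfolding wt_insert[OF assms(1,2)] mult.assoc[of _ "prod _ I" "wt _ _ _ _ _ _ _"] 1
    unfolding assms(3) 2 ..
qed

text \<open>The variable \<beta> enters only through \<sigma> (h + \<beta> + v) \<sigma> (h -
  \<beta> + v), which is \<open>s2 (h + v) \<beta>\<close>: one linear form per element of
  I.\<close>

lemma wt_sum_H:
  assumes "finite I"
  shows "(card I, \<lambda>\<beta>. \<Sum>S\<in>Pow I. wt (h + \<beta>) (h - \<beta>) b3 b4 I (flip z S) \<delta>) \<in> H"
proof (rule H_sum)
  fix S
  let ?v = "flip z S"
  have "wt (h + \<beta>) (h - \<beta>) b3 b4 I ?v \<delta>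
      = (\<Prod>x\<in>I. \<sigma> (b3 + ?v x) * \<sigma> (b4 + ?v x) / \<sigma> (2 * ?v x))
      * pprod (\<lambda>x y. \<sigma> (\<delta> + ?v x + ?v y) / \<sigma> (?v x + ?v y)) I
      * (\<Prod>x\<in>I. s2 (h + ?v x) \<beta>)" for \<beta>
  proof -
    have "(\<Prod>x\<in>I. \<sigma> (h + \<beta> + ?v x) * \<sigma> (h - \<beta> + ?v x) * \<sigma> (b3 + ?v x) * \<sigma> (b4 + ?v x) / \<sigma> (2 * ?v x))
      = (\<Prod>x\<in>I. \<sigma> (b3 + ?v x) * \<sigma> (b4 + ?v x) / \<sigma> (2 * ?v x)) * (\<Prod>x\<in>I. s2 (h + ?v x) \<beta>)"
      unfolding prod.distrib[symmetric] by (intro prod.cong refl) (simp add: s2_def algebra_simps)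
    then show ?thesis unfolding wt_def by (simp add: mult_ac)
  qed
  then show "(card I, \<lambda>\<beta>. wt (h + \<beta>) (h - \<beta>) b3 b4 I ?v \<delta>) \<in> H"
    using H_prod[OF assms] by simp
qed (use assms in simp)

text \<open>Once the product with b4 is read in reverse order, the balancing condition turns each of
  its factors into the partner of a factor with b3, and the two form an \<open>s2\<close>.\<close>

lemma wt_rhs_H:
  assumes "2 * h + b3 + b4 + of_nat m * \<delta> = \<delta>"
  shows "(m, \<lambda>\<beta>. \<Prod>i<m. \<sigma> (2 * h + of_nat i * \<delta>) * \<sigma> (h + \<beta> + b3 + of_nat i * \<delta>)
            * \<sigma> (h + \<beta> + b4 + of_nat i * \<delta>)) \<in> H"
proof -
  have "(\<Prod>i<m. \<sigma> (2 * h + of_nat i * \<delta>) * \<sigma> (h + \<beta> + b3 + of_nat i * \<delta>)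
            * \<sigma> (h + \<beta> + b4 + of_nat i * \<delta>))
      = (\<Prod>i<m. - \<sigma> (2 * h + of_nat i * \<delta>)) * (\<Prod>i<m. s2 (h + b3 + of_nat i * \<delta>) \<beta>)" for \<beta>
  proof -
    have "(\<Prod>i<m. \<sigma> (h + \<beta> + b4 + of_nat i * \<delta>))
        = (\<Prod>i<m. \<sigma> (h + \<beta> + b4 + of_nat (m - Suc i) * \<delta>))"
      by (rule prod.nat_diff_reindex[symmetric])
    also have "\<dots> = (\<Prod>i<m. - \<sigma> (h + b3 + of_nat i * \<delta> - \<beta>))"
    proof (intro prod.cong refl)
      fix i assume "i \<in> {..<m}"
      then have "of_nat (m - Suc i) * \<delta> = of_nat m * \<delta> - \<delta> - of_nat i * \<delta>"
        by (simp add: of_nat_diff algebra_simps)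
      also have "of_nat m * \<delta> = \<delta> - 2 * h - b3 - b4" using assms by (simp add: algebra_simps)
      finally have "h + \<beta> + b4 + of_nat (m - Suc i) * \<delta> = - (h + b3 + of_nat i * \<delta> - \<beta>)"
        by (simp add: algebra_simps)
      then show "\<sigma> (h + \<beta> + b4 + of_nat (m - Suc i) * \<delta>) = - \<sigma> (h + b3 + of_nat i * \<delta> - \<beta>)"
        by (simp only: odd)
    qed
    finally show ?thesis
      by (simp add: prod.distrib s2_def mult_ac add_ac prod_uminus)
  qed
  then show ?thesis
    using H_prod[of "{..<m}" "\<Prod>i<m. - \<sigma> (2 * h + of_nat i * \<delta>)" "\<lambda>i. h + b3 + of_nat i * \<delta>"]
    by simp
qed

lemma continuous_on_sigma:
  assumes "continuous_on A f"
  shows "continuous_on A (\<lambda>t. \<sigma> (f t))"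
  using continuous_on_compose2[OF cont assms] by simp

lemma wt_continuous:
  assumes "continuous_on UNIV b1" "continuous_on UNIV b2" "continuous_on UNIV b3"
    "continuous_on UNIV b4"
  shows "continuous_on UNIV (\<lambda>t. wt (b1 t) (b2 t) (b3 t) (b4 t) I v \<delta>)"
  unfolding wt_def divide_inverse
  by (intro continuous_on_mult continuous_on_prod continuous_on_sigma continuous_on_add
      continuous_on_const assms)

lemma sum_Pow_insert:
  fixes f :: "'b set \<Rightarrow> complex"
  assumes "finite I" "a \<notin> I"
  shows "(\<Sum>S\<in>Pow (insert a I). f S) = (\<Sum>S\<in>Pow I. f S) + (\<Sum>S\<in>Pow I. f (insert a S))"
proof -
  have "Pow I \<inter> insert a ` Pow I = {}" "inj_on (insert a) (Pow I)"
    using assms(2) by (auto simp: inj_on_def)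
  then show ?thesis unfolding Pow_insert using assms(1)
    by (simp add: sum.union_disjoint sum.reindex)
qed

text \<open>As a function of \<open>\<beta>\<close>, where \<open>b1 = h + \<beta>\<close> and \<open>b2 = h - \<beta>\<close>, both sides are polynomials of degree
  \<open>card I\<close> in the sense of \<open>H\<close>. If \<open>b1 = z a\<close> or \<open>b1 = - z a\<close>, then only one choice of sign survives
  at \<open>a\<close>, and \<open>a\<close> drops out at the cost of replacing \<open>b1\<close> by \<open>b1 + \<delta>\<close>.\<close>

theorem wt_sum:
  fixes I :: "'i::countable set"
  assumes "finite I" "\<And>x. x \<in> I \<Longrightarrow> \<sigma> (2 * z x) \<noteq> 0"
    and "\<And>x y. x \<in> I \<Longrightarrow> y \<in> I \<Longrightarrow> x \<noteq> y \<Longrightarrow> s2 (z x) (z y) \<noteq> 0"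
    and "b1 + b2 + b3 + b4 + of_nat (card I) * \<delta> = \<delta>"
  shows "(\<Sum>S\<in>Pow I. wt b1 b2 b3 b4 I (flip z S) \<delta>)
    = (\<Prod>i<card I. \<sigma> (b1 + b2 + of_nat i * \<delta>) * \<sigma> (b1 + b3 + of_nat i * \<delta>)
        * \<sigma> (b1 + b4 + of_nat i * \<delta>))"
  using assms
proof (induction "card I" arbitrary: I b1 b2 b3 b4)
  case 0
  then show ?case by (simp add: wt_def)
next
  case (Suc m)
  let ?L = "\<lambda>b1 b2 b3 b4. \<Sum>S\<in>Pow I. wt b1 b2 b3 b4 I (flip z S) \<delta>"
  let ?R = "\<lambda>b1 b2 b3 b4. \<Prod>i<card I. \<sigma> (b1 + b2 + of_nat i * \<delta>) * \<sigma> (b1 + b3 + of_nat i * \<delta>)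
        * \<sigma> (b1 + b4 + of_nat i * \<delta>)"
  have card: "card I = Suc m" using Suc.hyps by simp
  have step: "?L b1 b2 b3 b4 = ?R b1 b2 b3 b4"
    if a: "a \<in> I" and b1: "b1 = z a \<or> b1 = - z a"
      and bal: "b1 + b2 + b3 + b4 + of_nat (card I) * \<delta> = \<delta>" for a b1 b2 b3 b4
  proof -
    define I' where "I' = I - {a}"
    have I': "I = insert a I'" "a \<notin> I'" "finite I'" "card I' = m"
      using a card Suc.prems(1) by (auto simp: I'_def)
    have nz: "\<sigma> (2 * b1) \<noteq> 0"
      using b1 Suc.prems(2)[OF a] odd[of "2 * z a"] by auto
    have nz': "\<sigma> (b1 + flip z S y) \<noteq> 0" if "y \<in> I'" for S y
    proof -
      have "s2 (z a) (z y) \<noteq> 0" using Suc.prems(3)[of a y] a that by (auto simp: I'_def)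
      then have "\<sigma> (z a + z y) \<noteq> 0" "\<sigma> (z a - z y) \<noteq> 0" by (auto simp: s2_def)
      then show ?thesis
        using b1 odd[of "z a + z y"] odd[of "z a - z y"] by (auto simp: flip_def)
    qed
    let ?c = "\<sigma> (b1 + b2) * \<sigma> (b1 + b3) * \<sigma> (b1 + b4)"
    have ins: "wt c1 c2 c3 c4 I' (flip z (insert a S)) \<delta> = wt c1 c2 c3 c4 I' (flip z S) \<delta>" 
      for S c1 c2 c3 c4 by (rule wt_cong) (use I' in \<open>auto simp: flip_def\<close>)
    have "?L b1 b2 b3 b4 = ?c * (\<Sum>S\<in>Pow I'. wt (b1 + \<delta>) b2 b3 b4 I' (flip z S) \<delta>)"
    proof (cases "b1 = z a")
      case True
      have "wt b1 b2 b3 b4 I (flip z S) \<delta> = 0" if "S \<in> Pow I'" for S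
        by (rule wt_zero[OF Suc.prems(1) a]) (use that I' True in \<open>auto simp: flip_def\<close>)
      moreover have "wt b1 b2 b3 b4 I (flip z (insert a S)) \<delta>
          = ?c * wt (b1 + \<delta>) b2 b3 b4 I' (flip z S) \<delta>" if "S \<in> Pow I'" for S
      proof -
        have "wt b1 b2 b3 b4 (insert a I') (flip z (insert a S)) \<delta>
            = ?c * wt (b1 + \<delta>) b2 b3 b4 I' (flip z (insert a S)) \<delta>"
          by (rule wt_reduce[of I' a "flip z (insert a S)" b1, OF I'(3,2) _ nz nz'])
            (simp add: flip_def True)
        then show ?thesis by (simp only: ins I'(1)[symmetric])
      qed
      ultimately show ?thesis
        unfolding sum_Pow_insert[OF I'(3,2), folded I'(1)] by (simp add: sum_distrib_left)
    next
      case False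
      then have b1: "b1 = - z a" using b1 by simp
      have "wt b1 b2 b3 b4 I (flip z (insert a S)) \<delta> = 0" if "S \<in> Pow I'" for S
        by (rule wt_zero[OF Suc.prems(1) a]) (use that I' b1 in \<open>auto simp: flip_def\<close>)
      moreover have "wt b1 b2 b3 b4 I (flip z S) \<delta>
          = ?c * wt (b1 + \<delta>) b2 b3 b4 I' (flip z S) \<delta>" if "S \<in> Pow I'" for S
      proof -
        have "flip z S a = b1" using that I'(2) by (auto simp: flip_def b1)
        have "wt b1 b2 b3 b4 (insert a I') (flip z S) \<delta>
            = ?c * wt (b1 + \<delta>) b2 b3 b4 I' (flip z S) \<delta>"
          by (rule wt_reduce[of I' a "flip z S" b1, OF I'(3,2) \<open>flip z S a = b1\<close> nz nz'])
        then show ?thesis by (simp only: I'(1)[symmetric])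
      qed
      ultimately show ?thesis
        unfolding sum_Pow_insert[OF I'(3,2), folded I'(1)] by (simp add: sum_distrib_left)
    qed
    also have "(\<Sum>S\<in>Pow I'. wt (b1 + \<delta>) b2 b3 b4 I' (flip z S) \<delta>)
        = (\<Prod>i<card I'. \<sigma> (b1 + \<delta> + b2 + of_nat i * \<delta>) * \<sigma> (b1 + \<delta> + b3 + of_nat i * \<delta>)
        * \<sigma> (b1 + \<delta> + b4 + of_nat i * \<delta>))"
    proof (rule Suc.hyps(1))
      show "b1 + \<delta> + b2 + b3 + b4 + of_nat (card I') * \<delta> = \<delta>"
        using bal unfolding card I'(4) by (simp add: algebra_simps)
      show "\<sigma> (2 * z x) \<noteq> 0" if "x \<in> I'" for x
        using Suc.prems(2)[of x] that I'(1) by blast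
      show "s2 (z x) (z y) \<noteq> 0" if "x \<in> I'" "y \<in> I'" "x \<noteq> y" for x y
        using Suc.prems(3)[of x y] that I'(1) by blast
    qed (use I' in simp_all)
    also have "\<dots> = (\<Prod>i<m. \<sigma> (b1 + b2 + of_nat (Suc i) * \<delta>) * \<sigma> (b1 + b3 + of_nat (Suc i) * \<delta>)
        * \<sigma> (b1 + b4 + of_nat (Suc i) * \<delta>))"
      unfolding I'(4) by (intro prod.cong refl) (simp add: algebra_simps)
    also have "?c * \<dots> = ?R b1 b2 b3 b4"
      unfolding card prod.lessThan_Suc_shift by simp
    finally show ?thesis .
  qed
  obtain a where a: "a \<in> I" using card by (metis card.empty equals0I nat.distinct(1))
  \<comment> \<open>Here b1 + b2 = 2 h, and \<open>bad\<close> covers all coincidences among the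
    nodes z x - h and - z a - h used for interpolation below.\<close>
  define bad where "bad s \<longleftrightarrow> (\<exists>x\<in>I. (\<exists>y\<in>I. \<sigma> (z x + z y - s) = 0) \<or> \<sigma> (z x - z a - s) = 0)" for s
  have good: "?L b1 b2 b3 b4 = ?R b1 b2 b3 b4"
    if bal: "b1 + b2 + b3 + b4 + of_nat (card I) * \<delta> = \<delta>" and nb: "\<not> bad (b1 + b2)" for b1 b2 b3 b4
  proof -
    define h where "h = (b1 + b2) / 2"
    have h: "b1 + b2 = 2 * h" by (simp add: h_def)
    have bal': "2 * h + b3 + b4 + of_nat (card I) * \<delta> = \<delta>" using bal h by simp
    let ?f = "\<lambda>\<beta>. ?L (h + \<beta>) (h - \<beta>) b3 b4 + (-1) * ?R (h + \<beta>) (h - \<beta>) b3 b4"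
    have "(card I, ?f) \<in> H"
    proof (intro H.add H.scale wt_sum_H Suc.prems(1))
      have "(h + \<beta>) + (h - \<beta>) = 2 * h" for \<beta> by simp
      then show "(card I, \<lambda>\<beta>. ?R (h + \<beta>) (h - \<beta>) b3 b4) \<in> H"
        using wt_rhs_H[OF bal'] by simp
    qed
    then have "?f \<beta> = 0" for \<beta>
    \<comment> \<open>Degree \<open>card I\<close> requires one node more than I has elements; both
      signs of the single element a are used to get it.\<close>
    proof (rule H_vanish[where B = "insert (- z a - h) ((\<lambda>x. z x - h) ` I)"])
      have z: "\<sigma> (z x - z y) \<noteq> 0" "\<sigma> (z x + z y) \<noteq> 0"
        if "x \<in> I" "y \<in> I" "x \<noteq> y" for x y
        using Suc.prems(3)[OF that] by (auto simp: s2_def)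
      then have inj: "inj_on (\<lambda>x. z x - h) I"
        by (intro inj_onI) (metis add.right_neutral diff_add_cancel diff_self zero)
      have "- z a - h \<noteq> z x - h" if "x \<in> I" for x
      proof
        assume "- z a - h = z x - h"
        then have "z x + z a = 0" by (metis add.commute add.right_inverse diff_add_cancel)
        then show False
          using z(2)[OF that a] Suc.prems(2)[OF a] by (metis mult_2 zero)
      qed
      then have "- z a - h \<notin> (\<lambda>x. z x - h) ` I" by auto
      then show "card (insert (- z a - h) ((\<lambda>x. z x - h) ` I)) > card I"
        using Suc.prems(1) inj by (simp add: card_image)
      have nb1: "\<sigma> (z x + z y - 2 * h) \<noteq> 0" and nb2: "\<sigma> (z x - z a - 2 * h) \<noteq> 0"
        if "x \<in> I" "y \<in> I" for x y
        using nb that unfolding bad_def h by auto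
      have A: "s2 (z x - h) (z y - h) \<noteq> 0" if "x \<in> I" "y \<in> I" "x \<noteq> y" for x y
      proof -
        have "s2 (z x - h) (z y - h) = \<sigma> (z x + z y - 2 * h) * \<sigma> (z x - z y)"
          by (simp add: s2_def algebra_simps)
        then show ?thesis using nb1 z that by simp
      qed
      have B: "s2 (z x - h) (- z a - h) \<noteq> 0" if "x \<in> I" for x
      proof -
        have "s2 (z x - h) (- z a - h) = \<sigma> (z x - z a - 2 * h) * \<sigma> (z x + z a)"
          by (simp add: s2_def algebra_simps)
        moreover have "\<sigma> (z x + z a) \<noteq> 0"
          using z(2)[OF that a] Suc.prems(2)[OF a] by (metis mult_2)
        ultimately show ?thesis using nb2 that by simp
      qed
      show "s2 x y \<noteq> 0" if "x \<in> insert (- z a - h) ((\<lambda>x. z x - h) ` I)"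
        "y \<in> insert (- z a - h) ((\<lambda>x. z x - h) ` I)" "x \<noteq> y" for x y
        using that A B s2_swap[of "- z a - h"] by auto
      show "?f x = 0" if "x \<in> insert (- z a - h) ((\<lambda>x. z x - h) ` I)" for x
      proof -
        from that consider "x = - z a - h" | y where "y \<in> I" "x = z y - h" by blast
        then obtain b where b: "b \<in> I" "h + x = z b \<or> h + x = - z b"
          using a by cases (auto simp: algebra_simps)
        have "?L (h + x) (h - x) b3 b4 = ?R (h + x) (h - x) b3 b4"
          by (rule step[OF b]) (use bal' in \<open>simp add: algebra_simps\<close>)
        then show ?thesis by simp
      qed
    qed (use Suc.prems(1) in simp)
    from this[of "(b1 - b2) / 2"]
    have "?L (h + (b1 - b2) / 2) (h - (b1 - b2) / 2) b3 b4 = ?R (h + (b1 - b2) / 2) (h - (b1 - b2) / 2) b3 b4"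
      by simp
    moreover have "h + (b1 - b2) / 2 = b1" "h - (b1 - b2) / 2 = b2" by (simp_all add: h_def field_simps)
    ultimately show ?thesis by simp
  qed
  have ctr: "countable {t. \<sigma> (c - t) = 0}" for c
    using countable_zeros_affine[of "-1" c] by simp
  have "countable {t. bad (b1 + b2 + t)}"
  proof (rule countable_subset)
    show "{t. bad (b1 + b2 + t)} \<subseteq> (\<Union>x\<in>I. (\<Union>y\<in>I. {t. \<sigma> (z x + z y - (b1 + b2) - t) = 0})
        \<union> {t. \<sigma> (z x - z a - (b1 + b2) - t) = 0})"
      unfolding bad_def by (auto simp: algebra_simps)
  qed (intro countable_UN countable_Un ctr countable_finite Suc.prems(1))
  \<comment> \<open>Moving b1 and b3 in opposite directions keeps the balancing condition while b1 +
    b2 leaves the bad set.\<close>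
  let ?G = "\<lambda>t. ?L (b1 + t) b2 (b3 - t) b4 - ?R (b1 + t) b2 (b3 - t) b4"
  have "?G 0 = 0"
  proof (rule isCont_zero_off_countable[where G = ?G and a = 0])
    have "continuous_on UNIV ?G"
      by (intro continuous_intros continuous_on_sigma wt_continuous)
    then show "isCont ?G 0" by (simp add: continuous_on_eq_continuous_at)
    have "?G t = 0" if "\<not> bad (b1 + b2 + t)" for t
    proof -
      have "b1 + t + b2 + (b3 - t) + b4 + of_nat (card I) * \<delta> = \<delta>" "\<not> bad (b1 + t + b2)"
        using Suc.prems(4) that by (simp_all add: algebra_simps)
      from good[OF this] show ?thesis by simp
    qed
    then have "{t. ?G t \<noteq> 0} \<subseteq> {t. bad (b1 + b2 + t)}" by blast
    then show "countable {t. ?G t \<noteq> 0}"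
      using \<open>countable {t. bad (b1 + b2 + t)}\<close> countable_subset by blast
  qed
  then show ?case by simp
qed

end

section \<open>Interpolation and inversion\<close>

lemma sum_PiE_insert:
  fixes f :: "('i \<Rightarrow> 'b) \<Rightarrow> 'c::comm_monoid_add"
  assumes "a \<notin> R"
  shows "(\<Sum>n\<in>PiE (insert a R) A. f n) = (\<Sum>s\<in>A a. \<Sum>n\<in>PiE R A. f (n(a := s)))"
  unfolding PiE_insert_eq
  by (subst sum.reindex[OF inj_combinator[OF assms]])
    (simp add: sum.cartesian_product case_prod_unfold)

context odd_sigma
begin

text \<open>Expand with respect to the coordinate \<open>i0\<close>: summing that coordinate over all points gives zero by
  partial fractions, and summing it over the points of another coordinate \<open>i\<close> gives zero because the
  summand is antisymmetric in the coordinates \<open>i0\<close> and \<open>i\<close>.\<close>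

lemma sum_antisymmetric_residues:
  fixes R :: "'i::countable set" and c :: "'i \<Rightarrow> 's \<Rightarrow> complex" and A :: "'i \<Rightarrow> 's set"
  defines "X \<equiv> Sigma R A"
  assumes R: "finite R" "R \<noteq> {}" and A: "\<And>i. i \<in> R \<Longrightarrow> finite (A i)"
    and card: "card X = d + card R + 1" and g: "(d, g) \<in> H"
    and nz: "\<And>x y. x \<in> X \<Longrightarrow> y \<in> X \<Longrightarrow> x \<noteq> y \<Longrightarrow> s2 (case_prod c x) (case_prod c y) \<noteq> 0"
  shows "(\<Sum>n\<in>PiE R A. pprod (\<lambda>i j. s2 (c i (n i)) (c j (n j))) R
      * (\<Prod>j\<in>R. g (c j (n j)) / (\<Prod>y\<in>X-{(j, n j)}. s2 (case_prod c y) (c j (n j))))) = 0"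
proof -
  have X: "finite X" unfolding X_def using R A by auto
  obtain i0 where i0: "i0 \<in> R" using R by blast
  define R' where "R' = R - {i0}"
  have R': "R = insert i0 R'" "i0 \<notin> R'" "finite R'" using i0 R by (auto simp: R'_def)
  define C where "C = case_prod c"
  define G where "G x = g (C x) / (\<Prod>y\<in>X-{x}. s2 (C y) (C x))" for x
  obtain \<kappa> :: complex where \<kappa>: "\<And>B. (\<And>x y. B x y = - B y x) \<Longrightarrow>
      pprod B (insert i0 R') = \<kappa> * pprod B R' * (\<Prod>y\<in>R'. B i0 y)"
    using pprod_insert_antisym[OF R'(3,2)] by blast
  \<comment> \<open>The coordinate i0 is placed at an arbitrary point x of X, possibly in another
    chain; the sum in question uses only x in chain i0.\<close>
  define T where "T x n = \<kappa> * pprod (\<lambda>i j. s2 (c i (n i)) (c j (n j))) R'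
      * (\<Prod>j\<in>R'. s2 (C x) (c j (n j))) * G x * (\<Prod>j\<in>R'. G (j, n j))" for x n
  have expand: "pprod (\<lambda>i j. s2 (c i (n i)) (c j (n j))) R * (\<Prod>j\<in>R. G (j, n j)) = T (i0, s) n'"
    if n: "n = n'(i0 := s)" for n n' s
  proof -
    have ne: "j \<noteq> i0" if "j \<in> R'" for j using that R' by auto
    have "pprod (\<lambda>i j. s2 (c i (n i)) (c j (n j))) R
        = \<kappa> * pprod (\<lambda>i j. s2 (c i (n i)) (c j (n j))) R' * (\<Prod>j\<in>R'. s2 (c i0 (n i0)) (c j (n j)))"
      unfolding R'(1) by (rule \<kappa>) (rule s2_swap)
    also have "pprod (\<lambda>i j. s2 (c i (n i)) (c j (n j))) R' = pprod (\<lambda>i j. s2 (c i (n' i)) (c j (n' j))) R'"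
      by (rule pprod_cong) (use ne n in auto)
    also have "(\<Prod>j\<in>R'. s2 (c i0 (n i0)) (c j (n j))) = (\<Prod>j\<in>R'. s2 (C (i0, s)) (c j (n' j)))"
      by (intro prod.cong) (use ne n in \<open>auto simp: C_def\<close>)
    finally have 1: "pprod (\<lambda>i j. s2 (c i (n i)) (c j (n j))) R
        = \<kappa> * pprod (\<lambda>i j. s2 (c i (n' i)) (c j (n' j))) R' * (\<Prod>j\<in>R'. s2 (C (i0, s)) (c j (n' j)))" .
    have "(\<Prod>j\<in>R. G (j, n j)) = G (i0, n i0) * (\<Prod>j\<in>R'. G (j, n j))"
      unfolding R'(1) using R' by simp
    also have "(\<Prod>j\<in>R'. G (j, n j)) = (\<Prod>j\<in>R'. G (j, n' j))"
      by (intro prod.cong) (use ne n in auto)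
    finally have 2: "(\<Prod>j\<in>R. G (j, n j)) = G (i0, s) * (\<Prod>j\<in>R'. G (j, n' j))" using n by simp
    show ?thesis unfolding 1 2 T_def by (simp only: mult_ac)
  qed
  have "(\<Sum>n\<in>PiE R A. pprod (\<lambda>i j. s2 (c i (n i)) (c j (n j))) R * (\<Prod>j\<in>R. G (j, n j)))
      = (\<Sum>s\<in>A i0. \<Sum>n'\<in>PiE R' A. T (i0, s) n')"
    unfolding R'(1) sum_PiE_insert[OF R'(2)] unfolding R'(1)[symmetric]
    by (intro sum.cong refl expand)
  also have "\<dots> = (\<Sum>n\<in>PiE R' A. \<Sum>s\<in>A i0. T (i0, s) n)" by (rule sum.swap)
  finally have S0: "(\<Sum>n\<in>PiE R A. pprod (\<lambda>i j. s2 (c i (n i)) (c j (n j))) R * (\<Prod>j\<in>R. G (j, n j)))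
      = (\<Sum>n\<in>PiE R' A. \<Sum>s\<in>A i0. T (i0, s) n)" .
  have all: "(\<Sum>x\<in>X. T x n) = 0" for n
  proof -
    define f where "f t = g t * (\<Prod>j\<in>R'. s2 (c j (n j)) t)" for t
    have "(d + card R', f) \<in> H" unfolding f_def by (rule H_mult_prod[OF R'(3) g])
    \<comment> \<open>The |R| - 1 differences to the other coordinates raise the degree of g to
      exactly two less than the number of points.\<close>
    moreover have "card X = d + card R' + 2" using card R' by simp
    ultimately have "(\<Sum>x\<in>X. f (C x) / (\<Prod>y\<in>X-{x}. s2 (C y) (C x))) = 0"
      by (rule H_partial_fractions[where c = C, OF _ X]) (rule nz[folded C_def])
    moreover have "T x n = (\<kappa> * pprod (\<lambda>i j. s2 (c i (n i)) (c j (n j))) R' * (\<Prod>j\<in>R'. G (j, n j)) * (\<Prod>j\<in>R'. -1))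
        * (f (C x) / (\<Prod>y\<in>X-{x}. s2 (C y) (C x)))" for x
    proof -
      have "(\<Prod>j\<in>R'. s2 (C x) (c j (n j))) = (\<Prod>j\<in>R'. -1) * (\<Prod>j\<in>R'. s2 (c j (n j)) (C x))"
        unfolding prod.distrib[symmetric] mult_minus1 by (intro prod.cong refl s2_swap)
      then show ?thesis unfolding T_def G_def f_def by (simp add: mult_ac)
    qed
    ultimately show ?thesis by (simp only: sum_distrib_left[symmetric] mult_zero_right)
  qed
  have other: "(\<Sum>n\<in>PiE R' A. \<Sum>s\<in>A i. T (i, s) n) = 0" if i: "i \<in> R'" for i
  proof -
    define R'' where "R'' = R' - {i}"
    have R'': "R' = insert i R''" "i \<notin> R''" "finite R''" using i R' by (auto simp: R''_def)
    obtain \<kappa>' :: complex where \<kappa>': "\<And>B. (\<And>x y. B x y = - B y x) \<Longrightarrow>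
        pprod B (insert i R'') = \<kappa>' * pprod B R'' * (\<Prod>y\<in>R''. B i y)"
      using pprod_insert_antisym[OF R''(3,2)] by blast
    define U where "U n s = T (i, s) n" for n s
    \<comment> \<open>Both s and n i are points of the same chain i; exchanging them affects only
      the factor \<open>s2 (c i s) (c i (n i))\<close>.\<close>
    have swap: "U (n(i := s)) (n i) = - U n s" for n s
    proof -
      let ?n = "n(i := s)"
      have E: "U n s = \<kappa> * (\<kappa>' * pprod (\<lambda>i j. s2 (c i (n i)) (c j (n j))) R''
            * (\<Prod>j\<in>R''. s2 (c i (n i)) (c j (n j))))
          * (s2 (c i s) (c i (n i)) * (\<Prod>j\<in>R''. s2 (c i s) (c j (n j))))
          * G (i, s) * (G (i, n i) * (\<Prod>j\<in>R''. G (j, n j)))" for n s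
      proof -
        have "pprod (\<lambda>i j. s2 (c i (n i)) (c j (n j))) R'
            = \<kappa>' * pprod (\<lambda>i j. s2 (c i (n i)) (c j (n j))) R'' * (\<Prod>j\<in>R''. s2 (c i (n i)) (c j (n j)))"
          unfolding R''(1) by (rule \<kappa>') (rule s2_swap)
        then show ?thesis unfolding U_def T_def R''(1) using R''(2,3) by (simp add: C_def)
      qed
      have ne: "j \<noteq> i" if "j \<in> R''" for j using that R'' by auto
      have 1: "pprod (\<lambda>i j. s2 (c i (?n i)) (c j (?n j))) R'' = pprod (\<lambda>i j. s2 (c i (n i)) (c j (n j))) R''"
        by (rule pprod_cong) (use ne in auto)
      have 2: "(\<Prod>j\<in>R''. f j (?n j)) = (\<Prod>j\<in>R''. f j (n j))" for f :: "'i \<Rightarrow> 's \<Rightarrow> complex"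
        by (intro prod.cong) (use ne in auto)
      show ?thesis
        unfolding E[of ?n] 1 2[of "\<lambda>j s'. s2 (c i (?n i)) (c j s')"] 2[of "\<lambda>j s'. s2 (c i (n i)) (c j s')"]
          2[of "\<lambda>j s'. G (j, s')"]
        unfolding E[of n s] using s2_swap[of "c i s" "c i (n i)"] by simp
    qed
    let ?Q = "PiE R' A \<times> A i"
    have upd: "n(i := s) \<in> PiE R' A \<and> n i \<in> A i" if "n \<in> PiE R' A" "s \<in> A i" for n s
      using that i by (auto simp: PiE_iff extensional_def)
    have "(\<Sum>(n, s)\<in>?Q. U n s) = (\<Sum>(n, s)\<in>?Q. - U n s)"
    proof (rule sum.reindex_bij_witness[of _ "\<lambda>(n, s). (n(i := s), n i)" "\<lambda>(n, s). (n(i := s), n i)"])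
      show "(case case x of (n, s) \<Rightarrow> (n(i := s), n i) of (n, s) \<Rightarrow> - U n s)
          = (case x of (n, s) \<Rightarrow> U n s)" for x
        by (cases x) (simp add: swap)
    qed (use upd in auto)
    then have "(\<Sum>(n, s)\<in>?Q. U n s) = 0"
      by (simp add: case_prod_unfold sum_negf)
    then show ?thesis by (simp add: sum.cartesian_product U_def)
  qed
  have "(\<Sum>s\<in>A i0. T (i0, s) n) = - (\<Sum>i\<in>R'. \<Sum>s\<in>A i. T (i, s) n)" for n
  proof -
    have "(\<Sum>x\<in>X. T x n) = (\<Sum>i\<in>R. \<Sum>s\<in>A i. T (i, s) n)"
      unfolding X_def using R A by (subst sum.Sigma) auto
    then have "0 = (\<Sum>s\<in>A i0. T (i0, s) n) + (\<Sum>i\<in>R'. \<Sum>s\<in>A i. T (i, s) n)"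
      unfolding all R'(1) sum.insert[OF R'(3,2)] .
    then show ?thesis by (simp add: eq_neg_iff_add_eq_0)
  qed
  then have "(\<Sum>n\<in>PiE R' A. \<Sum>s\<in>A i0. T (i0, s) n)
      = (\<Sum>n\<in>PiE R' A. - (\<Sum>i\<in>R'. \<Sum>s\<in>A i. T (i, s) n))"
    by (rule sum.cong[OF refl])
  also have "\<dots> = - (\<Sum>i\<in>R'. \<Sum>n\<in>PiE R' A. \<Sum>s\<in>A i. T (i, s) n)"
    unfolding sum_negf by (subst sum.swap) simp
  also have "\<dots> = 0" using other by simp
  finally show ?thesis using S0 unfolding G_def C_def by simp
qed

text \<open>The numerator vanishes at the first l i nodes of each chain i, which makes the matrix of
  values at the nodes triangular. Numerator and denominator have the same number |l| of
  factors.\<close>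

definition newton :: "'i set \<Rightarrow> ('i \<Rightarrow> nat \<Rightarrow> complex) \<Rightarrow> (nat \<Rightarrow> complex) \<Rightarrow> ('i \<Rightarrow> nat) \<Rightarrow> complex \<Rightarrow> complex" where
  "newton R c h l w = (\<Prod>x\<in>Sigma R (\<lambda>i. {..<l i}). s2 (case_prod c x) w) / (\<Prod>y<sum l R. s2 (h y) w)"

text \<open>Up to normalisation the rows of the inverse of the triangular matrix of
  \<open>newton\<close>. The product over h has one factor less than in \<open>newton\<close>; this
  gives the degree needed for partial fractions.\<close>

definition dual :: "'i::countable set \<Rightarrow> ('i \<Rightarrow> nat \<Rightarrow> complex) \<Rightarrow> (nat \<Rightarrow> complex) \<Rightarrow> ('i \<Rightarrow> nat)
    \<Rightarrow> ('i \<Rightarrow> nat) \<Rightarrow> complex" where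
  "dual R c h k n = pprod (\<lambda>i j. s2 (c i (n i)) (c j (n j))) R
     * (\<Prod>j\<in>R. (\<Prod>y<sum k R - 1. s2 (h y) (c j (n j)))
        / (\<Prod>x\<in>Sigma R (\<lambda>i. {..k i}) - {(j, n j)}. s2 (case_prod c x) (c j (n j))))"

lemma newton_eq_0:
  assumes "finite R" "j \<in> R" "s < l j"
  shows "newton R c h l (c j s) = 0"
proof -
  have "(j, s) \<in> Sigma R (\<lambda>i. {..<l i})" using assms by auto
  moreover have "s2 (case_prod c (j, s)) (c j s) = 0" by simp
  ultimately have "(\<Prod>x\<in>Sigma R (\<lambda>i. {..<l i}). s2 (case_prod c x) (c j s)) = 0"
    using assms(1) by (intro prod_zero bexI[of _ "(j, s)"]) simp_all
  then show ?thesis by (simp add: newton_def)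
qed

text \<open>Multiplying by \<open>newton\<close> cancels all nodes below l and the first |l| factors
  of the product over h. What remains is an antisymmetric residue sum over the smaller grid from l
  to k, which is 0 for l \<noteq> k; for l = k the grid is one point, and if some l i > k i it is
  empty.\<close>

lemma dual_newton:
  fixes R :: "'i::countable set"
  assumes R: "finite R" "R \<noteq> {}" and k: "k \<in> PiE R (\<lambda>_. UNIV)" and l: "l \<in> PiE R (\<lambda>_. UNIV)"
    and nz: "\<And>i s j t. i \<in> R \<Longrightarrow> j \<in> R \<Longrightarrow> s \<le> k i \<Longrightarrow> t \<le> k j \<Longrightarrow> (i, s) \<noteq> (j, t) \<Longrightarrow> s2 (c i s) (c j t) \<noteq> 0"
    and h: "\<And>y j s. j \<in> R \<Longrightarrow> s \<le> k j \<Longrightarrow> y < sum k R \<Longrightarrow> s2 (h y) (c j s) \<noteq> 0"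
  shows "(\<Sum>n\<in>PiE R (\<lambda>i. {..k i}). dual R c h k n * (\<Prod>j\<in>R. newton R c h l (c j (n j))))
    = (if l = k then dual R c h k k * (\<Prod>j\<in>R. newton R c h k (c j (k j))) else 0)"
proof -
  define f where "f n = dual R c h k n * (\<Prod>j\<in>R. newton R c h l (c j (n j)))" for n
  have f0: "f n = 0" if "j \<in> R" "n j < l j" for n j
  proof -
    have "(\<Prod>j\<in>R. newton R c h l (c j (n j))) = 0"
      using newton_eq_0[of R j "n j" l, OF R(1) that] that(1) R(1) by (intro prod_zero) auto
    then show ?thesis by (simp add: f_def)
  qed
  have fin: "finite (PiE R (\<lambda>i. {..k i}))" using R by (intro finite_PiE) auto
  let ?B = "PiE R (\<lambda>i. {l i..k i})"
  have restrict: "sum f (PiE R (\<lambda>i. {..k i})) = sum f ?B"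
  proof (rule sum.mono_neutral_right[OF fin])
    show "?B \<subseteq> PiE R (\<lambda>i. {..k i})" by (auto simp: PiE_iff)
    show "\<forall>n\<in>PiE R (\<lambda>i. {..k i}) - ?B. f n = 0"
    proof
      fix n assume n: "n \<in> PiE R (\<lambda>i. {..k i}) - ?B"
      then obtain j where "j \<in> R" "n j < l j" by (auto simp: PiE_iff not_le)
      then show "f n = 0" by (rule f0)
    qed
  qed
  have "sum f ?B = (if l = k then f k else 0)"
  proof (cases "l = k")
    case True
    have "?B = {k}" using k True by (simp add: PiE_singleton PiE_iff)
    then show ?thesis using True by simp
  next
    case ne: False
    show ?thesis
    proof (cases "\<exists>i\<in>R. k i < l i")
      case True
      then have "?B = {}" by (auto simp: PiE_eq_empty_iff not_le)
      then show ?thesis using ne by simp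
    next
      case False
      then have le: "\<And>i. i \<in> R \<Longrightarrow> l i \<le> k i" by (simp add: not_less)
      obtain i where i: "i \<in> R" "l i \<noteq> k i"
        using ne k l by (metis PiE_ext)
      have lt: "sum l R < sum k R"
        by (rule sum_strict_mono_ex1) (use R i le in \<open>auto intro: bexI[of _ i] simp: less_le\<close>)
      define A where "A i = {l i..k i}" for i
      \<comment> \<open>The number of h-factors left over; the grid from l to k has |k| - |l| + |R|
        = d + |R| + 1 points, as the residue sum requires.\<close>
      define d where "d = sum k R - 1 - sum l R"
      define g where "g t = 1 * (\<Prod>y\<in>{sum l R..<sum k R - 1}. s2 (h y) t)" for t
      have g: "(d, g) \<in> H"
        using H_prod[of "{sum l R..<sum k R - 1}" 1 h] by (simp add: g_def [abs_def] d_def)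
      have cardX: "card (Sigma R A) = d + card R + 1"
      proof -
        have "card (Sigma R A) = (\<Sum>i\<in>R. Suc (k i) - l i)" using R by (simp add: A_def)
        also have "\<dots> = (\<Sum>i\<in>R. k i - l i + 1)"
          by (intro sum.cong refl) (use le in \<open>simp add: Suc_diff_le\<close>)
        also have "\<dots> = (sum k R - sum l R) + card R"
          unfolding sum.distrib using sum_subtractf_nat[of R l k] le by simp
        finally show ?thesis using lt by (simp add: d_def)
      qed
      have "f n = pprod (\<lambda>i j. s2 (c i (n i)) (c j (n j))) R
          * (\<Prod>j\<in>R. g (c j (n j)) / (\<Prod>y\<in>Sigma R A-{(j, n j)}. s2 (case_prod c y) (c j (n j))))"
        if n: "n \<in> ?B" for n
      proof -
        have "(\<Prod>y<sum k R - 1. s2 (h y) (c j (n j)))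
            / (\<Prod>x\<in>Sigma R (\<lambda>i. {..k i}) - {(j, n j)}. s2 (case_prod c x) (c j (n j)))
            * newton R c h l (c j (n j))
          = g (c j (n j)) / (\<Prod>y\<in>Sigma R A-{(j, n j)}. s2 (case_prod c y) (c j (n j)))"
          if j: "j \<in> R" for j
        proof -
          let ?w = "c j (n j)"
          have nj: "l j \<le> n j" "n j \<le> k j" using n j by (auto simp: PiE_iff)
          let ?L = "Sigma R (\<lambda>i. {..<l i})"
          have U: "{..<sum k R - 1} = {..<sum l R} \<union> {sum l R..<sum k R - 1}" using lt by auto
          have 1: "(\<Prod>y<sum k R - 1. s2 (h y) ?w) = (\<Prod>y<sum l R. s2 (h y) ?w) * g ?w"
            unfolding g_def mult_1 U by (rule prod.union_disjoint) auto
          have "x \<in> Sigma R (\<lambda>i. {..k i}) - {(j, n j)} \<longleftrightarrow> x \<in> ?L \<union> (Sigma R A - {(j, n j)})" for x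
            using le[of "fst x"] nj by (cases x) (auto simp: A_def)
          then have "Sigma R (\<lambda>i. {..k i}) - {(j, n j)} = ?L \<union> (Sigma R A - {(j, n j)})"
            by (rule set_eqI)
          moreover have "?L \<inter> (Sigma R A - {(j, n j)}) = {}" by (auto simp: A_def)
          ultimately have 2: "(\<Prod>x\<in>Sigma R (\<lambda>i. {..k i}) - {(j, n j)}. s2 (case_prod c x) ?w)
              = (\<Prod>x\<in>?L. s2 (case_prod c x) ?w) * (\<Prod>x\<in>Sigma R A - {(j, n j)}. s2 (case_prod c x) ?w)"
            using R by (simp add: prod.union_disjoint A_def)
          have 3: "(\<Prod>x\<in>?L. s2 (case_prod c x) ?w) \<noteq> 0"
          proof -
            have "s2 (c i s) ?w \<noteq> 0" if "i \<in> R" "s < l i" for i s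
              by (rule nz) (use that j nj le[of i] in auto)
            then show ?thesis using R by (auto simp: prod_zero_iff)
          qed
          have 4: "(\<Prod>y<sum l R. s2 (h y) ?w) \<noteq> 0" using h[OF j nj(2)] lt by (auto simp: prod_zero_iff)
          show ?thesis unfolding newton_def 1 2 using 3 4 by simp
        qed
        then show ?thesis unfolding f_def dual_def
          by (simp add: prod.distrib[symmetric] mult.assoc cong: prod.cong)
      qed
      then have "sum f ?B = (\<Sum>n\<in>PiE R A. pprod (\<lambda>i j. s2 (c i (n i)) (c j (n j))) R
          * (\<Prod>j\<in>R. g (c j (n j)) / (\<Prod>y\<in>Sigma R A-{(j, n j)}. s2 (case_prod c y) (c j (n j)))))"
        unfolding A_def by (rule sum.cong[OF refl])
      also have "\<dots> = 0"
      proof (rule sum_antisymmetric_residues[OF R _ cardX g])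
        fix x y assume "x \<in> Sigma R A" "y \<in> Sigma R A" "x \<noteq> y"
        then show "s2 (case_prod c x) (case_prod c y) \<noteq> 0"
          by (cases x, cases y) (simp only: prod.case, rule nz, auto simp: A_def)
      qed (simp add: A_def)
      finally show ?thesis using ne by simp
    qed
  qed
  with restrict show ?thesis by (simp add: f_def)
qed

end

section \<open>Geometric chains of nodes\<close>

lemma prod_telescope_ratio:
  fixes f :: "nat \<Rightarrow> complex"
  assumes "a \<le> b" "\<And>s. a \<le> s \<Longrightarrow> s \<le> b \<Longrightarrow> f s \<noteq> 0"
  shows "(\<Prod>s=a..<b. f (Suc s) / f s) = f b / f a"
  using assms by (induction rule: dec_induct) auto

lemma pprod_zero:
  assumes "finite I" "x \<in> I" "y \<in> I" "x \<noteq> y" "B x y = 0" "B y x = (0::complex)"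
  shows "pprod B I = 0"
proof -
  have "to_nat x \<noteq> to_nat y" using assms(4) by simp
  then have "\<exists>P\<in>{(x, y). x \<in> I \<and> y \<in> I \<and> to_nat x < to_nat y}. case_prod B P = 0"
  proof (cases "to_nat x < to_nat y")
    case True then show ?thesis using assms by (intro bexI[of _ "(x, y)"]) auto
  next
    case False
    then have "to_nat y < to_nat x" using \<open>to_nat x \<noteq> to_nat y\<close> by linarith
    then show ?thesis using assms by (intro bexI[of _ "(y, x)"]) auto
  qed
  then show ?thesis unfolding pprod_def
    using assms(1) by (intro prod_zero finite_pairs) auto
qed

context odd_sigma
begin

text \<open>The z s are the midpoints between consecutive nodes c s, with signs minus up to n and
  plus from n on. Numerators match neighbouring denominators on either side of n, so only the two
  ends of the chain and the break at the node c n survive. The second form omits the link n, for a u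
  that itself comes from this link.\<close>

lemma chain_telescope:
  fixes c z v :: "nat \<Rightarrow> complex" and e u :: complex
  assumes c: "\<And>s. c (Suc s) = c s + 2 * e" and z: "\<And>s. z s = c s + e"
    and v: "\<And>s. v s = (if s < n then - z s else z s)" and le: "n \<le> k"
    and nz: "\<And>s. s \<le> n \<Longrightarrow> \<sigma> (u + e - c s) \<noteq> 0"
  shows chain_telescope_all: "(\<And>s. n \<le> s \<Longrightarrow> s \<le> k \<Longrightarrow> \<sigma> (u + e + c s) \<noteq> 0) \<Longrightarrow>
      (\<Prod>s<k. \<sigma> (2 * e + u + v s) / \<sigma> (u + v s))
      = \<sigma> (u + e - c 0) * \<sigma> (u + e + c k) / s2 (u + e) (c n)"
    and chain_telescope_but: "n < k \<Longrightarrow> (\<And>s. n < s \<Longrightarrow> s \<le> k \<Longrightarrow> \<sigma> (u + e + c s) \<noteq> 0) \<Longrightarrow>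
      (\<Prod>s\<in>{..<k}-{n}. \<sigma> (2 * e + u + v s) / \<sigma> (u + v s))
      = \<sigma> (u + e - c 0) * \<sigma> (u + e + c k) / (\<sigma> (u + e - c n) * \<sigma> (u + e + c (Suc n)))"
proof -
  let ?r = "\<lambda>s. \<sigma> (2 * e + u + v s) / \<sigma> (u + v s)"
  let ?f = "\<lambda>s. inverse (\<sigma> (u + e - c s))" and ?g = "\<lambda>s. \<sigma> (u + e + c s)"
  have lo: "(\<Prod>s=0..<n. ?r s) = \<sigma> (u + e - c 0) / \<sigma> (u + e - c n)"
  proof -
    have "(\<Prod>s=0..<n. ?r s) = (\<Prod>s=0..<n. ?f (Suc s) / ?f s)"
    proof (intro prod.cong refl)
      fix s assume "s \<in> {0..<n}"
      then have "2 * e + u + v s = u + e - c s" "u + v s = u + e - c (Suc s)"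
        by (simp_all add: v z c)
      then show "?r s = ?f (Suc s) / ?f s" by (simp only:) (simp add: divide_inverse)
    qed
    also have "\<dots> = ?f n / ?f 0" by (rule prod_telescope_ratio) (use nz in auto)
    finally show ?thesis by (simp add: field_simps)
  qed
  have hi: "(\<Prod>s=a..<k. ?r s) = \<sigma> (u + e + c k) / \<sigma> (u + e + c a)"
    if "n \<le> a" "a \<le> k" "\<And>s. a \<le> s \<Longrightarrow> s \<le> k \<Longrightarrow> \<sigma> (u + e + c s) \<noteq> 0" for a
  proof -
    have "(\<Prod>s=a..<k. ?r s) = (\<Prod>s=a..<k. ?g (Suc s) / ?g s)"
    proof (intro prod.cong refl)
      fix s assume "s \<in> {a..<k}"
      then have "2 * e + u + v s = u + e + c (Suc s)" "u + v s = u + e + c s"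
        using that(1) by (simp_all add: v z c)
      then show "?r s = ?g (Suc s) / ?g s" by (simp only:)
    qed
    also have "\<dots> = ?g k / ?g a" by (rule prod_telescope_ratio) (use that in auto)
    finally show ?thesis .
  qed
  {
    assume "\<And>s. n \<le> s \<Longrightarrow> s \<le> k \<Longrightarrow> \<sigma> (u + e + c s) \<noteq> 0"
    from hi[OF order_refl le this]
    have "(\<Prod>s=n..<k. ?r s) = \<sigma> (u + e + c k) / \<sigma> (u + e + c n)" by simp
    moreover have "(\<Prod>s<k. ?r s) = (\<Prod>s=0..<n. ?r s) * (\<Prod>s=n..<k. ?r s)"
      using prod.atLeastLessThan_concat[of 0 n k ?r] le by (simp add: atLeast0LessThan)
    ultimately show "(\<Prod>s<k. ?r s) = \<sigma> (u + e - c 0) * \<sigma> (u + e + c k) / s2 (u + e) (c n)"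
      unfolding lo by (simp add: s2_def)
  }
  {
    assume "n < k" and g: "\<And>s. n < s \<Longrightarrow> s \<le> k \<Longrightarrow> \<sigma> (u + e + c s) \<noteq> 0"
    have "(\<Prod>s=Suc n..<k. ?r s) = \<sigma> (u + e + c k) / \<sigma> (u + e + c (Suc n))"
      using hi[of "Suc n"] \<open>n < k\<close> g by simp
    moreover have "{..<k} - {n} = {0..<n} \<union> {Suc n..<k}" using \<open>n < k\<close> by auto
    then have "(\<Prod>s\<in>{..<k}-{n}. ?r s) = (\<Prod>s=0..<n. ?r s) * (\<Prod>s=Suc n..<k. ?r s)"
      by (simp only:) (rule prod.union_disjoint, auto)
    ultimately show "(\<Prod>s\<in>{..<k}-{n}. ?r s)
        = \<sigma> (u + e - c 0) * \<sigma> (u + e + c k) / (\<sigma> (u + e - c n) * \<sigma> (u + e + c (Suc n)))"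
      unfolding lo by simp
  }
qed

text \<open>Moving w by one step d amounts to moving the index s by one, so the two products differ
  only in their end factors.\<close>

lemma shift_plus:
  assumes c: "\<And>s. c (Suc s) = c s + d"
  shows "(\<Prod>s\<le>k. \<sigma> (c s + w)) * \<sigma> (c k + (w + d)) = (\<Prod>s\<le>k. \<sigma> (c s + (w + d))) * \<sigma> (c 0 + w)"
proof -
  have *: "c s + (w + d) = c (Suc s) + w" for s by (simp add: c add_ac)
  show ?thesis unfolding * prod.atMost_Suc[symmetric, of "\<lambda>s. \<sigma> (c s + w)" k] prod.atMost_Suc_shift
    by (simp add: mult.commute)
qed

lemma shift_minus:
  assumes c: "\<And>s. c (Suc s) = c s + d"
  shows "(\<Prod>s\<le>k. \<sigma> (c s - w)) * \<sigma> (c 0 - (w + d)) = (\<Prod>s\<le>k. \<sigma> (c s - (w + d))) * \<sigma> (c k - w)"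
proof -
  have *: "c s - w = c (Suc s) - (w + d)" for s by (simp add: c)
  show ?thesis unfolding * prod.atMost_Suc[symmetric, of "\<lambda>s. \<sigma> (c s - (w + d))" k] prod.atMost_Suc_shift
    by (simp add: mult.commute)
qed

lemma shift_minus_but:
  assumes c: "\<And>s. c (Suc s) = c s + d" and n: "n < k" and w: "w = c n"
  shows "(\<Prod>s\<in>{..k}-{n}. \<sigma> (c s - w)) * \<sigma> (c 0 - (w + d))
    = (\<Prod>s\<in>{..k}-{Suc n}. \<sigma> (c s - (w + d))) * \<sigma> (c k - w)"
proof -
  let ?f = "\<lambda>s. \<sigma> (c s - (w + d))"
  have *: "\<sigma> (c s - w) = ?f (Suc s)" for s by (simp add: c)
  have 1: "(\<Prod>s\<in>{..k}-{n}. \<sigma> (c s - w)) = prod ?f (Suc ` ({..k} - {n}))"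
    unfolding * by (subst prod.reindex) auto
  have 2: "insert 0 (Suc ` ({..k} - {n})) = {..Suc k} - {Suc n}"
    by (subst atMost_Suc_eq_insert_0) auto
  have "prod ?f (insert 0 (Suc ` ({..k} - {n}))) = ?f 0 * prod ?f (Suc ` ({..k} - {n}))"
    by (rule prod.insert) auto
  then have 3: "prod ?f ({..Suc k} - {Suc n}) = (\<Prod>s\<in>{..k}-{n}. \<sigma> (c s - w)) * ?f 0"
    unfolding 1 2 by (simp only: mult.commute)
  have 4: "{..Suc k} - {Suc n} = insert (Suc k) ({..k} - {Suc n})" using n by auto
  have "prod ?f (insert (Suc k) ({..k} - {Suc n})) = ?f (Suc k) * prod ?f ({..k} - {Suc n})"
    by (rule prod.insert) auto
  then show ?thesis using 3 unfolding 4 *[of k] by (simp only: mult.commute)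
qed

lemma shift_s2:
  assumes c: "\<And>s. c (Suc s) = c s + d"
  shows "(\<Prod>s\<le>k. s2 (c s) w) * (\<sigma> (w + d - c 0) * \<sigma> (w + d + c k))
    = (\<Prod>s\<le>k. s2 (c s) (w + d)) * (\<sigma> (- w - c 0) * \<sigma> (- w + c k))"
proof -
  have 1: "\<sigma> (w + d - c 0) = - \<sigma> (c 0 - (w + d))" by (rule odd_diff)
  have 2: "\<sigma> (- w - c 0) = - \<sigma> (c 0 + w)" using odd[of "w + c 0"] by (simp add: add.commute)
  have "(\<Prod>s\<le>k. s2 (c s) w) * (\<sigma> (w + d - c 0) * \<sigma> (w + d + c k))
      = - ((\<Prod>s\<le>k. \<sigma> (c s + w)) * \<sigma> (c k + (w + d)))
        * ((\<Prod>s\<le>k. \<sigma> (c s - w)) * \<sigma> (c 0 - (w + d)))"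
    unfolding s2_def prod.distrib 1 by (simp add: mult_ac add_ac)
  also have "\<dots> = - ((\<Prod>s\<le>k. \<sigma> (c s + (w + d))) * \<sigma> (c 0 + w))
      * ((\<Prod>s\<le>k. \<sigma> (c s - (w + d))) * \<sigma> (c k - w))"
    unfolding shift_plus[where c = c and d = d and k = k and w = w, OF c] shift_minus[where c = c and d = d and k = k and w = w, OF c] ..
  also have "\<dots> = (\<Prod>s\<le>k. s2 (c s) (w + d)) * (\<sigma> (- w - c 0) * \<sigma> (- w + c k))"
    unfolding s2_def prod.distrib 2 by (simp add: mult_ac)
  finally show ?thesis .
qed

text \<open>Here w and w + d are themselves the nodes n and n + 1, so a vanishing factor is omitted
  on either side. The factors \<sigma> (2 w) and \<sigma> (2 (w + d)), lost along with them, are put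
  back to complete the products over sums.\<close>

lemma shift_s2_but:
  assumes c: "\<And>s. c (Suc s) = c s + d" and n: "n < k" and w: "w = c n"
  shows "(\<Prod>s\<in>{..k}-{n}. s2 (c s) w) * \<sigma> (- 2 * w) * (\<sigma> (w + d - c 0) * \<sigma> (w + d + c k))
    = - ((\<Prod>s\<in>{..k}-{Suc n}. s2 (c s) (w + d)) * \<sigma> (2 * (w + d)) * (\<sigma> (- w - c 0) * \<sigma> (- w + c k)))"
proof -
  have 1: "\<sigma> (w + d - c 0) = - \<sigma> (c 0 - (w + d))" by (rule odd_diff)
  have 2: "\<sigma> (- w - c 0) = - \<sigma> (c 0 + w)" using odd[of "w + c 0"] by (simp add: add.commute)
  have 3: "\<sigma> (- 2 * w) = - \<sigma> (2 * w)" using odd[of "2 * w"] by simp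
  have 4: "(\<Prod>s\<in>{..k}-{n}. \<sigma> (c s + w)) * \<sigma> (2 * w) = (\<Prod>s\<le>k. \<sigma> (c s + w))"
  proof -
    have "2 * w = c n + w" by (simp add: w)
    then show ?thesis
      using n prod.remove[of "{..k}" n "\<lambda>s. \<sigma> (c s + w)"] by (simp only:) (simp add: mult.commute)
  qed
  have 5: "(\<Prod>s\<in>{..k}-{Suc n}. \<sigma> (c s + (w + d))) * \<sigma> (2 * (w + d)) = (\<Prod>s\<le>k. \<sigma> (c s + (w + d)))"
  proof -
    have "2 * (w + d) = c (Suc n) + (w + d)" by (simp add: w c)
    then show ?thesis
      using n prod.remove[of "{..k}" "Suc n" "\<lambda>s. \<sigma> (c s + (w + d))"]
      by (simp only:) (simp add: mult.commute)
  qed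
  have "(\<Prod>s\<in>{..k}-{n}. s2 (c s) w) * \<sigma> (- 2 * w) * (\<sigma> (w + d - c 0) * \<sigma> (w + d + c k))
      = ((\<Prod>s\<le>k. \<sigma> (c s + w)) * \<sigma> (c k + (w + d)))
        * ((\<Prod>s\<in>{..k}-{n}. \<sigma> (c s - w)) * \<sigma> (c 0 - (w + d)))"
    unfolding s2_def prod.distrib 1 3 4[symmetric] by (simp add: mult_ac add_ac)
  also have "\<dots> = ((\<Prod>s\<le>k. \<sigma> (c s + (w + d))) * \<sigma> (c 0 + w))
      * ((\<Prod>s\<in>{..k}-{Suc n}. \<sigma> (c s - (w + d))) * \<sigma> (c k - w))"
    unfolding shift_plus[where c = c and d = d and k = k and w = w, OF c] shift_minus_but[where c = c and d = d and k = k and w = w and n = n, OF c n w] ..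
  also have "\<dots> = - ((\<Prod>s\<in>{..k}-{Suc n}. s2 (c s) (w + d)) * \<sigma> (2 * (w + d)) * (\<sigma> (- w - c 0) * \<sigma> (- w + c k)))"
    unfolding s2_def prod.distrib 2 5[symmetric] by (simp add: mult_ac)
  finally show ?thesis .
qed

end

text \<open>General position: nodes, midpoints and multiples of \<zeta> never meet, whatever the
  length of the chains. The condition on \<zeta> alone concerns even multiples because with q = exp
  (4 \<zeta>) these correspond to integral powers of q.\<close>

locale generic_chains = odd_sigma +
  fixes \<zeta> :: complex and \<xi> :: "nat \<Rightarrow> complex" and R :: "nat set"
  assumes finite_R: "finite R" and R_ne: "R \<noteq> {}"
    and nz_zeta: "\<And>m::int. m \<noteq> 0 \<Longrightarrow> \<sigma> (of_int (2 * m) * \<zeta>) \<noteq> 0"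
    and nz_single: "\<And>i m. i \<in> R \<Longrightarrow> \<sigma> (\<xi> i + of_int m * \<zeta>) \<noteq> 0"
    and nz_double: "\<And>i m. i \<in> R \<Longrightarrow> \<sigma> (2 * \<xi> i + of_int m * \<zeta>) \<noteq> 0"
    and nz_plus: "\<And>i j m. i \<in> R \<Longrightarrow> j \<in> R \<Longrightarrow> i \<noteq> j \<Longrightarrow> \<sigma> (\<xi> i + \<xi> j + of_int m * \<zeta>) \<noteq> 0"
    and nz_minus: "\<And>i j m. i \<in> R \<Longrightarrow> j \<in> R \<Longrightarrow> i \<noteq> j \<Longrightarrow> \<sigma> (\<xi> i - \<xi> j + of_int m * \<zeta>) \<noteq> 0"
begin

text \<open>A step of 6 \<zeta> is multiplication by q^3 in the variable exp (2 u).\<close>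

definition c :: "nat \<Rightarrow> nat \<Rightarrow> complex" where "c i s = \<xi> i + of_nat (6 * s) * \<zeta>"
text \<open>Midpoints of consecutive nodes. They advance by 6 \<zeta>, the value of \<delta> in
  \<open>chain_wt\<close>, so that \<delta> + z i s - z i (Suc s) = 0.\<close>

definition z :: "nat \<Rightarrow> nat \<Rightarrow> complex" where "z i s = \<xi> i + of_nat (6 * s + 3) * \<zeta>"

lemma c_Suc: "c i (Suc s) = c i s + 6 * \<zeta>" by (simp add: c_def algebra_simps)
lemma z_c: "z i s = c i s + 3 * \<zeta>" by (simp add: c_def z_def algebra_simps)

lemma nz_cc_plus: 
  assumes "i \<in> R" "j \<in> R" shows "\<sigma> (c i s + c j t + of_int m * \<zeta>) \<noteq> 0"
proof -
  have "c i s + c j t + of_int m * \<zeta> = \<xi> i + \<xi> j + of_int (6 * int s + 6 * int t + m) * \<zeta>"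
    by (simp add: c_def algebra_simps)
  moreover have "\<sigma> (\<xi> i + \<xi> j + of_int l * \<zeta>) \<noteq> 0" for l
  proof (cases "i = j")
    case True
    then have "\<xi> i + \<xi> j = 2 * \<xi> i" by simp
    then show ?thesis using nz_double[OF assms(1)] by (simp only:) simp
  next
    case False
    then show ?thesis by (rule nz_plus[OF assms])
  qed
  ultimately show ?thesis by (simp only:) simp
qed

lemma nz_cc_minus: 
  assumes "i \<in> R" "j \<in> R" "i \<noteq> j" shows "\<sigma> (c i s - c j t + of_int m * \<zeta>) \<noteq> 0"
proof -
  have "c i s - c j t + of_int m * \<zeta> = \<xi> i - \<xi> j + of_int (6 * int s - 6 * int t + m) * \<zeta>"
    by (simp add: c_def algebra_simps)
  then show ?thesis using nz_minus[OF assms] by (simp only:) simp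
qed

lemma nz_cc_self:
  assumes "s \<noteq> t" shows "\<sigma> (c i s - c i t) \<noteq> 0"
proof -
  have "c i s - c i t = of_int (2 * (3 * int s - 3 * int t)) * \<zeta>"
    by (simp add: c_def algebra_simps)
  moreover have "3 * int s - 3 * int t \<noteq> 0" using assms by simp
  ultimately show ?thesis using nz_zeta by metis
qed

lemma s2_cc: 
  assumes "i \<in> R" "j \<in> R" "(i, s) \<noteq> (j, t)" shows "s2 (c i s) (c j t) \<noteq> 0"
  using nz_cc_plus[OF assms(1,2), of s t 0] nz_cc_minus[OF assms(1,2), of s t 0] nz_cc_self[of s t i] assms(3)
  by (cases "i = j") (auto simp: s2_def)

lemma s2_zz: 
  assumes "i \<in> R" "j \<in> R" "(i, s) \<noteq> (j, t)" shows "s2 (z i s) (z j t) \<noteq> 0"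
proof -
  have 1: "z i s + z j t = c i s + c j t + of_int 6 * \<zeta>" "z i s - z j t = c i s - c j t" by (simp_all add: z_c)
  show ?thesis
    using nz_cc_plus[OF assms(1,2), of s t 6] nz_cc_minus[OF assms(1,2), of s t 0] nz_cc_self[of s t i] assms(3)
    unfolding s2_def 1 by (cases "i = j") auto
qed

lemma nz_2z: "i \<in> R \<Longrightarrow> \<sigma> (2 * z i s) \<noteq> 0"
  using nz_cc_plus[of i i s s 6] by (simp add: z_c algebra_simps)


definition links :: "(nat \<Rightarrow> nat) \<Rightarrow> (nat \<times> nat) set" where
  "links k = Sigma R (\<lambda>i. {..<k i})"

text \<open>The set of plus signs of a surviving choice: minus on the first n i links of chain i,
  plus afterwards. The break at n i corresponds to the node \<open>c i (n i)\<close>.\<close>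

definition surv :: "(nat \<Rightarrow> nat) \<Rightarrow> (nat \<Rightarrow> nat) \<Rightarrow> (nat \<times> nat) set" where
  "surv k n = Sigma R (\<lambda>i. {n i..<k i})"

definition chain_wt :: "complex \<Rightarrow> complex \<Rightarrow> complex \<Rightarrow> complex \<Rightarrow> (nat \<Rightarrow> nat) \<Rightarrow> (nat \<Rightarrow> nat) \<Rightarrow> complex" where
  "chain_wt b1 b2 b3 b4 k n = wt b1 b2 b3 b4 (links k) (flip (case_prod z) (surv k n)) (6 * \<zeta>)"

abbreviation box :: "(nat \<Rightarrow> nat) \<Rightarrow> (nat \<Rightarrow> nat) set" where
  "box k \<equiv> PiE R (\<lambda>i. {..k i})"

lemma finite_links [simp]: "finite (links k)"
  using finite_R by (simp add: links_def)

lemma card_links: "card (links k) = sum k R"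
  using finite_R by (simp add: links_def)

lemma finite_box [simp]: "finite (box k)"
  using finite_R by (intro finite_PiE) auto

text \<open>A choice of signs contributes only if no plus sign is followed by a minus sign in the same chain.\<close>

lemma sum_chain_wt:
  "(\<Sum>S\<in>Pow (links k). wt b1 b2 b3 b4 (links k) (flip (case_prod z) S) (6 * \<zeta>))
    = (\<Sum>n\<in>box k. chain_wt b1 b2 b3 b4 k n)"
proof -
  let ?w = "\<lambda>S. wt b1 b2 b3 b4 (links k) (flip (case_prod z) S) (6 * \<zeta>)"
  have inj: "inj_on (surv k) (box k)"
  proof (rule inj_onI)
    fix n n' assume n: "n \<in> box k" and n': "n' \<in> box k" and eq: "surv k n = surv k n'"
    have "\<not> n i < n' i \<and> \<not> n' i < n i" if i: "i \<in> R" for i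
    proof -
      have "(i, n i) \<in> surv k n \<longleftrightarrow> (i, n i) \<in> surv k n'"
        "(i, n' i) \<in> surv k n \<longleftrightarrow> (i, n' i) \<in> surv k n'" using eq by simp_all
      moreover have "n i \<le> k i" "n' i \<le> k i" using n n' i by (auto simp: PiE_iff)
      ultimately show ?thesis using i by (auto simp: surv_def)
    qed
    then show "n = n'" using n n' by (intro PiE_ext[OF n n']) (meson linorder_neqE_nat)
  qed
  have zero: "?w S = 0" if S: "S \<in> Pow (links k) - surv k ` box k" for S
  proof -
    have "\<exists>i s. i \<in> R \<and> (i, s) \<in> S \<and> Suc s < k i \<and> (i, Suc s) \<notin> S"
    proof (rule ccontr)
      assume "\<not> ?thesis"
      then have up: "(i, Suc s) \<in> S" if "i \<in> R" "(i, s) \<in> S" "Suc s < k i" for i s using that by blast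
      \<comment> \<open>The position of the first plus sign in each chain, or k i if the chain has
        none.\<close>
      define n where "n = restrict (\<lambda>i. LEAST s. s = k i \<or> (i, s) \<in> S) R"
      have n: "n i = (LEAST s. s = k i \<or> (i, s) \<in> S)" if "i \<in> R" for i using that by (simp add: n_def)
      have le: "n i \<le> k i" if "i \<in> R" for i unfolding n[OF that] by (rule Least_le) simp
      have "n \<in> box k" using le by (auto simp: n_def PiE_iff)
      moreover have "(i, s) \<in> S \<longleftrightarrow> (i, s) \<in> surv k n" for i s
      proof
        assume s: "(i, s) \<in> S"
        then have "i \<in> R" "s < k i" using S by (auto simp: links_def)
        moreover have "n i \<le> s" unfolding n[OF \<open>i \<in> R\<close>] by (rule Least_le) (use s in simp)
        ultimately show "(i, s) \<in> surv k n" by (simp add: surv_def)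
      next
        assume "(i, s) \<in> surv k n"
        then have s: "i \<in> R" "n i \<le> s" "s < k i" by (auto simp: surv_def)
        have "n i = k i \<or> (i, n i) \<in> S" unfolding n[OF s(1)] by (rule LeastI[of _ "k i"]) simp
        then have base: "(i, n i) \<in> S" using s by auto
        from s(2,3) show "(i, s) \<in> S" by (induction rule: dec_induct) (use base up s(1) in auto)
      qed
      then have "S = surv k n" by (intro set_eqI) (metis surj_pair)
      ultimately show False using S by blast
    qed
    then obtain i s where s: "i \<in> R" "(i, s) \<in> S" "Suc s < k i" "(i, Suc s) \<notin> S" by blast
    let ?v = "flip (case_prod z) S"
    have 1: "(i, s) \<in> links k" "(i, Suc s) \<in> links k" using s by (auto simp: links_def)
    have "6 * \<zeta> + ?v (i, s) + ?v (i, Suc s) = 0" "6 * \<zeta> + ?v (i, Suc s) + ?v (i, s) = 0"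
      using s by (simp_all add: flip_def z_c c_Suc)
    then have "pprod (\<lambda>x y. \<sigma> (6 * \<zeta> + ?v x + ?v y) / \<sigma> (?v x + ?v y)) (links k) = 0"
      by (intro pprod_zero[OF finite_links 1]) simp_all
    then show ?thesis by (simp add: wt_def)
  qed
  have "(\<Sum>S\<in>Pow (links k). ?w S) = (\<Sum>S\<in>surv k ` box k. ?w S)"
  proof (rule sum.mono_neutral_right)
    show "surv k ` box k \<subseteq> Pow (links k)" by (auto simp: surv_def links_def)
  qed (use zero in auto)
  also have "\<dots> = (\<Sum>n\<in>box k. chain_wt b1 b2 b3 b4 k n)"
    unfolding chain_wt_def by (subst sum.reindex[OF inj]) simp
  finally show ?thesis .
qed

text \<open>The shape of \<open>dual\<close> with a general function \<Psi> in place of the product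
  over h.\<close>

definition grid_wt :: "(complex \<Rightarrow> complex) \<Rightarrow> (nat \<Rightarrow> nat) \<Rightarrow> (nat \<Rightarrow> nat) \<Rightarrow> complex" where
  "grid_wt \<Psi> k n = pprod (\<lambda>i j. s2 (c i (n i)) (c j (n j))) R
     * (\<Prod>j\<in>R. \<Psi> (c j (n j)) / (\<Prod>x\<in>Sigma R (\<lambda>i. {..k i}) - {(j, n j)}. s2 (case_prod c x) (c j (n j))))"

text \<open>Raising n i by one reverses the single sign at \<open>z i (n i)\<close> and moves one
  node. The telescoped contribution of every chain then changes on both sides in the same ratio, and
  the parameters b1, ..., b4 enter only through the difference equation for \<Psi>. The
  cross-multiplied form avoids any nonvanishing assumption on \<Psi> and the parameters.\<close>

lemma flip_step:
  assumes n: "n \<in> box k" and i: "i \<in> R" "n i < k i" and n': "n' = n(i := Suc (n i))"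
    and \<Psi>: "\<Psi> (c i (Suc (n i))) * (\<sigma> (b1 + z i (n i)) * \<sigma> (b2 + z i (n i)) * \<sigma> (b3 + z i (n i)) * \<sigma> (b4 + z i (n i)))
      = \<Psi> (c i (n i)) * (\<sigma> (b1 - z i (n i)) * \<sigma> (b2 - z i (n i)) * \<sigma> (b3 - z i (n i)) * \<sigma> (b4 - z i (n i)))"
  shows "chain_wt b1 b2 b3 b4 k n * grid_wt \<Psi> k n' = chain_wt b1 b2 b3 b4 k n' * grid_wt \<Psi> k n"
proof -
  define \<nu> where "\<nu> = n i"
  define z0 where "z0 = z i \<nu>"
  define w where "w = c i \<nu>"
  define w' where "w' = c i (Suc \<nu>)"
  define R' where "R' = R - {i}"
  have R': "R = insert i R'" "i \<notin> R'" "finite R'" using i finite_R by (auto simp: R'_def)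
  have w': "w' = w + 6 * \<zeta>" by (simp add: w'_def w_def c_Suc)
  have zw: "z0 + 3 * \<zeta> = w'" "- z0 + 3 * \<zeta> = - w" by (simp_all add: z0_def w'_def w_def z_c c_Suc)
  have nk: "n j \<le> k j" if "j \<in> R" for j using n that by (auto simp: PiE_iff)
  have \<nu>: "\<nu> < k i" using i by (simp add: \<nu>_def)
  define v where "v = flip (case_prod z) (surv k n)"
  define v' where "v' = flip (case_prod z) (surv k n')"
  define I' where "I' = links k - {(i, \<nu>)}"
  have I': "links k = insert (i, \<nu>) I'" "(i, \<nu>) \<notin> I'" "finite I'"
    using i \<nu> by (simp_all add: I'_def) (auto simp: links_def)
  have v0: "v (i, \<nu>) = z0" "v' (i, \<nu>) = - z0"
    using i by (simp_all add: v_def v'_def flip_def surv_def n' \<nu>_def z0_def)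
  have vv: "v' x = v x" if "x \<in> I'" for x
    using that by (cases x) (auto simp: v_def v'_def flip_def surv_def n' \<nu>_def I'_def links_def)
  have vs: "v (j, s) = (if s < n j then - z j s else z j s)" if "j \<in> R" "s < k j" for j s
    using that by (simp add: v_def flip_def surv_def)
  define W where "W = wt b1 b2 b3 b4 I' v (6 * \<zeta>)"
  define BB where "BB u = (\<Prod>y\<in>I'. \<sigma> (6 * \<zeta> + u + v y) / \<sigma> (u + v y))" for u
  define \<beta> where "\<beta> u = \<sigma> (b1 + u) * \<sigma> (b2 + u) * \<sigma> (b3 + u) * \<sigma> (b4 + u)" for u
  have t: "chain_wt b1 b2 b3 b4 k n = \<beta> z0 / \<sigma> (2 * z0) * BB z0 * W"
    unfolding chain_wt_def v_def[symmetric] I'(1) wt_insert[OF I'(3,2)] v0 BB_def W_def \<beta>_def ..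
  have t': "chain_wt b1 b2 b3 b4 k n' = \<beta> (- z0) / \<sigma> (2 * - z0) * BB (- z0) * W"
  proof -
    have "(\<Prod>y\<in>I'. \<sigma> (6 * \<zeta> + - z0 + v' y) / \<sigma> (- z0 + v' y)) = BB (- z0)"
      unfolding BB_def by (rule prod.cong) (simp_all add: vv)
    moreover have "wt b1 b2 b3 b4 I' v' (6 * \<zeta>) = W"
      unfolding W_def by (rule wt_cong) (rule vv)
    ultimately show ?thesis
      unfolding chain_wt_def v'_def[symmetric] I'(1) wt_insert[OF I'(3,2)] v0 \<beta>_def by simp
  qed
  define CH where "CH j u = (\<Prod>s<k j. \<sigma> (6 * \<zeta> + u + v (j, s)) / \<sigma> (u + v (j, s)))" for j u
  define CH0 where "CH0 u = (\<Prod>s\<in>{..<k i}-{\<nu>}. \<sigma> (6 * \<zeta> + u + v (i, s)) / \<sigma> (u + v (i, s)))" for u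
  have BB: "BB u = (\<Prod>j\<in>R'. CH j u) * CH0 u" for u
  proof -
    have "I' = Sigma R' (\<lambda>j. {..<k j}) \<union> Pair i ` ({..<k i} - {\<nu>})"
      using i by (auto simp: I'_def links_def R'_def)
    moreover have "Sigma R' (\<lambda>j. {..<k j}) \<inter> Pair i ` ({..<k i} - {\<nu>}) = {}" using R' by auto
    ultimately have "BB u = (\<Prod>y\<in>Sigma R' (\<lambda>j. {..<k j}). \<sigma> (6 * \<zeta> + u + v y) / \<sigma> (u + v y))
        * (\<Prod>y\<in>Pair i ` ({..<k i} - {\<nu>}). \<sigma> (6 * \<zeta> + u + v y) / \<sigma> (u + v y))"
      unfolding BB_def using R' by (simp only:) (rule prod.union_disjoint, auto)
    also have "(\<Prod>y\<in>Sigma R' (\<lambda>j. {..<k j}). \<sigma> (6 * \<zeta> + u + v y) / \<sigma> (u + v y)) = (\<Prod>j\<in>R'. CH j u)"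
      unfolding CH_def using R' by (subst prod.Sigma) (auto simp: case_prod_unfold)
    also have "(\<Prod>y\<in>Pair i ` ({..<k i} - {\<nu>}). \<sigma> (6 * \<zeta> + u + v y) / \<sigma> (u + v y)) = CH0 u"
      unfolding CH0_def by (subst prod.reindex) (auto simp: inj_on_def)
    finally show ?thesis .
  qed
  define E where "E j u = (\<Prod>s\<le>k j. s2 (c j s) u)" for j u
  define E0 where "E0 u m = (\<Prod>s\<in>{..k i}-{m}. s2 (c i s) u)" for u m
  obtain \<kappa> :: complex where \<kappa>: "\<And>B. (\<And>x y. B x y = - B y x) \<Longrightarrow>
      pprod B (insert i R') = \<kappa> * pprod B R' * (\<Prod>y\<in>R'. B i y)"
    using pprod_insert_antisym[OF R'(3,2)] by blast
  define D where "D = \<kappa> * pprod (\<lambda>i j. s2 (c i (n i)) (c j (n j))) R'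
     * (\<Prod>j\<in>R'. \<Psi> (c j (n j)) / (\<Prod>x\<in>Sigma R (\<lambda>i. {..k i}) - {(j, n j)}. s2 (case_prod c x) (c j (n j))))"
  have grid: "grid_wt \<Psi> k m = D * (\<Prod>j\<in>R'. s2 u (c j (n j)) / E j u) * (\<Psi> u / E0 u \<mu>)"
    if m: "m = n(i := \<mu>)" and \<mu>: "\<mu> \<le> k i" and u: "u = c i \<mu>" for m \<mu> u
  proof -
    have ne: "j \<noteq> i" if "j \<in> R'" for j using that R' by auto
    have "pprod (\<lambda>i j. s2 (c i (m i)) (c j (m j))) R
        = \<kappa> * pprod (\<lambda>i j. s2 (c i (m i)) (c j (m j))) R' * (\<Prod>j\<in>R'. s2 (c i (m i)) (c j (m j)))"
      unfolding R'(1) by (rule \<kappa>) (rule s2_swap)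
    also have "pprod (\<lambda>i j. s2 (c i (m i)) (c j (m j))) R' = pprod (\<lambda>i j. s2 (c i (n i)) (c j (n j))) R'"
      by (rule pprod_cong) (use ne m in auto)
    also have "(\<Prod>j\<in>R'. s2 (c i (m i)) (c j (m j))) = (\<Prod>j\<in>R'. s2 u (c j (n j)))"
      by (intro prod.cong) (use ne m u in auto)
    finally have 1: "pprod (\<lambda>i j. s2 (c i (m i)) (c j (m j))) R
        = \<kappa> * pprod (\<lambda>i j. s2 (c i (n i)) (c j (n j))) R' * (\<Prod>j\<in>R'. s2 u (c j (n j)))" .
    let ?G = "\<lambda>n j. \<Psi> (c j (n j)) / (\<Prod>x\<in>Sigma R (\<lambda>i. {..k i}) - {(j, n j)}. s2 (case_prod c x) (c j (n j)))"
    have "(\<Prod>j\<in>R. ?G m j) = ?G m i * (\<Prod>j\<in>R'. ?G m j)"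
      unfolding R'(1) by (rule prod.insert[OF R'(3,2)])
    also have "(\<Prod>j\<in>R'. ?G m j) = (\<Prod>j\<in>R'. ?G n j)"
      by (intro prod.cong) (use ne m in auto)
    also have "?G m i = \<Psi> u / ((\<Prod>j\<in>R'. E j u) * E0 u \<mu>)"
    proof -
      have "Sigma R (\<lambda>i. {..k i}) - {(i, \<mu>)} = Sigma R' (\<lambda>j. {..k j}) \<union> Pair i ` ({..k i} - {\<mu>})"
        using i by (auto simp: R'_def)
      moreover have "Sigma R' (\<lambda>j. {..k j}) \<inter> Pair i ` ({..k i} - {\<mu>}) = {}" using R' by auto
      ultimately have "(\<Prod>x\<in>Sigma R (\<lambda>i. {..k i}) - {(i, \<mu>)}. s2 (case_prod c x) u)
          = (\<Prod>x\<in>Sigma R' (\<lambda>j. {..k j}). s2 (case_prod c x) u)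
            * (\<Prod>x\<in>Pair i ` ({..k i} - {\<mu>}). s2 (case_prod c x) u)"
        using R' by (simp only:) (rule prod.union_disjoint, auto)
      also have "(\<Prod>x\<in>Sigma R' (\<lambda>j. {..k j}). s2 (case_prod c x) u) = (\<Prod>j\<in>R'. E j u)"
        unfolding E_def using R' by (subst prod.Sigma) (auto simp: case_prod_unfold)
      also have "(\<Prod>x\<in>Pair i ` ({..k i} - {\<mu>}). s2 (case_prod c x) u) = E0 u \<mu>"
        unfolding E0_def by (subst prod.reindex) (auto simp: inj_on_def)
      finally show ?thesis using m u by simp
    qed
    finally have 2: "(\<Prod>j\<in>R. ?G m j) = \<Psi> u / ((\<Prod>j\<in>R'. E j u) * E0 u \<mu>) * (\<Prod>j\<in>R'. ?G n j)" .
    have 3: "(\<Prod>j\<in>R'. s2 u (c j (n j)) / E j u) = (\<Prod>j\<in>R'. s2 u (c j (n j))) / (\<Prod>j\<in>R'. E j u)"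
      by (rule prod_dividef)
    show ?thesis unfolding grid_wt_def 1 2 3 D_def
      by (simp only: divide_inverse inverse_mult_distrib mult_ac)
  qed
  have g: "grid_wt \<Psi> k n = D * (\<Prod>j\<in>R'. s2 w (c j (n j)) / E j w) * (\<Psi> w / E0 w \<nu>)"
    by (rule grid) (use \<nu> in \<open>simp_all add: \<nu>_def w_def\<close>)
  have g': "grid_wt \<Psi> k n' = D * (\<Prod>j\<in>R'. s2 w' (c j (n j)) / E j w') * (\<Psi> w' / E0 w' (Suc \<nu>))"
    by (rule grid) (use \<nu> in \<open>simp_all add: \<nu>_def w'_def n'\<close>)
  have cc_nz: "\<sigma> (w' - c j s) \<noteq> 0" "\<sigma> (w' + c j s) \<noteq> 0" "\<sigma> (- w - c j s) \<noteq> 0" "\<sigma> (- w + c j s) \<noteq> 0"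
    "s2 (c j s) w' \<noteq> 0" "s2 (c j s) w \<noteq> 0" "s2 w' (c j s) \<noteq> 0" "s2 w (c j s) \<noteq> 0"
    if "j \<in> R'" for j s
  proof -
    have j: "j \<in> R" "j \<noteq> i" using that by (auto simp: R'_def)
    have "s2 (c j s) (c i t) \<noteq> 0" for t using s2_cc[OF j(1) i(1)] j by simp
    then show 1: "s2 (c j s) w' \<noteq> 0" "s2 (c j s) w \<noteq> 0" by (simp_all add: w'_def w_def)
    then show "s2 w' (c j s) \<noteq> 0" "s2 w (c j s) \<noteq> 0" using s2_swap[of w'] s2_swap[of w] by simp_all
    then show "\<sigma> (w' - c j s) \<noteq> 0" "\<sigma> (w' + c j s) \<noteq> 0" by (simp_all add: s2_def)
    have "\<sigma> (c j s + w) \<noteq> 0" "\<sigma> (c j s - w) \<noteq> 0" using 1 by (simp_all add: s2_def)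
    then show "\<sigma> (- w - c j s) \<noteq> 0" "\<sigma> (- w + c j s) \<noteq> 0"
      using odd[of "w + c j s"] by (simp_all add: add.commute)
  qed
  \<comment> \<open>Telescoping chain j leaves 1 / \<open>s2 w' (c j (n j))\<close>, which cancels
    the difference factor of \<open>grid_wt\<close>; the remaining end factors are those by which
    \<open>E j\<close> changes from w to w'.\<close>
  have per_chain: "CH j z0 * (s2 w' (c j (n j)) / E j w') = CH j (- z0) * (s2 w (c j (n j)) / E j w)"
    if j: "j \<in> R'" for j
  proof -
    have jR: "j \<in> R" using j by (simp add: R'_def)
    have ch: "CH j u = \<sigma> (u + 3 * \<zeta> - c j 0) * \<sigma> (u + 3 * \<zeta> + c j (k j)) / s2 (u + 3 * \<zeta>) (c j (n j))"
      if "\<And>s. \<sigma> (u + 3 * \<zeta> - c j s) \<noteq> 0" "\<And>s. \<sigma> (u + 3 * \<zeta> + c j s) \<noteq> 0" for u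
    proof -
      let ?v = "\<lambda>s. if s < n j then - z j s else z j s"
      have "CH j u = (\<Prod>s<k j. \<sigma> (2 * (3 * \<zeta>) + u + ?v s) / \<sigma> (u + ?v s))"
        unfolding CH_def by (intro prod.cong) (simp_all add: vs jR)
      also have "\<dots> = \<sigma> (u + 3 * \<zeta> - c j 0) * \<sigma> (u + 3 * \<zeta> + c j (k j)) / s2 (u + 3 * \<zeta>) (c j (n j))"
        by (rule chain_telescope_all) (use that nk[OF jR] in \<open>simp_all add: c_Suc z_c\<close>)
      finally show ?thesis .
    qed
    have c1: "CH j z0 = \<sigma> (w' - c j 0) * \<sigma> (w' + c j (k j)) / s2 w' (c j (n j))"
      using ch[of z0] cc_nz[OF j] unfolding zw by blast
    have c2: "CH j (- z0) = \<sigma> (- w - c j 0) * \<sigma> (- w + c j (k j)) / s2 (- w) (c j (n j))"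
      using ch[of "- z0"] cc_nz[OF j] unfolding zw by blast
    have c3: "s2 (- w) (c j (n j)) = s2 w (c j (n j))"
      unfolding s2_def using odd[of "w - c j (n j)"] odd[of "w + c j (n j)"] by (simp add: algebra_simps)
    have "E j w \<noteq> 0" "E j w' \<noteq> 0" using cc_nz[OF j] by (auto simp: E_def)
    moreover have "E j w * (\<sigma> (w' - c j 0) * \<sigma> (w' + c j (k j)))
        = E j w' * (\<sigma> (- w - c j 0) * \<sigma> (- w + c j (k j)))"
      unfolding E_def w' by (rule shift_s2) (rule c_Suc)
    ultimately show ?thesis unfolding c1 c2 c3 using cc_nz[OF j] by (simp add: field_simps)
  qed
  have z2: "\<sigma> (2 * z0) \<noteq> 0" using nz_2z[OF i(1)] by (simp add: z0_def)
  have z2': "\<sigma> (2 * - z0) = - \<sigma> (2 * z0)" using odd[of "2 * z0"] by simp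
  have ii_plus: "\<sigma> (c i s + c i t) \<noteq> 0" for s t using nz_cc_plus[OF i(1) i(1), of s t 0] by simp
  have ii_minus: "\<sigma> (c i s - c i t) \<noteq> 0" if "s \<noteq> t" for s t by (rule nz_cc_self[OF that])
  \<comment> \<open>The minus sign of \<open>shift_s2_but\<close> is compensated by \<sigma> (2 * -
    z0) = - \<sigma> (2 * z0).\<close>
  have own_chain: "CH0 z0 / \<sigma> (2 * z0) / E0 w' (Suc \<nu>) = CH0 (- z0) / \<sigma> (2 * - z0) / E0 w \<nu>"
  proof -
    have ch: "CH0 u = \<sigma> (u + 3 * \<zeta> - c i 0) * \<sigma> (u + 3 * \<zeta> + c i (k i))
        / (\<sigma> (u + 3 * \<zeta> - c i \<nu>) * \<sigma> (u + 3 * \<zeta> + c i (Suc \<nu>)))"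
      if "\<And>s. s \<le> \<nu> \<Longrightarrow> \<sigma> (u + 3 * \<zeta> - c i s) \<noteq> 0" "\<And>s. \<nu> < s \<Longrightarrow> \<sigma> (u + 3 * \<zeta> + c i s) \<noteq> 0" for u
    proof -
      let ?v = "\<lambda>s. if s < \<nu> then - z i s else z i s"
      have "CH0 u = (\<Prod>s\<in>{..<k i}-{\<nu>}. \<sigma> (2 * (3 * \<zeta>) + u + ?v s) / \<sigma> (u + ?v s))"
        unfolding CH0_def by (intro prod.cong) (simp_all add: vs i \<nu>_def)
      also have "\<dots> = \<sigma> (u + 3 * \<zeta> - c i 0) * \<sigma> (u + 3 * \<zeta> + c i (k i))
        / (\<sigma> (u + 3 * \<zeta> - c i \<nu>) * \<sigma> (u + 3 * \<zeta> + c i (Suc \<nu>)))"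
        by (rule chain_telescope_but) (use that \<nu> in \<open>simp_all add: c_Suc z_c\<close>)
      finally show ?thesis .
    qed
    have c1: "CH0 z0 = \<sigma> (w' - c i 0) * \<sigma> (w' + c i (k i)) / (\<sigma> (w' - c i \<nu>) * \<sigma> (w' + c i (Suc \<nu>)))"
    proof -
      have "\<sigma> (w' - c i s) \<noteq> 0" if "s \<le> \<nu>" for s unfolding w'_def by (rule ii_minus) (use that in simp)
      moreover have "\<sigma> (w' + c i s) \<noteq> 0" for s unfolding w'_def by (rule ii_plus)
      ultimately show ?thesis using ch[of z0] unfolding zw by blast
    qed
    have c2: "CH0 (- z0) = \<sigma> (- w - c i 0) * \<sigma> (- w + c i (k i)) / (\<sigma> (- w - c i \<nu>) * \<sigma> (- w + c i (Suc \<nu>)))"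
    proof -
      have "\<sigma> (- w - c i s) \<noteq> 0" for s
        using ii_plus[of \<nu> s] odd[of "w + c i s"] by (simp add: w_def add.commute)
      moreover have "\<sigma> (- w + c i s) \<noteq> 0" if "\<nu> < s" for s
        using ii_minus[of s \<nu>] that by (simp add: w_def)
      ultimately show ?thesis using ch[of "- z0"] unfolding zw by blast
    qed
    have a: "w' - c i \<nu> = 6 * \<zeta>" "- w + c i (Suc \<nu>) = 6 * \<zeta>" "w' + c i (Suc \<nu>) = 2 * (w + 6 * \<zeta>)"
      "- w - c i \<nu> = - 2 * w" by (simp_all add: w'_def w_def c_Suc)
    have "E0 w \<nu> \<noteq> 0" "E0 w' (Suc \<nu>) \<noteq> 0"
      using s2_cc[OF i(1) i(1)] by (auto simp: E0_def w_def w'_def)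
    moreover have "\<sigma> (2 * (w + 6 * \<zeta>)) \<noteq> 0" "\<sigma> (- 2 * w) \<noteq> 0"
    proof -
      show "\<sigma> (2 * (w + 6 * \<zeta>)) \<noteq> 0"
        using ii_plus[of "Suc \<nu>" "Suc \<nu>"] unfolding a(3)[symmetric] w'_def .
      show "\<sigma> (- 2 * w) \<noteq> 0"
      proof -
        have "- 2 * w = - (w + w)" by simp
        then show ?thesis using ii_plus[of \<nu> \<nu>] odd[of "w + w"] by (simp only: w_def) simp
      qed
    qed
    moreover have "\<sigma> (6 * \<zeta>) \<noteq> 0" using nz_zeta[of 3] by simp
    moreover have "E0 w \<nu> * \<sigma> (- 2 * w) * (\<sigma> (w' - c i 0) * \<sigma> (w' + c i (k i)))
        = - (E0 w' (Suc \<nu>) * \<sigma> (2 * (w + 6 * \<zeta>)) * (\<sigma> (- w - c i 0) * \<sigma> (- w + c i (k i))))"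
      unfolding E0_def w' by (rule shift_s2_but) (use \<nu> in \<open>simp_all add: c_Suc w_def\<close>)
    ultimately show ?thesis unfolding c1 c2 a z2' using z2
      by (simp add: field_simps)
  qed
  have psi: "\<beta> z0 * \<Psi> w' = \<beta> (- z0) * \<Psi> w"
    using \<Psi> by (simp add: \<beta>_def z0_def w_def w'_def \<nu>_def mult_ac)
  have chains: "(\<Prod>j\<in>R'. CH j z0) * (\<Prod>j\<in>R'. s2 w' (c j (n j)) / E j w')
      = (\<Prod>j\<in>R'. CH j (- z0)) * (\<Prod>j\<in>R'. s2 w (c j (n j)) / E j w)"
    unfolding prod.distrib[symmetric] by (rule prod.cong[OF refl per_chain])
  have "chain_wt b1 b2 b3 b4 k n * grid_wt \<Psi> k n'
      = W * D * (\<beta> z0 * \<Psi> w') * (CH0 z0 / \<sigma> (2 * z0) / E0 w' (Suc \<nu>))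
        * ((\<Prod>j\<in>R'. CH j z0) * (\<Prod>j\<in>R'. s2 w' (c j (n j)) / E j w'))"
    unfolding t g' BB by (simp add: divide_inverse mult_ac)
  also have "\<dots> = W * D * (\<beta> (- z0) * \<Psi> w) * (CH0 (- z0) / \<sigma> (2 * - z0) / E0 w \<nu>)
        * ((\<Prod>j\<in>R'. CH j (- z0)) * (\<Prod>j\<in>R'. s2 w (c j (n j)) / E j w))"
    unfolding psi own_chain chains ..
  also have "\<dots> = chain_wt b1 b2 b3 b4 k n' * grid_wt \<Psi> k n"
    unfolding t' g BB by (simp only: divide_inverse mult_ac)
  finally show ?thesis .
qed

end

section \<open>Coefficients of the cubic expansion\<close>

text \<open>An index m of largest \<mu> does not occur in the equations of the other indices, so
  these are solved first and the equation of m determines its own unknown.\<close>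

lemma triangular_solve:
  fixes f :: "'n \<Rightarrow> 'n \<Rightarrow> 'a::field" and \<mu> :: "'n \<Rightarrow> nat"
  assumes "finite B" "\<And>n. n \<in> B \<Longrightarrow> f n n \<noteq> 0"
    and "\<And>n l. n \<in> B \<Longrightarrow> l \<in> B \<Longrightarrow> f n l \<noteq> 0 \<Longrightarrow> l \<noteq> n \<Longrightarrow> \<mu> l < \<mu> n"
  shows "\<exists>\<alpha>. \<forall>n\<in>B. (\<Sum>l\<in>B. f n l * \<alpha> l) = F n"
  using assms
proof (induction "card B" arbitrary: B)
  case 0 then show ?case by simp
next
  case (Suc N)
  then have "B \<noteq> {}" by auto
  then have "Max (\<mu> ` B) \<in> \<mu> ` B" using Suc.prems(1) by simp
  then obtain m where "m \<in> B" "\<mu> m = Max (\<mu> ` B)" by auto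
  then have m: "m \<in> B" "\<And>n. n \<in> B \<Longrightarrow> \<mu> n \<le> \<mu> m" using Suc.prems(1) by simp_all
  define B' where "B' = B - {m}"
  have B': "B = insert m B'" "m \<notin> B'" "finite B'" using m Suc.prems(1) by (auto simp: B'_def)
  have "\<exists>\<alpha>. \<forall>n\<in>B'. (\<Sum>l\<in>B'. f n l * \<alpha> l) = F n"
    by (rule Suc.hyps(1)) (use Suc.hyps(2) Suc.prems B' in auto)
  then obtain \<alpha> where \<alpha>: "\<And>n. n \<in> B' \<Longrightarrow> (\<Sum>l\<in>B'. f n l * \<alpha> l) = F n" by blast
  define \<alpha>' where "\<alpha>' = \<alpha>(m := (F m - (\<Sum>l\<in>B'. f m l * \<alpha> l)) / f m m)"
  have eq: "(\<Sum>l\<in>B'. f n l * \<alpha>' l) = (\<Sum>l\<in>B'. f n l * \<alpha> l)" for n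
    by (intro sum.cong) (use B'(2) in \<open>auto simp: \<alpha>'_def\<close>)
  have "(\<Sum>l\<in>B. f n l * \<alpha>' l) = F n" if "n \<in> B" for n
  proof (cases "n = m")
    case True
    then show ?thesis
      unfolding B'(1) sum.insert[OF B'(3,2)] eq using Suc.prems(2)[OF m(1)] by (simp add: \<alpha>'_def)
  next
    case False
    then have "n \<in> B'" using that by (simp add: B'_def)
    have "f n m = 0" using Suc.prems(3)[OF that m(1)] m(2)[OF that] False by force
    then show ?thesis unfolding B'(1) sum.insert[OF B'(3,2)] eq using \<alpha>[OF \<open>n \<in> B'\<close>] by simp
  qed
  then show ?case by blast
qed

context odd_sigma
begin

text \<open>The coordinates are released from their finite sets one at a time, each by the
  one-variable statement.\<close>

lemma H_vanish_multi:
  fixes D :: "('i \<Rightarrow> complex) \<Rightarrow> complex"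
  assumes "finite R" and H: "\<And>j w. j \<in> R \<Longrightarrow> (N, \<lambda>x. D (w(j := x))) \<in> H"
    and P: "\<And>j. j \<in> R \<Longrightarrow> finite (P j) \<and> card (P j) > N"
    and nz: "\<And>j x y. j \<in> R \<Longrightarrow> x \<in> P j \<Longrightarrow> y \<in> P j \<Longrightarrow> x \<noteq> y \<Longrightarrow> s2 x y \<noteq> 0"
    and zero: "\<And>w. (\<And>j. j \<in> R \<Longrightarrow> w j \<in> P j) \<Longrightarrow> D w = 0"
  shows "D w = 0"
proof -
  have "J \<subseteq> R \<Longrightarrow> \<forall>w. (\<forall>j\<in>R - J. w j \<in> P j) \<longrightarrow> D w = 0" if "finite J" for J
    using that
  proof (induction J rule: finite_induct)
    case empty then show ?case using zero by auto
  next
    case (insert a J)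
    show ?case
    proof (intro allI impI)
      fix w assume w: "\<forall>j\<in>R - insert a J. w j \<in> P j"
      have "D (w(a := x)) = 0" for x
      proof (rule H_vanish[OF H])
        show "D (w(a := y)) = 0" if "y \<in> P a" for y
          using insert.IH insert.prems w that by auto
      qed (use insert.prems P[of a] nz[of a] in auto)
      from this[of "w a"] show "D w = 0" by simp
    qed
  qed
  from this[OF assms(1)] show ?thesis by auto
qed

end

text \<open>The shifted factorial in additive notation. With q = exp (4 \<zeta>), the step d = 2
  belongs to base q and d = 6 to base q^3.\<close>

definition sigma_run :: "(complex \<Rightarrow> complex) \<Rightarrow> complex \<Rightarrow> int \<Rightarrow> int \<Rightarrow> nat \<Rightarrow> complex \<Rightarrow> complex" where
  "sigma_run \<sigma> \<zeta> d a L w = (\<Prod>y<L. \<sigma> (w + of_int (a + d * int y) * \<zeta>))"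

text \<open>The dependence on one b i of the right-hand side. Both runs are centred at 0, so that
  the function is even.\<close>

definition run_ratio :: "(complex \<Rightarrow> complex) \<Rightarrow> complex \<Rightarrow> nat \<Rightarrow> complex \<Rightarrow> complex" where
  "run_ratio \<sigma> \<zeta> N w = sigma_run \<sigma> \<zeta> 2 (- int N) (N + 1) w / sigma_run \<sigma> \<zeta> 6 (- 3 * int N) (N + 1) w"

section \<open>Products along arithmetic progressions and the functions to be interpolated\<close>

context generic_chains
begin

abbreviation run :: "int \<Rightarrow> int \<Rightarrow> nat \<Rightarrow> complex \<Rightarrow> complex" where
  "run \<equiv> sigma_run \<sigma> \<zeta>"

lemmas run_def = sigma_run_def

lemma run_0 [simp]: "run d a 0 w = 1"
  by (simp add: run_def)

lemma run_Suc: "run d a (Suc L) w = run d a L w * \<sigma> (w + of_int (a + d * int L) * \<zeta>)"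
  by (simp add: run_def)

lemma run_add: "run d a (L + M) w = run d a L w * run d (a + d * int L) M w"
proof (induction M)
  case (Suc M)
  have "a + d * int (L + M) = a + d * int L + d * int M" by (simp add: algebra_simps)
  then show ?case using Suc by (simp only: add_Suc_right run_Suc mult.assoc)
qed simp

lemma run_1: "run d a (Suc 0) w = \<sigma> (w + of_int a * \<zeta>)"
  by (simp add: run_Suc)

lemma run_shift: "run d a L (w + of_int e * \<zeta>) = run d (a + e) L w"
  unfolding run_def by (intro prod.cong refl arg_cong[where f = \<sigma>]) (simp add: algebra_simps)

lemma run_swap: "run d a L w * run d (a + d * int L) M w = run d a M w * run d (a + d * int M) L w"
  using run_add[of d a L M w] run_add[of d a M L w] by (simp add: add.commute)

text \<open>Sorting a run of step 2 by residues modulo 6; this is how base q and base q^3 are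
  compared.\<close>

lemma run_split3: "run 2 a (3 * L) w = run 6 a L w * run 6 (a + 2) L w * run 6 (a + 4) L w"
proof (induction L)
  case (Suc L)
  have "3 * Suc L = Suc (Suc (Suc (3 * L)))" by simp
  then have "run 2 a (3 * Suc L) w = run 2 a (3 * L) w * \<sigma> (w + of_int (a + 2 * int (3 * L)) * \<zeta>)
      * \<sigma> (w + of_int (a + 2 * int (Suc (3 * L))) * \<zeta>)
      * \<sigma> (w + of_int (a + 2 * int (Suc (Suc (3 * L)))) * \<zeta>)"
    by (simp only: run_Suc)
  moreover have "a + 2 * int (3 * L) = a + 6 * int L"
    "a + 2 * int (Suc (3 * L)) = a + 2 + 6 * int L"
    "a + 2 * int (Suc (Suc (3 * L))) = a + 4 + 6 * int L" by simp_all
  ultimately show ?case unfolding Suc.IH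
    by (simp only: run_Suc[of 6 a L] run_Suc[of 6 "a + 2" L] run_Suc[of 6 "a + 4" L] mult_ac)
qed simp

lemma run_split3_Suc: "run 2 a (3 * L + 1) w = run 6 a (L + 1) w * run 6 (a + 2) L w * run 6 (a + 4) L w"
proof -
  have "a + 2 * int (3 * L) = a + 6 * int L" by simp
  then have "run 2 a (3 * L + 1) w = run 2 a (3 * L) w * \<sigma> (w + of_int (a + 6 * int L) * \<zeta>)"
    by (simp only: Suc_eq_plus1[symmetric] run_Suc)
  then show ?thesis
    unfolding run_split3 Suc_eq_plus1[symmetric] run_Suc[of 6 a L] by (simp only: mult_ac)
qed

lemma run_reflect: "run d a L (- w) = (-1) ^ L * run d (- a - d * (int L - 1)) L w"
proof -
  have "run d a L (- w) = (\<Prod>y<L. - \<sigma> (w + of_int (- a - d * (int L - 1) + d * int (L - Suc y)) * \<zeta>))"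
    unfolding run_def
  proof (intro prod.cong refl)
    fix y assume "y \<in> {..<L}"
    then have "- w + of_int (a + d * int y) * \<zeta>
        = - (w + of_int (- a - d * (int L - 1) + d * int (L - Suc y)) * \<zeta>)"
      by (simp add: of_nat_diff algebra_simps)
    then show "\<sigma> (- w + of_int (a + d * int y) * \<zeta>)
        = - \<sigma> (w + of_int (- a - d * (int L - 1) + d * int (L - Suc y)) * \<zeta>)" by (simp only: odd)
  qed
  also have "\<dots> = (\<Prod>y<L. - \<sigma> (w + of_int (- a - d * (int L - 1) + d * int y) * \<zeta>))"
    by (rule prod.nat_diff_reindex)
  finally show ?thesis by (simp add: prod_uminus run_def)
qed

text \<open>The offsets that follow the run -N, ..., N: multiplication by \<open>s2 (h N y)\<close>
  for y = 0, 1, ... prolongs that run by one factor at each end.\<close>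

definition h :: "nat \<Rightarrow> nat \<Rightarrow> complex" where
  "h N y = of_int (int N + 2 + 2 * int y) * \<zeta>"

lemma s2_h: "s2 (h N y) w = - (\<sigma> (w + of_int (int N + 2 + 2 * int y) * \<zeta>) * \<sigma> (w + of_int (- int N - 2 - 2 * int y) * \<zeta>))"
proof -
  have "s2 (h N y) w = - s2 w (h N y)" by (rule s2_swap)
  moreover have "w - h N y = w + of_int (- int N - 2 - 2 * int y) * \<zeta>" by (simp add: h_def algebra_simps)
  moreover have "w + h N y = w + of_int (int N + 2 + 2 * int y) * \<zeta>" by (simp add: h_def)
  ultimately show ?thesis by (simp only: s2_def)
qed

lemma run_h:
  "run 2 (- int N) (N + 1) w * (\<Prod>y<M. s2 (h N y) w)
    = (-1) ^ M * run 2 (- int N - 2 * int M) (N + 1 + 2 * M) w"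
proof (induction M)
  case (Suc M)
  let ?a = "- int N - 2 * int M" and ?L = "N + 1 + 2 * M"
  have "- int N - 2 * int (Suc M) = ?a - 2" "N + 1 + 2 * Suc M = Suc 0 + ?L + Suc 0" by simp_all
  then have "run 2 (- int N - 2 * int (Suc M)) (N + 1 + 2 * Suc M) w
      = run 2 (?a - 2) (Suc 0 + ?L + Suc 0) w" by (simp only:)
  also have "\<dots> = \<sigma> (w + of_int (?a - 2) * \<zeta>) * run 2 ?a ?L w * \<sigma> (w + of_int (?a + 2 * int ?L) * \<zeta>)"
  proof -
    have "?a - 2 + 2 * int (Suc 0) = ?a" "?a - 2 + 2 * int (Suc 0 + ?L) = ?a + 2 * int ?L" by simp_all
    then show ?thesis
      unfolding run_add[of 2 "?a - 2" "Suc 0 + ?L" "Suc 0"] run_add[of 2 "?a - 2" "Suc 0" ?L]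
      by (simp only: run_1)
  qed
  also have "?a - 2 = - int N - 2 - 2 * int M" by simp
  also have "?a + 2 * int ?L = int N + 2 + 2 * int M" by simp
  finally show ?case unfolding prod.lessThan_Suc mult.assoc[symmetric] Suc s2_h[of N M]
    by (simp only: power_Suc mult_ac mult_minus_left mult_minus_right mult_1)
qed simp

abbreviation F :: "nat \<Rightarrow> complex \<Rightarrow> complex" where
  "F \<equiv> run_ratio \<sigma> \<zeta>"

lemmas F_def = run_ratio_def

definition Fnum :: "nat \<Rightarrow> complex \<Rightarrow> complex" where
  "Fnum N w = (\<Prod>y<N. s2 (of_int (- 3 * int N + 2 + 6 * int y) * \<zeta>) w)"

text \<open>After N prolongations the run of step 2 reaches from -3N to 3N. The residue class of -3N
  modulo 6 is the denominator of F; the two other classes are reflections of each other under w ->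
  -w and pair up to N factors \<open>s2\<close>.\<close>

lemma Fnum_eq:
  "Fnum N w * run 6 (- 3 * int N) (N + 1) w = run 2 (- int N) (N + 1) w * (\<Prod>y<N. s2 (h N y) w)"
proof -
  have "run 2 (- int N) (N + 1) w * (\<Prod>y<N. s2 (h N y) w) = (-1) ^ N * run 2 (- 3 * int N) (3 * N + 1) w"
  proof -
    have "- int N - 2 * int N = - 3 * int N" "N + 1 + 2 * N = 3 * N + 1" by simp_all
    then show ?thesis using run_h[of N w N] by simp
  qed
  also have "\<dots> = run 6 (- 3 * int N) (N + 1) w * (run 6 (- 3 * int N + 2) N w * ((-1) ^ N * run 6 (- 3 * int N + 4) N w))"
    unfolding run_split3_Suc by (simp only: mult_ac)
  also have "(-1) ^ N * run 6 (- 3 * int N + 4) N w = run 6 (- 3 * int N + 2) N (- w)"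
    unfolding run_reflect by (simp add: algebra_simps)
  also have "run 6 (- 3 * int N + 2) N w * run 6 (- 3 * int N + 2) N (- w) = Fnum N w"
    unfolding run_def Fnum_def s2_def prod.distrib by (simp add: add.commute)
  finally show ?thesis by (simp add: mult.commute)
qed

lemma F_Fnum:
  assumes "run 6 (- 3 * int N) (N + 1) w \<noteq> 0"
  shows "F N w * (\<Prod>y<N. s2 (h N y) w) = Fnum N w"
  using Fnum_eq[of N w] assms by (simp add: F_def field_simps)

lemma Fnum_H: "(N, Fnum N) \<in> H"
  using H_prod[of "{..<N}" 1] by (simp add: Fnum_def [abs_def])

text \<open>The constants are read off from the ratio of \<open>Psi\<close> at neighbouring nodes:
  three factors from the run of step 2 (B1, B2, B3) and one from the run of step 6 (B4). Together
  with 6 K \<zeta> they add up to 6 \<zeta>, the balancing condition of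
  \<open>wt_sum\<close>.\<close>

definition B1 :: "nat \<Rightarrow> nat \<Rightarrow> complex" where "B1 N K = of_int (- (int N + 2 * int K - 3)) * \<zeta>"
definition B2 :: "nat \<Rightarrow> nat \<Rightarrow> complex" where "B2 N K = of_int (- (int N + 2 * int K - 1)) * \<zeta>"
definition B3 :: "nat \<Rightarrow> nat \<Rightarrow> complex" where "B3 N K = of_int (- (int N + 2 * int K + 1)) * \<zeta>"
definition B4 :: "nat \<Rightarrow> complex" where "B4 N = of_int (3 * int N + 3) * \<zeta>"

text \<open>With this choice \<open>grid_wt\<close> is the dual row multiplied by the values of F;
  this explains K - 1 instead of K factors.\<close>

definition Psi :: "nat \<Rightarrow> nat \<Rightarrow> complex \<Rightarrow> complex" where
  "Psi N K w = F N w * (\<Prod>y<K - 1. s2 (h N y) w)"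

text \<open>The shift by 6 \<zeta> drops three factors at one end of the run of step 2 and adds
  three at the other, and exchanges one factor of the run of step 6. Relative to the midpoint z'
  these are the four plus and the four minus factors.\<close>

lemma Psi_step:
  assumes K: "K \<ge> 1" and nz: "run 6 (- 3 * int N) (N + 1) w \<noteq> 0" "run 6 (- 3 * int N) (N + 1) (w + 6 * \<zeta>) \<noteq> 0"
    and z: "z' = w + 3 * \<zeta>"
  shows "Psi N K (w + 6 * \<zeta>) * (\<sigma> (B1 N K + z') * \<sigma> (B2 N K + z') * \<sigma> (B3 N K + z') * \<sigma> (B4 N + z'))
    = Psi N K w * (\<sigma> (B1 N K - z') * \<sigma> (B2 N K - z') * \<sigma> (B3 N K - z') * \<sigma> (B4 N - z'))"
proof -
  obtain M where M: "K = Suc M" using K by (cases K) auto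
  let ?a = "- int N - 2 * int M" and ?L = "N + 1 + 2 * M"
  let ?Q = "run 6 (- 3 * int N) (N + 1)"
  have Psi: "Psi N K u = (-1) ^ M * run 2 ?a ?L u / ?Q u" for u
    using run_h[of N u M] by (simp add: Psi_def F_def M)
  have num: "run 2 ?a ?L (w + 6 * \<zeta>) * run 2 ?a 3 w = run 2 ?a ?L w * run 2 (?a + 2 * int ?L) 3 w"
    using run_swap[of 2 ?a ?L w 3] run_shift[of 2 ?a ?L w 6] by (simp add: mult.commute)
  have den: "?Q (w + 6 * \<zeta>) * \<sigma> (w + of_int (- 3 * int N) * \<zeta>) = ?Q w * \<sigma> (w + of_int (3 * int N + 6) * \<zeta>)"
    using run_swap[of 6 "- 3 * int N" "N + 1" w "Suc 0"] run_shift[of 6 "- 3 * int N" "N + 1" w 6]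
    by (simp add: run_1 mult.commute algebra_simps)
  have r3: "run 2 b 3 u = \<sigma> (u + of_int b * \<zeta>) * \<sigma> (u + of_int (b + 2) * \<zeta>) * \<sigma> (u + of_int (b + 4) * \<zeta>)" for b u
    by (simp add: run_Suc numeral_3_eq_3)
  have p: "\<sigma> (B1 N K + z') * \<sigma> (B2 N K + z') * \<sigma> (B3 N K + z') = run 2 ?a 3 w"
  proof -
    have "B1 N K + z' = w + of_int (?a + 4) * \<zeta>" "B2 N K + z' = w + of_int (?a + 2) * \<zeta>"
      "B3 N K + z' = w + of_int ?a * \<zeta>"
      by (simp_all add: B1_def B2_def B3_def z M algebra_simps)
    then show ?thesis unfolding r3 by (simp only: mult_ac)
  qed
  have m: "\<sigma> (B1 N K - z') * \<sigma> (B2 N K - z') * \<sigma> (B3 N K - z') = - run 2 (?a + 2 * int ?L) 3 w"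
  proof -
    have "B1 N K - z' = - (w + of_int (?a + 2 * int ?L) * \<zeta>)"
      "B2 N K - z' = - (w + of_int (?a + 2 * int ?L + 2) * \<zeta>)"
      "B3 N K - z' = - (w + of_int (?a + 2 * int ?L + 4) * \<zeta>)"
      by (simp_all add: B1_def B2_def B3_def z M algebra_simps)
    then show ?thesis unfolding r3 by (simp only: odd) simp
  qed
  have b4: "B4 N + z' = w + of_int (3 * int N + 6) * \<zeta>" "B4 N - z' = - (w + of_int (- 3 * int N) * \<zeta>)"
    by (simp_all add: B4_def z algebra_simps)
  have cross: "A / P' * (t * s) = C / P * (u * v)"
    if "P \<noteq> 0" "P' \<noteq> 0" "(A * t) * (P * s) = (C * u) * (P' * v)" for A P P' t s C u v :: complex
    using that by (simp add: field_simps)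
  have "(run 2 ?a ?L (w + 6 * \<zeta>) * run 2 ?a 3 w) * (?Q w * \<sigma> (w + of_int (3 * int N + 6) * \<zeta>))
      = (run 2 ?a ?L w * run 2 (?a + 2 * int ?L) 3 w) * (?Q (w + 6 * \<zeta>) * \<sigma> (w + of_int (- 3 * int N) * \<zeta>))"
    unfolding num den ..
  then have E: "run 2 ?a ?L (w + 6 * \<zeta>) / ?Q (w + 6 * \<zeta>) * (run 2 ?a 3 w * \<sigma> (w + of_int (3 * int N + 6) * \<zeta>))
      = run 2 ?a ?L w / ?Q w * (run 2 (?a + 2 * int ?L) 3 w * \<sigma> (w + of_int (- 3 * int N) * \<zeta>))"
    by (rule cross[OF nz])
  show ?thesis
    unfolding Psi p m b4 odd minus_mult_minus
    using arg_cong[OF E, of "\<lambda>x. (-1) ^ M * x"]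
    by (simp only: mult.assoc[symmetric] times_divide_eq_right)
qed


lemma nz_c: "i \<in> R \<Longrightarrow> \<sigma> (c i s + of_int m * \<zeta>) \<noteq> 0"
  using nz_single[of i "6 * int s + m"] by (simp add: c_def algebra_simps)

lemma nz_run: "i \<in> R \<Longrightarrow> run d a L (c i s) \<noteq> 0"
  unfolding run_def prod_zero_iff[OF finite_lessThan] using nz_c by blast

lemma nz_h: "i \<in> R \<Longrightarrow> s2 (h N y) (c i s) \<noteq> 0"
  unfolding s2_h using nz_c[of i s] by (simp only: neg_equal_0_iff_equal mult_eq_0_iff) simp

lemma nz_Psi: "i \<in> R \<Longrightarrow> Psi N K (c i s) \<noteq> 0"
  unfolding Psi_def F_def using nz_run[of i] nz_h[of i] by (simp add: prod_zero_iff)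

lemma nz_grid_wt: "n \<in> box k \<Longrightarrow> grid_wt (Psi N K) k n \<noteq> 0"
  unfolding grid_wt_def
proof (intro no_zero_divisors)
  show "pprod (\<lambda>i j. s2 (c i (n i)) (c j (n j))) R \<noteq> 0"
    unfolding pprod_def using finite_R s2_cc by (subst prod_zero_iff) (auto intro!: finite_pairs)
  have "Psi N K (c j (n j)) / (\<Prod>x\<in>Sigma R (\<lambda>i. {..k i}) - {(j, n j)}. s2 (case_prod c x) (c j (n j))) \<noteq> 0"
    if j: "j \<in> R" for j
  proof -
    have "s2 (case_prod c x) (c j (n j)) \<noteq> 0" if "x \<in> Sigma R (\<lambda>i. {..k i}) - {(j, n j)}" for x
      using that s2_cc[OF _ j, of "fst x" "snd x" "n j"] by (cases x) auto
    then show ?thesis using nz_Psi[OF j] finite_R by (simp add: prod_zero_iff)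
  qed
  then show "(\<Prod>j\<in>R. Psi N K (c j (n j)) / (\<Prod>x\<in>Sigma R (\<lambda>i. {..k i}) - {(j, n j)}.
      s2 (case_prod c x) (c j (n j)))) \<noteq> 0"
    using finite_R by (simp add: prod_zero_iff)
qed

text \<open>B4 stands first because the closed form of \<open>wt_sum\<close> adds its first
  parameter to the three others, and B4 + B1, B4 + B2, B4 + B3 are consecutive even multiples of
  \<zeta>.\<close>

definition cubic_wt :: "nat \<Rightarrow> (nat \<Rightarrow> nat) \<Rightarrow> (nat \<Rightarrow> nat) \<Rightarrow> complex" where
  "cubic_wt N k n = chain_wt (B4 N) (B1 N (sum k R)) (B2 N (sum k R)) (B3 N (sum k R)) k n"

text \<open>The two weights have a ratio independent of n: links are reversed one by one until n =
  k, where all signs are minus and the weight is a single product.\<close>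

lemma cubic_wt_grid:
  assumes n: "n \<in> box k" and k: "k \<in> PiE R (\<lambda>_. UNIV)"
  shows "cubic_wt N k n * grid_wt (Psi N (sum k R)) k k = cubic_wt N k k * grid_wt (Psi N (sum k R)) k n"
  using n
proof (induction "sum k R - sum n R" arbitrary: n rule: less_induct)
  case less
  show ?case
  proof (cases "n = k")
    case True then show ?thesis by simp
  next
    case False
    let ?K = "sum k R"
    have le: "n i \<le> k i" if "i \<in> R" for i using less.prems that by (auto simp: PiE_iff)
    obtain i where i: "i \<in> R" "n i \<noteq> k i"
      using False PiE_ext[of n R "\<lambda>_. UNIV" k] k less.prems by (auto simp: PiE_iff)
    then have lt: "n i < k i" using le[of i] by simp
    define n' where "n' = n(i := Suc (n i))"
    have n': "n' \<in> box k" using less.prems i lt by (auto simp: n'_def PiE_iff extensional_def)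
    have "sum n' R = Suc (sum n R)"
      unfolding n'_def using i(1) finite_R by (simp add: sum.remove[of R i])
    moreover have "sum n' R \<le> ?K" using n' by (intro sum_mono) (auto simp: PiE_iff)
    ultimately have "?K - sum n' R < ?K - sum n R" by simp
    from less.hyps[OF this n'] have IH:
      "cubic_wt N k n' * grid_wt (Psi N ?K) k k = cubic_wt N k k * grid_wt (Psi N ?K) k n'" .
    have K: "?K \<ge> 1" using \<open>sum n' R = Suc (sum n R)\<close> \<open>sum n' R \<le> ?K\<close> by simp
    have "Psi N ?K (c i (n i) + 6 * \<zeta>)
        * (\<sigma> (B1 N ?K + z i (n i)) * \<sigma> (B2 N ?K + z i (n i)) * \<sigma> (B3 N ?K + z i (n i)) * \<sigma> (B4 N + z i (n i)))
      = Psi N ?K (c i (n i))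
        * (\<sigma> (B1 N ?K - z i (n i)) * \<sigma> (B2 N ?K - z i (n i)) * \<sigma> (B3 N ?K - z i (n i)) * \<sigma> (B4 N - z i (n i)))"
      by (rule Psi_step[OF K]) (use nz_run[OF i(1)] in \<open>simp_all add: z_c c_Suc[symmetric] del: run_Suc\<close>)
    then have S: "cubic_wt N k n * grid_wt (Psi N ?K) k n' = cubic_wt N k n' * grid_wt (Psi N ?K) k n"
      unfolding cubic_wt_def
      by (intro flip_step[OF less.prems i(1) lt n'_def]) (simp only: c_Suc mult_ac)
    have "(cubic_wt N k n * grid_wt (Psi N ?K) k k) * grid_wt (Psi N ?K) k n'
        = (cubic_wt N k n * grid_wt (Psi N ?K) k n') * grid_wt (Psi N ?K) k k"
      by (simp only: mult_ac)
    also have "\<dots> = (cubic_wt N k n' * grid_wt (Psi N ?K) k k) * grid_wt (Psi N ?K) k n"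
      unfolding S by (simp only: mult_ac)
    also have "\<dots> = (cubic_wt N k k * grid_wt (Psi N ?K) k n) * grid_wt (Psi N ?K) k n'"
      unfolding IH by (simp only: mult_ac)
    finally show ?thesis using nz_grid_wt[OF n'] by simp
  qed
qed

text \<open>The three products of step 6 delivered by \<open>wt_sum\<close> interleave to one run of
  step 2.\<close>

lemma sum_cubic_wt:
  "(\<Sum>n\<in>box k. cubic_wt N k n) = run 2 (2 * int N - 2 * int (sum k R) + 2) (3 * sum k R) 0"
proof -
  let ?K = "sum k R"
  have "(\<Sum>n\<in>box k. cubic_wt N k n)
      = (\<Sum>S\<in>Pow (links k). wt (B4 N) (B1 N ?K) (B2 N ?K) (B3 N ?K) (links k) (flip (case_prod z) S) (6 * \<zeta>))"
    unfolding cubic_wt_def by (rule sum_chain_wt[symmetric])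
  also have "\<dots> = (\<Prod>i<card (links k). \<sigma> (B4 N + B1 N ?K + of_nat i * (6 * \<zeta>))
      * \<sigma> (B4 N + B2 N ?K + of_nat i * (6 * \<zeta>)) * \<sigma> (B4 N + B3 N ?K + of_nat i * (6 * \<zeta>)))"
  proof (rule wt_sum)
    show "\<sigma> (2 * case_prod z x) \<noteq> 0" if "x \<in> links k" for x
      using that nz_2z by (auto simp: links_def)
    show "s2 (case_prod z x) (case_prod z y) \<noteq> 0" if "x \<in> links k" "y \<in> links k" "x \<noteq> y" for x y
      using that s2_zz[of "fst x" "fst y" "snd x" "snd y"] by (cases x, cases y) (auto simp: links_def)
  qed (simp_all add: card_links B1_def B2_def B3_def B4_def algebra_simps)
  also have "\<dots> = (\<Prod>i<?K. \<sigma> (0 + of_int (2 * int N - 2 * int ?K + 2 + 4 + 6 * int i) * \<zeta>)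
      * \<sigma> (0 + of_int (2 * int N - 2 * int ?K + 2 + 2 + 6 * int i) * \<zeta>)
      * \<sigma> (0 + of_int (2 * int N - 2 * int ?K + 2 + 6 * int i) * \<zeta>))"
    unfolding card_links
    by (intro prod.cong refl arg_cong2[where f = "(*)"] arg_cong[where f = \<sigma>])
      (simp_all add: B1_def B2_def B3_def B4_def algebra_simps)
  also have "\<dots> = run 2 (2 * int N - 2 * int ?K + 2) (3 * ?K) 0"
    unfolding run_split3 unfolding run_def prod.distrib by (simp only: mult_ac)
  finally show ?thesis .
qed

lemma chain_wt_top: "chain_wt b1 b2 b3 b4 k k = wt b1 b2 b3 b4 (links k) (\<lambda>x. - case_prod z x) (6 * \<zeta>)"
  unfolding chain_wt_def by (rule wt_cong) (auto simp: flip_def surv_def)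

lemma nz_minus_z: "i \<in> R \<Longrightarrow> \<sigma> (of_int m * \<zeta> + - z i s) \<noteq> 0"
proof -
  assume i: "i \<in> R"
  have "of_int m * \<zeta> + - z i s = - (c i s + of_int (3 - m) * \<zeta>)" by (simp add: z_c algebra_simps)
  then show ?thesis using nz_c[OF i, of s "3 - m"] by (simp only: odd) simp
qed

lemma nz_minus_zz: 
  assumes "i \<in> R" "j \<in> R" shows "\<sigma> (of_int m * \<zeta> + - z i s + - z j t) \<noteq> 0"
proof -
  have "of_int m * \<zeta> + - z i s + - z j t = - (c i s + c j t + of_int (6 - m) * \<zeta>)"
    by (simp add: z_c algebra_simps)
  then show ?thesis using nz_cc_plus[OF assms, of s t "6 - m"] by (simp only: odd) simp
qed

lemma cubic_wt_nz: "cubic_wt N k k \<noteq> 0"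
  unfolding cubic_wt_def chain_wt_top wt_def
proof (intro no_zero_divisors)
  let ?A = "\<lambda>x. \<sigma> (B4 N + - case_prod z x) * \<sigma> (B1 N (sum k R) + - case_prod z x)
    * \<sigma> (B2 N (sum k R) + - case_prod z x) * \<sigma> (B3 N (sum k R) + - case_prod z x) / \<sigma> (2 * - case_prod z x)"
  have "?A x \<noteq> 0" if x: "x \<in> links k" for x
  proof -
    obtain i s where [simp]: "x = (i, s)" and i: "i \<in> R" using x by (auto simp: links_def)
    have "\<sigma> (2 * - z i s) \<noteq> 0" using nz_2z[OF i, of s] odd[of "2 * z i s"] by simp
    moreover have "\<sigma> (B4 N + - z i s) \<noteq> 0" "\<sigma> (B1 N (sum k R) + - z i s) \<noteq> 0"
      "\<sigma> (B2 N (sum k R) + - z i s) \<noteq> 0" "\<sigma> (B3 N (sum k R) + - z i s) \<noteq> 0"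
      unfolding B1_def B2_def B3_def B4_def by (rule nz_minus_z[OF i])+
    ultimately show ?thesis by simp
  qed
  then show "prod ?A (links k) \<noteq> 0" unfolding prod_zero_iff[OF finite_links] by blast
  let ?B = "\<lambda>x y. \<sigma> (6 * \<zeta> + - case_prod z x + - case_prod z y) / \<sigma> (- case_prod z x + - case_prod z y)"
  have "?B x y \<noteq> 0" if "x \<in> links k" "y \<in> links k" for x y
    using that nz_minus_zz[of "fst x" "fst y" 6 "snd x" "snd y"] nz_minus_zz[of "fst x" "fst y" 0 "snd x" "snd y"]
    by (cases x, cases y) (auto simp: links_def)
  then show "pprod ?B (links k) \<noteq> 0"
    unfolding pprod_def by (subst prod_zero_iff) (auto intro: finite_pairs)
qed

text \<open>Applying the row k of the inverse matrix to the interpolation equations isolates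
  \<alpha> k on one side. On the other side stands a sum of \<open>grid_wt\<close>, proportional to
  the sum of \<open>cubic_wt\<close>, which has a closed form.\<close>

lemma coefficient:
  fixes N :: nat
  defines "B \<equiv> PiE R (\<lambda>_. {..N})"
  assumes \<alpha>: "\<And>n. n \<in> B \<Longrightarrow> (\<Sum>l\<in>B. (\<Prod>j\<in>R. newton R c (h N) l (c j (n j))) * \<alpha> l) = (\<Prod>j\<in>R. F N (c j (n j)))"
    and k: "k \<in> B"
  shows "\<alpha> k * (\<Prod>j\<in>R. newton R c (h N) k (c j (k j))) * cubic_wt N k k
    = (\<Prod>j\<in>R. F N (c j (k j))) * run 2 (2 * int N - 2 * int (sum k R) + 2) (3 * sum k R) 0"
proof -
  let ?K = "sum k R"
  have kU: "k \<in> PiE R (\<lambda>_. UNIV)" using k by (auto simp: B_def PiE_iff)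
  have kbox: "k \<in> box k" using kU by (auto simp: PiE_iff)
  have sub: "box k \<subseteq> B" using k by (auto simp: B_def PiE_iff intro: order_trans)
  have finB: "finite B" unfolding B_def using finite_R by (intro finite_PiE) auto
  have grid: "grid_wt (Psi N ?K) k n = dual R c (h N) k n * (\<Prod>j\<in>R. F N (c j (n j)))" for n
    unfolding grid_wt_def dual_def Psi_def times_divide_eq_right[symmetric] prod.distrib
    by (simp only: mult_ac)
  have "(\<Sum>n\<in>box k. grid_wt (Psi N ?K) k n)
      = (\<Sum>n\<in>box k. dual R c (h N) k n * (\<Sum>l\<in>B. (\<Prod>j\<in>R. newton R c (h N) l (c j (n j))) * \<alpha> l))"
    unfolding grid by (intro sum.cong refl) (use \<alpha> sub in auto)
  also have "\<dots> = (\<Sum>n\<in>box k. \<Sum>l\<in>B. \<alpha> l * (dual R c (h N) k n * (\<Prod>j\<in>R. newton R c (h N) l (c j (n j)))))"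
    unfolding sum_distrib_left by (intro sum.cong refl) (simp only: mult_ac)
  also have "\<dots> = (\<Sum>l\<in>B. \<alpha> l * (\<Sum>n\<in>box k. dual R c (h N) k n * (\<Prod>j\<in>R. newton R c (h N) l (c j (n j)))))"
    unfolding sum_distrib_left by (rule sum.swap)
  also have "\<dots> = (\<Sum>l\<in>B. \<alpha> l * (if l = k then dual R c (h N) k k * (\<Prod>j\<in>R. newton R c (h N) k (c j (k j))) else 0))"
  proof (intro sum.cong refl arg_cong2[where f = "(*)"])
    fix l assume "l \<in> B"
    then have "l \<in> PiE R (\<lambda>_. UNIV)" by (auto simp: B_def PiE_iff)
    then show "(\<Sum>n\<in>box k. dual R c (h N) k n * (\<Prod>j\<in>R. newton R c (h N) l (c j (n j))))
        = (if l = k then dual R c (h N) k k * (\<Prod>j\<in>R. newton R c (h N) k (c j (k j))) else 0)"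
      by (intro dual_newton finite_R R_ne kU s2_cc nz_h)
  qed
  also have "\<dots> = \<alpha> k * (dual R c (h N) k k * (\<Prod>j\<in>R. newton R c (h N) k (c j (k j))))"
    using finB k by (simp add: if_distrib[of "\<lambda>x. _ * x"] cong: if_cong)
  finally have 1: "(\<Sum>n\<in>box k. grid_wt (Psi N ?K) k n)
      = \<alpha> k * (dual R c (h N) k k * (\<Prod>j\<in>R. newton R c (h N) k (c j (k j))))" .
  have "cubic_wt N k k * (\<Sum>n\<in>box k. grid_wt (Psi N ?K) k n) = (\<Sum>n\<in>box k. cubic_wt N k n * grid_wt (Psi N ?K) k k)"
    unfolding sum_distrib_left by (intro sum.cong refl) (use cubic_wt_grid[OF _ kU] in auto)
  also have "\<dots> = grid_wt (Psi N ?K) k k * run 2 (2 * int N - 2 * int ?K + 2) (3 * ?K) 0"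
    unfolding sum_distrib_right[symmetric] sum_cubic_wt by (simp only: mult_ac)
  finally have "dual R c (h N) k k * (\<alpha> k * (\<Prod>j\<in>R. newton R c (h N) k (c j (k j))) * cubic_wt N k k)
      = dual R c (h N) k k * ((\<Prod>j\<in>R. F N (c j (k j))) * run 2 (2 * int N - 2 * int ?K + 2) (3 * ?K) 0)"
    unfolding 1 unfolding grid by (simp only: mult_ac)
  moreover have "dual R c (h N) k k \<noteq> 0" using nz_grid_wt[OF kbox, of N ?K] unfolding grid by simp
  ultimately show ?thesis by simp
qed


lemma newton_c_nz: "j \<in> R \<Longrightarrow> newton R c (h N) k (c j (k j)) \<noteq> 0"
proof -
  assume j: "j \<in> R"
  have "s2 (case_prod c x) (c j (k j)) \<noteq> 0" if "x \<in> Sigma R (\<lambda>i. {..<k i})" for x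
    using that s2_cc[OF _ j, of "fst x" "snd x" "k j"] by (cases x) auto
  then show ?thesis unfolding newton_def using nz_h[OF j] finite_R by (simp add: prod_zero_iff)
qed

text \<open>The triangular system is solved on the full cube of indices up to N. The formula for its
  solution shows that all coefficients with |k| > N vanish, and only then are both sides of degree N
  in each variable, so that agreement at the nodes suffices.\<close>

lemma expansion:
  fixes N :: nat
  defines "B \<equiv> PiE R (\<lambda>_. {..N})"
  obtains \<alpha> where
    "\<And>k. k \<in> B \<Longrightarrow> \<alpha> k * (\<Prod>j\<in>R. newton R c (h N) k (c j (k j))) * cubic_wt N k k
      = (\<Prod>j\<in>R. F N (c j (k j))) * run 2 (2 * int N - 2 * int (sum k R) + 2) (3 * sum k R) 0"
    "\<And>w. (\<And>j. j \<in> R \<Longrightarrow> run 6 (- 3 * int N) (N + 1) (w j) \<noteq> 0) \<Longrightarrow>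
      (\<And>j y. j \<in> R \<Longrightarrow> y < N \<Longrightarrow> s2 (h N y) (w j) \<noteq> 0) \<Longrightarrow>
      (\<Sum>k\<in>{k\<in>B. sum k R \<le> N}. \<alpha> k * (\<Prod>j\<in>R. newton R c (h N) k (w j))) = (\<Prod>j\<in>R. F N (w j))"
proof -
  have finB: "finite B" unfolding B_def using finite_R by (intro finite_PiE) auto
  have "\<exists>\<alpha>. \<forall>n\<in>B. (\<Sum>l\<in>B. (\<Prod>j\<in>R. newton R c (h N) l (c j (n j))) * \<alpha> l) = (\<Prod>j\<in>R. F N (c j (n j)))"
  proof (rule triangular_solve[where \<mu> = "\<lambda>n. sum n R", OF finB])
    show "(\<Prod>j\<in>R. newton R c (h N) n (c j (n j))) \<noteq> 0" for n
      using newton_c_nz finite_R by (simp add: prod_zero_iff)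
    fix n l assume n: "n \<in> B" and l: "l \<in> B" and ne: "l \<noteq> n"
      and nz: "(\<Prod>j\<in>R. newton R c (h N) l (c j (n j))) \<noteq> 0"
    have le: "l i \<le> n i" if i: "i \<in> R" for i
    proof (rule ccontr)
      assume "\<not> l i \<le> n i"
      then have "newton R c (h N) l (c i (n i)) = 0"
        using newton_eq_0[of R i "n i" l c "h N", OF finite_R i] by simp
      then show False using nz i finite_R by (auto simp: prod_zero_iff)
    qed
    moreover obtain i where "i \<in> R" "l i \<noteq> n i"
      using ne n l PiE_ext[of l R "\<lambda>_. {..N}" n] by (auto simp: B_def)
    ultimately show "sum l R < sum n R"
      by (intro sum_strict_mono_ex1 finite_R) (auto intro!: bexI[of _ i] simp: less_le)
  qed
  then obtain \<alpha> where \<alpha>: "\<And>n. n \<in> B \<Longrightarrow>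
      (\<Sum>l\<in>B. (\<Prod>j\<in>R. newton R c (h N) l (c j (n j))) * \<alpha> l) = (\<Prod>j\<in>R. F N (c j (n j)))" by blast
  have coeff: "\<alpha> k * (\<Prod>j\<in>R. newton R c (h N) k (c j (k j))) * cubic_wt N k k
      = (\<Prod>j\<in>R. F N (c j (k j))) * run 2 (2 * int N - 2 * int (sum k R) + 2) (3 * sum k R) 0"
    if "k \<in> B" for k
    using coefficient[of N \<alpha> k] \<alpha> that unfolding B_def by blast
  have large: "\<alpha> k = 0" if k: "k \<in> B" "\<not> sum k R \<le> N" for k
  proof -
    \<comment> \<open>The position at which the run passes through the offset 0 and contributes
      \<sigma> 0.\<close>
    let ?y = "sum k R - N - 1"
    have "2 * int N - 2 * int (sum k R) + 2 + 2 * int ?y = 0" using k(2) by simp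
    then have "\<sigma> (0 + of_int (2 * int N - 2 * int (sum k R) + 2 + 2 * int ?y) * \<zeta>) = 0"
      by (simp only: of_int_0) simp
    moreover have "?y \<in> {..<3 * sum k R}" using k(2) by simp
    ultimately have "run 2 (2 * int N - 2 * int (sum k R) + 2) (3 * sum k R) 0 = 0"
      unfolding run_def by (intro prod_zero bexI[of _ ?y] finite_lessThan)
    then show ?thesis using coeff[OF k(1)] cubic_wt_nz[of N k] newton_c_nz finite_R
      by (auto simp: prod_zero_iff)
  qed
  define Bs where "Bs = {k\<in>B. sum k R \<le> N}"
  have finBs: "finite Bs" using finB by (simp add: Bs_def)
  \<comment> \<open>The Newton function times the common denominator, the product of
    \<open>s2 (h N y)\<close> over y < N: |k| factors from the nodes and N - |k| factors left of the
    denominator.\<close>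
  define T where "T k x = 1 * (\<Prod>p\<in>Sigma R (\<lambda>i. {..<k i}). s2 (case_prod c p) x) * (\<Prod>y\<in>{sum k R..<N}. s2 (h N y) x)" for k x
  have T_H: "(N, T k) \<in> H" if "k \<in> Bs" for k
  proof -
    have card: "card (Sigma R (\<lambda>i. {..<k i})) + card {sum k R..<N} = N"
      using finite_R that by (simp add: Bs_def)
    have fin: "finite (Sigma R (\<lambda>i. {..<k i}))" using finite_R by simp
    show ?thesis
      unfolding T_def
      by (subst card[symmetric]) (intro H_mult_prod H_prod finite_atLeastLessThan fin)
  qed
  have T_newton: "newton R c (h N) k x * (\<Prod>y<N. s2 (h N y) x) = T k x"
    if "k \<in> Bs" "\<And>y. y < N \<Longrightarrow> s2 (h N y) x \<noteq> 0" for k x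
  proof -
    have K: "sum k R \<le> N" using that(1) by (simp add: Bs_def)
    have "(\<Prod>y<N. s2 (h N y) x) = (\<Prod>y<sum k R. s2 (h N y) x) * (\<Prod>y\<in>{sum k R..<N}. s2 (h N y) x)"
      using prod.atLeastLessThan_concat[OF le0 K, of "\<lambda>y. s2 (h N y) x"]
      by (simp only: atLeast0LessThan)
    moreover have "(\<Prod>y<sum k R. s2 (h N y) x) \<noteq> 0" using that(2) K by (auto simp: prod_zero_iff)
    ultimately show ?thesis by (simp add: newton_def T_def)
  qed
  define D where "D w = (\<Prod>j\<in>R. Fnum N (w j)) + (-1) * (\<Sum>k\<in>Bs. \<alpha> k * (\<Prod>j\<in>R. T k (w j)))" for w
  have D_eq: "D w = (\<Prod>j\<in>R. \<Prod>y<N. s2 (h N y) (w j))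
      * ((\<Prod>j\<in>R. F N (w j)) - (\<Sum>k\<in>Bs. \<alpha> k * (\<Prod>j\<in>R. newton R c (h N) k (w j))))"
    if "\<And>j. j \<in> R \<Longrightarrow> run 6 (- 3 * int N) (N + 1) (w j) \<noteq> 0"
      "\<And>j y. j \<in> R \<Longrightarrow> y < N \<Longrightarrow> s2 (h N y) (w j) \<noteq> 0" for w
  proof -
    have "(\<Prod>j\<in>R. Fnum N (w j)) = (\<Prod>j\<in>R. F N (w j)) * (\<Prod>j\<in>R. \<Prod>y<N. s2 (h N y) (w j))"
      unfolding prod.distrib[symmetric] by (intro prod.cong refl F_Fnum[symmetric] that(1))
    moreover have "(\<Prod>j\<in>R. T k (w j))
        = (\<Prod>j\<in>R. newton R c (h N) k (w j)) * (\<Prod>j\<in>R. \<Prod>y<N. s2 (h N y) (w j))" if "k \<in> Bs" for k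
      unfolding prod.distrib[symmetric]
      by (intro prod.cong refl T_newton[symmetric] that) (use \<open>\<And>j y. j \<in> R \<Longrightarrow> y < N \<Longrightarrow> s2 (h N y) (w j) \<noteq> 0\<close> in blast)
    then have "(\<Sum>k\<in>Bs. \<alpha> k * (\<Prod>j\<in>R. T k (w j)))
        = (\<Sum>k\<in>Bs. \<alpha> k * (\<Prod>j\<in>R. newton R c (h N) k (w j))) * (\<Prod>j\<in>R. \<Prod>y<N. s2 (h N y) (w j))"
      unfolding sum_distrib_right by (intro sum.cong refl) (simp only: mult.assoc)
    ultimately show ?thesis unfolding D_def by (simp add: algebra_simps)
  qed
  have D0: "D w = 0" for w
  \<comment> \<open>Degree N in each variable against the N + 1 nodes c j 0, ..., c j N.\<close>
  proof (rule H_vanish_multi[where D = D and w = w and R = R and N = N and P = "\<lambda>j. c j ` {..N}"])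
    show "(N, \<lambda>x. D (w(j := x))) \<in> H" if j: "j \<in> R" for j w
    proof -
      have upd: "(\<Prod>i\<in>R. f ((w(j := x)) i)) = (\<Prod>i\<in>R-{j}. f (w i)) * f x" for f :: "complex \<Rightarrow> complex" and x
        using finite_R j by (simp add: prod.remove[of R j] mult.commute)
      show ?thesis unfolding D_def upd
        by (intro H.add H.scale H_sum finBs T_H Fnum_H)
    qed
    show "finite (c j ` {..N}) \<and> card (c j ` {..N}) > N" if "j \<in> R" for j
    proof -
      have "inj_on (c j) {..N}" by (rule inj_onI) (metis diff_self nz_cc_self zero)
      then show ?thesis by (simp add: card_image)
    qed
    show "s2 x y \<noteq> 0" if xy: "j \<in> R" "x \<in> c j ` {..N}" "y \<in> c j ` {..N}" "x \<noteq> y" for j x y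
    proof -
      obtain s t where "x = c j s" "y = c j t" using xy by auto
      moreover from this xy(4) have "(j, s) \<noteq> (j, t)" by auto
      ultimately show ?thesis using s2_cc[OF xy(1) xy(1)] by simp
    qed
    fix w assume w: "\<And>j. j \<in> R \<Longrightarrow> w j \<in> c j ` {..N}"
    have "\<forall>j. \<exists>s. j \<in> R \<longrightarrow> s \<le> N \<and> w j = c j s" using w by (auto simp: image_iff)
    from choice[OF this] obtain s where s: "\<And>j. j \<in> R \<Longrightarrow> s j \<le> N \<and> w j = c j (s j)" by blast
    define n where "n = restrict s R"
    have n: "n \<in> B" "\<And>j. j \<in> R \<Longrightarrow> w j = c j (n j)" using s by (auto simp: n_def B_def)
    have "(\<Sum>k\<in>Bs. \<alpha> k * (\<Prod>j\<in>R. newton R c (h N) k (w j)))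
        = (\<Sum>l\<in>B. (\<Prod>j\<in>R. newton R c (h N) l (c j (n j))) * \<alpha> l)"
    proof (rule sum.mono_neutral_cong_left[OF finB])
      show "Bs \<subseteq> B" by (auto simp: Bs_def)
      show "\<forall>i\<in>B - Bs. (\<Prod>j\<in>R. newton R c (h N) i (c j (n j))) * \<alpha> i = 0"
        using large by (auto simp: Bs_def)
    qed (simp add: n(2) mult.commute)
    also have "\<dots> = (\<Prod>j\<in>R. F N (w j))" using \<alpha>[OF n(1)] n(2) by simp
    finally show "D w = 0"
      by (subst D_eq) (use n(2) nz_run nz_h in auto)
  qed (rule finite_R)
  have "(\<Sum>k\<in>Bs. \<alpha> k * (\<Prod>j\<in>R. newton R c (h N) k (w j))) = (\<Prod>j\<in>R. F N (w j))"
    if "\<And>j. j \<in> R \<Longrightarrow> run 6 (- 3 * int N) (N + 1) (w j) \<noteq> 0"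
      "\<And>j y. j \<in> R \<Longrightarrow> y < N \<Longrightarrow> s2 (h N y) (w j) \<noteq> 0" for w
    using D_eq[OF that] that(2) finite_R D0[of w] by (auto simp: prod_zero_iff)
  then show thesis using that coeff unfolding Bs_def by blast
qed

end

section \<open>The summand in additive notation and its comparison with the expansion
  coefficients\<close>

lemma pprod_Un_row:
  fixes S :: "('i::countable \<times> nat) set"
  assumes "finite S" "\<And>s. (i, s) \<notin> S" "\<And>x y. B x y = B y x"
  shows "pprod B (S \<union> Pair i ` {..<m})
    = pprod B S * (\<Prod>s<m. \<Prod>t<s. B (i, s) (i, t)) * (\<Prod>s<m. \<Prod>y\<in>S. B (i, s) y)"
proof (induction m)
  case (Suc m)
  have "S \<union> Pair i ` {..<Suc m} = insert (i, m) (S \<union> Pair i ` {..<m})" by (auto simp: lessThan_Suc)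
  then have "pprod B (S \<union> Pair i ` {..<Suc m})
      = pprod B (S \<union> Pair i ` {..<m}) * (\<Prod>y\<in>S \<union> Pair i ` {..<m}. B (i, m) y)"
    using pprod_insert_sym[of "S \<union> Pair i ` {..<m}" "(i, m)" B, OF _ _ assms(3)] assms(1,2) by auto
  also have "(\<Prod>y\<in>S \<union> Pair i ` {..<m}. B (i, m) y)
      = (\<Prod>y\<in>S. B (i, m) y) * (\<Prod>y\<in>Pair i ` {..<m}. B (i, m) y)"
    by (rule prod.union_disjoint) (use assms in auto)
  also have "(\<Prod>y\<in>Pair i ` {..<m}. B (i, m) y) = (\<Prod>t<m. B (i, m) (i, t))"
    by (subst prod.reindex) (auto simp: inj_on_def)
  finally show ?case unfolding Suc prod.lessThan_Suc by (simp only: mult_ac)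
qed simp

abbreviation (input) upper :: "nat \<Rightarrow> (nat \<Rightarrow> nat \<Rightarrow> 'a) \<Rightarrow> 'a::comm_monoid_mult" where
  "upper r f \<equiv> \<Prod>i=1..r. \<Prod>j=i+1..r. f i j"

lemma upper_Suc: "upper (Suc r) f = upper r f * (\<Prod>i=1..r. f i (Suc r))"
proof -
  have "(\<Prod>i=1..r. \<Prod>j=i+1..Suc r. f i j) = (\<Prod>i=1..r. (\<Prod>j=i+1..r. f i j) * f i (Suc r))"
    by (intro prod.cong refl) simp
  then show ?thesis by (simp add: prod.distrib)
qed

text \<open>Separates pairs of links within one chain from pairs in different chains; these are
  matched with different factors of the summand.\<close>

lemma pprod_rows:
  fixes B :: "nat \<times> nat \<Rightarrow> nat \<times> nat \<Rightarrow> complex"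
  assumes "\<And>x y. B x y = B y x"
  shows "pprod B (Sigma {1..r} (\<lambda>i. {..<k i}))
    = (\<Prod>i=1..r. \<Prod>s<k i. \<Prod>t<s. B (i, s) (i, t))
      * upper r (\<lambda>i j. \<Prod>s<k i. \<Prod>t<k j. B (i, s) (j, t))"
proof (induction r)
  case (Suc r)
  let ?S = "Sigma {1..r} (\<lambda>i. {..<k i})" and ?i = "Suc r"
  have "Sigma {1..Suc r} (\<lambda>i. {..<k i}) = ?S \<union> Pair ?i ` {..<k ?i}"
    by (auto simp: atLeastAtMostSuc_conv)
  then have "pprod B (Sigma {1..Suc r} (\<lambda>i. {..<k i}))
      = pprod B ?S * (\<Prod>s<k ?i. \<Prod>t<s. B (?i, s) (?i, t)) * (\<Prod>s<k ?i. \<Prod>y\<in>?S. B (?i, s) y)"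
    using pprod_Un_row[of ?S ?i B "k ?i", OF _ _ assms] by auto
  also have "(\<Prod>s<k ?i. \<Prod>y\<in>?S. B (?i, s) y) = (\<Prod>s<k ?i. \<Prod>i=1..r. \<Prod>t<k i. B (?i, s) (i, t))"
    by (subst prod.Sigma) (auto simp: case_prod_unfold)
  also have "\<dots> = (\<Prod>i=1..r. \<Prod>s<k ?i. \<Prod>t<k i. B (?i, s) (i, t))"
    by (rule prod.swap)
  also have "\<dots> = (\<Prod>i=1..r. \<Prod>t<k i. \<Prod>s<k ?i. B (i, t) (?i, s))"
  proof (rule prod.cong[OF refl])
    fix i
    have "(\<Prod>s<k ?i. \<Prod>t<k i. B (?i, s) (i, t)) = (\<Prod>t<k i. \<Prod>s<k ?i. B (?i, s) (i, t))"
      by (rule prod.swap)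
    also have "\<dots> = (\<Prod>t<k i. \<Prod>s<k ?i. B (i, t) (?i, s))"
      by (intro prod.cong refl assms)
    finally show "(\<Prod>s<k ?i. \<Prod>t<k i. B (?i, s) (i, t)) = (\<Prod>t<k i. \<Prod>s<k ?i. B (i, t) (?i, s))" .
  qed
  finally show ?case unfolding Suc upper_Suc by (simp add: mult_ac)
qed simp

lemma prod_square:
  "(\<Prod>i=1..r. \<Prod>j=1..r. f i j) = (\<Prod>i=1..r. f i i) * upper r (\<lambda>i j. f i j * f j i)"
  for f :: "nat \<Rightarrow> nat \<Rightarrow> 'a::comm_monoid_mult"
proof (induction r)
  case (Suc r)
  have "(\<Prod>i=1..Suc r. \<Prod>j=1..Suc r. f i j)
      = (\<Prod>i=1..r. (\<Prod>j=1..r. f i j) * f i (Suc r)) * ((\<Prod>j=1..r. f (Suc r) j) * f (Suc r) (Suc r))"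
    by simp
  then show ?case unfolding upper_Suc prod.distrib Suc by (simp add: mult_ac)
qed simp

text \<open>The factors of the summand that depend on a single \<xi> i = u, with m = k i and K =
  |k|, stripped of their exponential prefactors.\<close>

definition single_factor :: "(complex \<Rightarrow> complex) \<Rightarrow> complex \<Rightarrow> nat \<Rightarrow> nat \<Rightarrow> nat \<Rightarrow> complex \<Rightarrow> complex" where
  "single_factor \<sigma> \<zeta> N K m u =
     sigma_run \<sigma> \<zeta> 2 (int N + 2 * int K + 6 * int m) 1 u / sigma_run \<sigma> \<zeta> 2 (int N) 1 u
     * (sigma_run \<sigma> \<zeta> 2 (int N) K u * sigma_run \<sigma> \<zeta> 2 (int N + 2) (K - m) (- u))
     / sigma_run \<sigma> \<zeta> 2 (2 * int m - 2 * int K - int N) (2 * m) u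
     / sigma_run \<sigma> \<zeta> 6 (3 * int N + 6) m u"

definition pair_factor :: "(complex \<Rightarrow> complex) \<Rightarrow> complex \<Rightarrow> (nat \<Rightarrow> complex) \<Rightarrow> (nat \<Rightarrow> nat)
    \<Rightarrow> nat \<Rightarrow> nat \<Rightarrow> complex" where
  "pair_factor \<sigma> \<zeta> \<xi> k i j =
     sigma_run \<sigma> \<zeta> 6 (6 * int (k i) - 6 * int (k j)) 1 (\<xi> i - \<xi> j) / sigma_run \<sigma> \<zeta> 6 0 1 (\<xi> i - \<xi> j)
     / sigma_run \<sigma> \<zeta> 6 0 (k i + k j) (\<xi> i + \<xi> j)"

definition cubic_term :: "(complex \<Rightarrow> complex) \<Rightarrow> complex \<Rightarrow> nat \<Rightarrow> nat \<Rightarrow> (nat \<Rightarrow> complex) \<Rightarrow> (nat \<Rightarrow> complex)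
    \<Rightarrow> (nat \<Rightarrow> nat) \<Rightarrow> complex" where
  "cubic_term \<sigma> \<zeta> r N \<xi> w k = (let K = sum k {1..r} in
     upper r (pair_factor \<sigma> \<zeta> \<xi> k)
     * (\<Prod>i=1..r. single_factor \<sigma> \<zeta> N K (k i) (\<xi> i)
          / (sigma_run \<sigma> \<zeta> 2 (int N + 2) K (- w i) * sigma_run \<sigma> \<zeta> 2 (int N + 2) K (w i)))
     * (sigma_run \<sigma> \<zeta> 2 (- 2 * int N) K 0 * sigma_run \<sigma> \<zeta> 2 (2 * int N + 2) (2 * K) 0)
     * (\<Prod>i=1..r. \<Prod>j=1..r. sigma_run \<sigma> \<zeta> 6 0 (k i) (\<xi> i + w j) * sigma_run \<sigma> \<zeta> 6 0 (k i) (\<xi> i - w j)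
          / sigma_run \<sigma> \<zeta> 6 6 (k i) (\<xi> i - \<xi> j)))"

context generic_chains
begin

abbreviation coeff_single :: "nat \<Rightarrow> nat \<Rightarrow> nat \<Rightarrow> complex \<Rightarrow> complex" where
  "coeff_single \<equiv> single_factor \<sigma> \<zeta>"

text \<open>After reflection the runs of step 2 on both sides tile the same long interval of
  offsets, cut at different places; the runs of step 6 are matched by
  \<open>run_swap\<close>.\<close>

lemma coeff_single:
  assumes i: "i \<in> R" and m: "m \<le> K"
  shows "coeff_single N K m (\<xi> i) * F N (\<xi> i) * (run 6 (- 3 * int N) m (\<xi> i) * run 2 (int N + 2 * int K) (3 * m) (\<xi> i))
    = (-1) ^ m * F N (c i m) * (\<Prod>y<K. s2 (h N y) (c i m))"
proof -
  let ?u = "\<xi> i"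
  have nz: "run d a L ?u \<noteq> 0" for d a L using nz_run[OF i, of d a L 0] by (simp add: c_def)
  have c: "c i m = ?u + of_int (6 * int m) * \<zeta>" by (simp add: c_def)
  have rhs: "F N (c i m) * (\<Prod>y<K. s2 (h N y) (c i m))
      = (-1) ^ K * run 2 (6 * int m - int N - 2 * int K) (N + 1 + 2 * K) ?u / run 6 (6 * int m - 3 * int N) (N + 1) ?u"
    unfolding F_def times_divide_eq_left run_h unfolding c run_shift by (simp add: algebra_simps)
  have refl: "run 2 (int N + 2) (K - m) (- ?u) = (-1) ^ (K - m) * run 2 (- int N - 2 * int (K - m)) (K - m) ?u"
  proof -
    have "- (int N + 2) - 2 * (int (K - m) - 1) = - int N - 2 * int (K - m)" by simp
    then show ?thesis by (simp only: run_reflect)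
  qed
  have Q: "run 6 (- 3 * int N) (N + 1) ?u * run 6 (3 * int N + 6) m ?u
      = run 6 (- 3 * int N) m ?u * run 6 (6 * int m - 3 * int N) (N + 1) ?u"
    using run_swap[of 6 "- 3 * int N" "N + 1" ?u m] by (simp add: algebra_simps)
  \<comment> \<open>Up to one factor at offset N, both sides are decompositions of the run that
    begins at -N - 2 (K - m) and has 2 m + N + 1 + 2 K factors.\<close>
  have P: "run 2 (- int N - 2 * int (K - m)) (K - m) ?u * run 2 (- int N) (N + 1) ?u * run 2 (int N) K ?u
        * run 2 (int N + 2 * int K) (3 * m) ?u * run 2 (int N + 2 * int K + 6 * int m) 1 ?u
      = run 2 (int N) 1 ?u * (run 2 (2 * int m - 2 * int K - int N) (2 * m) ?u
        * run 2 (6 * int m - int N - 2 * int K) (N + 1 + 2 * K) ?u)"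
  proof -
    let ?a = "- int N - 2 * int (K - m)"
    have e: "?a + 2 * int (K - m) = - int N" "?a + 2 * int (K - m + N) = int N"
      "?a + 2 * int (K - m + N + K) = int N + 2 * int K"
      "?a + 2 * int (K - m + N + K + 3 * m) = int N + 2 * int K + 6 * int m"
      "?a + 2 * int (2 * m) = 6 * int m - int N - 2 * int K"
      "?a = 2 * int m - 2 * int K - int N" "- int N + 2 * int N = int N"
      using m by (simp_all add: of_nat_diff)
    have "run 2 ?a (K - m + N + K + 3 * m + 1) ?u = run 2 ?a (K - m) ?u * run 2 (- int N) N ?u
        * run 2 (int N) K ?u * run 2 (int N + 2 * int K) (3 * m) ?u * run 2 (int N + 2 * int K + 6 * int m) 1 ?u"
      unfolding run_add[of 2 ?a "K - m + N + K + 3 * m" 1] run_add[of 2 ?a "K - m + N + K" "3 * m"]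
        run_add[of 2 ?a "K - m + N" K] run_add[of 2 ?a "K - m" N] e(1-4) ..
    moreover have "K - m + N + K + 3 * m + 1 = 2 * m + (N + 1 + 2 * K)" using m by simp
    then have "run 2 ?a (K - m + N + K + 3 * m + 1) ?u
        = run 2 ?a (2 * m) ?u * run 2 (6 * int m - int N - 2 * int K) (N + 1 + 2 * K) ?u"
      by (simp only: run_add[of 2 ?a "2 * m" "N + 1 + 2 * K"] e(5))
    moreover have "run 2 (- int N) (N + 1) ?u = run 2 (- int N) N ?u * run 2 (int N) 1 ?u"
      unfolding run_add e(7) ..
    ultimately show ?thesis unfolding e(6)[symmetric] by (simp only: mult_ac)
  qed
  have field: "t / n * (k * (\<epsilon> * l)) / d / s * (p / q) * (g * f) = \<epsilon> * e / v"
    if "n \<noteq> 0" "d \<noteq> 0" "s \<noteq> 0" "q \<noteq> 0" "v \<noteq> 0" "q * s = g * v" "l * p * k * f * t = n * (d * e)"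
    for t n k \<epsilon> l d s p q g f e v :: complex
  proof -
    have "t * (k * (\<epsilon> * l)) * p * (g * f) * v = \<epsilon> * (l * p * k * f * t) * (g * v)" by (simp only: mult_ac)
    also have "\<dots> = \<epsilon> * e * (n * d * s * q)" unfolding that(6)[symmetric] that(7) by (simp only: mult_ac)
    finally show ?thesis using that(1-5) by (simp add: field_simps)
  qed
  have "coeff_single N K m ?u * F N ?u * (run 6 (- 3 * int N) m ?u * run 2 (int N + 2 * int K) (3 * m) ?u)
      = (-1) ^ (K - m) * run 2 (6 * int m - int N - 2 * int K) (N + 1 + 2 * K) ?u / run 6 (6 * int m - 3 * int N) (N + 1) ?u"
    unfolding single_factor_def F_def refl by (rule field[OF nz nz nz nz nz Q P])
  also have "(-1 :: complex) ^ (K - m) = (-1) ^ m * (-1) ^ K"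
  proof -
    have "(-1 :: complex) ^ K = (-1) ^ m * (-1) ^ (K - m)" using m by (simp add: power_add[symmetric])
    then show ?thesis
      unfolding mult.assoc[symmetric] power_mult_distrib[symmetric] by (simp add: mult.assoc[symmetric] power_mult_distrib[symmetric])
  qed
  finally show ?thesis unfolding mult.assoc[of "(-1) ^ m" "F N (c i m)"] rhs by simp
qed

text \<open>The factors in 2 \<xi> i cancel altogether: telescoping within the chain leaves even
  positions in the denominator and \<sigma> (2 z) contributes the odd ones, so that the upper half
  of this product cancels the sums of nodes. The four parameters give the two runs in \<xi> i and
  the differences of nodes give \<open>run 6 6 m 0\<close>.\<close>

lemma newton_self:
  assumes i: "i \<in> R"
  shows "(\<Prod>s<m. \<sigma> (B4 N + - z i s) * \<sigma> (B1 N K + - z i s) * \<sigma> (B2 N K + - z i s) * \<sigma> (B3 N K + - z i s)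
        / \<sigma> (2 * - z i s))
      * (\<Prod>s<m. \<Prod>t<s. \<sigma> (6 * \<zeta> + - z i s + - z i t) / \<sigma> (- z i s + - z i t))
      * (\<Prod>s<m. s2 (c i s) (c i m))
    = run 6 (- 3 * int N) m (\<xi> i) * run 2 (int N + 2 * int K) (3 * m) (\<xi> i) * run 6 6 m 0"
proof -
  let ?u = "\<xi> i"
  let ?g = "\<lambda>y. \<sigma> (2 * ?u + of_int (6 * int y) * \<zeta>)"
  have gnz: "?g y \<noteq> 0" for y using nz_double[OF i, of "6 * int y"] by simp
  have \<beta>: "(\<Prod>s<m. \<sigma> (B4 N + - z i s) * \<sigma> (B1 N K + - z i s) * \<sigma> (B2 N K + - z i s) * \<sigma> (B3 N K + - z i s))
      = run 6 (- 3 * int N) m ?u * run 2 (int N + 2 * int K) (3 * m) ?u"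
  proof -
    have eq: "B4 N + - z i s = - (?u + of_int (- 3 * int N + 6 * int s) * \<zeta>)"
      "B1 N K + - z i s = - (?u + of_int (int N + 2 * int K + 6 * int s) * \<zeta>)"
      "B2 N K + - z i s = - (?u + of_int (int N + 2 * int K + 2 + 6 * int s) * \<zeta>)"
      "B3 N K + - z i s = - (?u + of_int (int N + 2 * int K + 4 + 6 * int s) * \<zeta>)" for s
      by (simp_all add: B1_def B2_def B3_def B4_def z_def algebra_simps)
    show ?thesis unfolding run_split3 unfolding run_def prod.distrib[symmetric]
      by (intro prod.cong refl) (simp only: eq odd, simp)
  qed
  have tele: "(\<Prod>t<s. \<sigma> (6 * \<zeta> + - z i s + - z i t) / \<sigma> (- z i s + - z i t)) = ?g s / ?g (2 * s)" for s
  proof -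
    have "6 * \<zeta> + - z i s + - z i t = - (2 * ?u + of_int (6 * int (s + t)) * \<zeta>)"
      "- z i s + - z i t = - (2 * ?u + of_int (6 * int (s + Suc t)) * \<zeta>)" for t
      by (simp_all add: z_def algebra_simps)
    then have "(\<Prod>t<s. \<sigma> (6 * \<zeta> + - z i s + - z i t) / \<sigma> (- z i s + - z i t))
        = (\<Prod>t=0..<s. inverse (?g (s + Suc t)) / inverse (?g (s + t)))"
      by (simp only: odd atLeast0LessThan) (simp add: field_simps)
    also have "\<dots> = inverse (?g (s + s)) / inverse (?g (s + 0))"
    proof (rule prod_telescope_ratio[of 0 s "\<lambda>t. inverse (?g (s + t))"])
      show "inverse (?g (s + t)) \<noteq> 0" for t
        using gnz[of "s + t"] by (simp only: inverse_nonzero_iff_nonzero) simp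
    qed simp
    finally show ?thesis by (simp add: field_simps mult_2)
  qed
  have own: "(\<Prod>s<m. ?g s / ?g (2 * s) / \<sigma> (2 * - z i s)) * (\<Prod>s<m. \<sigma> (2 * ?u + of_int (6 * int (s + m)) * \<zeta>)) = (-1) ^ m"
  proof -
    have "2 * - z i s = - (2 * ?u + of_int (6 * int (2 * s + 1)) * \<zeta>)" for s
      by (simp add: z_def algebra_simps)
    then have "(\<Prod>s<m. ?g s / ?g (2 * s) / \<sigma> (2 * - z i s)) = (\<Prod>s<m. - (?g s / (?g (2 * s) * ?g (2 * s + 1))))"
      by (intro prod.cong refl) (simp only: odd, simp)
    also have "\<dots> = (-1) ^ m * ((\<Prod>s<m. ?g s) / (\<Prod>s<2 * m. ?g s))"
    proof -
      have "(\<Prod>s<2 * m. ?g s) = (\<Prod>s<m. ?g (2 * s) * ?g (2 * s + 1))"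
        by (induction m) (simp_all only: mult_Suc_right add_2_eq_Suc prod.lessThan_Suc, simp_all add: mult_ac)
      then show ?thesis unfolding prod_uminus prod_dividef by simp
    qed
    also have "(\<Prod>s<2 * m. ?g s) = (\<Prod>s<m. ?g s) * (\<Prod>s<m. ?g (s + m))"
    proof -
      have "(\<Prod>s<m + n. ?g s) = (\<Prod>s<m. ?g s) * (\<Prod>s<n. ?g (s + m))" for n
      proof (induction n)
        case (Suc n)
        have "(\<Prod>s<m + Suc n. ?g s) = (\<Prod>s<m + n. ?g s) * ?g (n + m)"
          by (simp only: add_Suc_right prod.lessThan_Suc add.commute[of m n])
        then show ?case unfolding Suc by (simp only: prod.lessThan_Suc mult.assoc)
      qed simp
      from this[of m] show ?thesis by (simp only: mult_2)
    qed
    finally have eq: "(\<Prod>s<m. ?g s / ?g (2 * s) / \<sigma> (2 * - z i s))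
        = (-1) ^ m * ((\<Prod>s<m. ?g s) / ((\<Prod>s<m. ?g s) * (\<Prod>s<m. ?g (s + m))))" .
    have nz: "(\<Prod>s<m. ?g (f s)) \<noteq> 0" for f
      unfolding prod_zero_iff[OF finite_lessThan] using gnz by blast
    have cancel: "e * (A / (A * P)) * P = e" if "A \<noteq> 0" "P \<noteq> 0" for e A P :: complex
      using that by simp
    show ?thesis unfolding eq by (rule cancel[OF nz[of "\<lambda>s. s"] nz[of "\<lambda>s. s + m"]])
  qed
  have self: "(\<Prod>s<m. s2 (c i s) (c i m)) = (\<Prod>s<m. \<sigma> (2 * ?u + of_int (6 * int (s + m)) * \<zeta>)) * ((-1) ^ m * run 6 6 m 0)"
  proof -
    have "(\<Prod>s<m. \<sigma> (c i s - c i m)) = run 6 (- 6 * int m) m (- 0)"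
      unfolding run_def by (intro prod.cong refl arg_cong[where f = \<sigma>]) (simp add: c_def algebra_simps)
    also have "\<dots> = (-1) ^ m * run 6 6 m 0" unfolding run_reflect by (simp add: algebra_simps)
    finally have 1: "(\<Prod>s<m. \<sigma> (c i s - c i m)) = (-1) ^ m * run 6 6 m 0" .
    have 2: "c i s + c i m = 2 * ?u + of_int (6 * int (s + m)) * \<zeta>" for s by (simp add: c_def algebra_simps)
    show ?thesis unfolding s2_def prod.distrib 1 2 ..
  qed
  have "(\<Prod>s<m. \<sigma> (B4 N + - z i s) * \<sigma> (B1 N K + - z i s) * \<sigma> (B2 N K + - z i s) * \<sigma> (B3 N K + - z i s)
        / \<sigma> (2 * - z i s))
      * (\<Prod>s<m. \<Prod>t<s. \<sigma> (6 * \<zeta> + - z i s + - z i t) / \<sigma> (- z i s + - z i t))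
    = (\<Prod>s<m. \<sigma> (B4 N + - z i s) * \<sigma> (B1 N K + - z i s) * \<sigma> (B2 N K + - z i s) * \<sigma> (B3 N K + - z i s))
      * (\<Prod>s<m. ?g s / ?g (2 * s) / \<sigma> (2 * - z i s))"
    unfolding tele prod.distrib[symmetric] by (intro prod.cong refl) simp
  then have "?thesis \<longleftrightarrow> run 6 (- 3 * int N) m ?u * run 2 (int N + 2 * int K) (3 * m) ?u
      * (((\<Prod>s<m. ?g s / ?g (2 * s) / \<sigma> (2 * - z i s)) * (\<Prod>s<m. \<sigma> (2 * ?u + of_int (6 * int (s + m)) * \<zeta>)))
      * (-1) ^ m * run 6 6 m 0)
    = run 6 (- 3 * int N) m ?u * run 2 (int N + 2 * int K) (3 * m) ?u * run 6 6 m 0"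
    unfolding self \<beta> by (simp only: mult_ac)
  then show ?thesis unfolding own by (simp add: power_add[symmetric])
qed

abbreviation coeff_pair :: "(nat \<Rightarrow> nat) \<Rightarrow> nat \<Rightarrow> nat \<Rightarrow> complex" where
  "coeff_pair \<equiv> pair_factor \<sigma> \<zeta> \<xi>"

text \<open>The product over pairs of links telescopes, whereupon all factors in \<xi> i + \<xi> j
  cancel. The factors in \<xi> i - \<xi> j are one run of step 6 decomposed in two ways.\<close>

lemma newton_pair:
  assumes i: "i \<in> R" "j \<in> R" "i \<noteq> j"
  shows "coeff_pair k i j * (\<Prod>s<k i. \<Prod>t<k j. \<sigma> (6 * \<zeta> + - z i s + - z j t) / \<sigma> (- z i s + - z j t))
      * ((\<Prod>s<k i. s2 (c i s) (c j (k j))) * (\<Prod>s<k j. s2 (c j s) (c i (k i))))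
    = run 6 6 (k i) (\<xi> i - \<xi> j) * run 6 6 (k j) (\<xi> j - \<xi> i)"
proof -
  let ?p = "\<xi> i + \<xi> j" and ?d = "\<xi> i - \<xi> j"
  let ?m = "k i" and ?n = "k j"
  have pnz: "run d a L ?p \<noteq> 0" for d a L
    unfolding run_def prod_zero_iff[OF finite_lessThan] using nz_plus[OF i] by blast
  have dnz: "run d a L ?d \<noteq> 0" for d a L
    unfolding run_def prod_zero_iff[OF finite_lessThan] using nz_minus[OF i] by blast
  have cross: "(\<Prod>s<?m. \<Prod>t<?n. \<sigma> (6 * \<zeta> + - z i s + - z j t) / \<sigma> (- z i s + - z j t))
      = run 6 0 ?m ?p / run 6 (6 * int ?n) ?m ?p"
  proof -
    have "(\<Prod>t<?n. \<sigma> (6 * \<zeta> + - z i s + - z j t) / \<sigma> (- z i s + - z j t))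
        = \<sigma> (?p + of_int (0 + 6 * int s) * \<zeta>) / \<sigma> (?p + of_int (6 * int ?n + 6 * int s) * \<zeta>)" for s
    proof -
      let ?g = "\<lambda>y. inverse (\<sigma> (?p + of_int (6 * int y + 6 * int s) * \<zeta>))"
      have "6 * \<zeta> + - z i s + - z j t = - (?p + of_int (6 * int t + 6 * int s) * \<zeta>)"
        "- z i s + - z j t = - (?p + of_int (6 * int (Suc t) + 6 * int s) * \<zeta>)" for t
        by (simp_all add: z_def algebra_simps)
      then have "(\<Prod>t<?n. \<sigma> (6 * \<zeta> + - z i s + - z j t) / \<sigma> (- z i s + - z j t)) = (\<Prod>t=0..<?n. ?g (Suc t) / ?g t)"
        by (simp only: odd atLeast0LessThan) (simp add: field_simps)
      also have "\<dots> = ?g ?n / ?g 0"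
      proof (rule prod_telescope_ratio)
        show "?g t \<noteq> 0" for t using nz_plus[OF i] by (simp only: inverse_nonzero_iff_nonzero) blast
      qed simp
      finally show ?thesis by (simp add: field_simps)
    qed
    then show ?thesis unfolding run_def prod_dividef[symmetric] by (rule prod.cong[OF refl])
  qed
  have m1: "(\<Prod>s<?m. s2 (c i s) (c j ?n)) = run 6 (6 * int ?n) ?m ?p * run 6 (- 6 * int ?n) ?m ?d"
    unfolding s2_def prod.distrib run_def
    by (intro arg_cong2[where f = "(*)"] prod.cong refl arg_cong[where f = \<sigma>]) (simp_all add: c_def algebra_simps)
  have m2: "(\<Prod>s<?n. s2 (c j s) (c i ?m)) = run 6 (6 * int ?m) ?n ?p * ((-1) ^ ?n * run 6 (6 * int ?m - 6 * int ?n + 6) ?n ?d)"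
  proof -
    have "(\<Prod>s<?n. s2 (c j s) (c i ?m)) = run 6 (6 * int ?m) ?n ?p * run 6 (- 6 * int ?m) ?n (- ?d)"
      unfolding s2_def prod.distrib run_def
      by (intro arg_cong2[where f = "(*)"] prod.cong refl arg_cong[where f = \<sigma>]) (simp_all add: c_def algebra_simps)
    also have "run 6 (- 6 * int ?m) ?n (- ?d) = (-1) ^ ?n * run 6 (6 * int ?m - 6 * int ?n + 6) ?n ?d"
    proof -
      have "- (- 6 * int ?m) - 6 * (int ?n - 1) = 6 * int ?m - 6 * int ?n + 6" by simp
      then show ?thesis by (simp only: run_reflect)
    qed
    finally show ?thesis .
  qed
  have g9: "run 6 6 ?n (\<xi> j - \<xi> i) = (-1) ^ ?n * run 6 (- 6 * int ?n) ?n ?d"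
  proof -
    have "- 6 - 6 * (int ?n - 1) = - 6 * int ?n" "\<xi> j - \<xi> i = - ?d" by simp_all
    then show ?thesis by (simp only: run_reflect)
  qed
  have plus: "run 6 0 (?m + ?n) ?p = run 6 0 ?m ?p * run 6 (6 * int ?m) ?n ?p"
    by (simp add: run_add)
  have minus: "run 6 (- 6 * int ?n) ?m ?d * run 6 (6 * int ?m - 6 * int ?n) 1 ?d * run 6 (6 * int ?m - 6 * int ?n + 6) ?n ?d
      = run 6 (- 6 * int ?n) ?n ?d * run 6 0 1 ?d * run 6 6 ?m ?d"
  proof -
    let ?a = "- 6 * int ?n"
    have "?a + 6 * int ?m = 6 * int ?m - 6 * int ?n" "?a + 6 * int (?m + 1) = 6 * int ?m - 6 * int ?n + 6"
      "?a + 6 * int ?n = 0" "?a + 6 * int (?n + 1) = 6" by simp_all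
    moreover have "run 6 ?a (?m + 1 + ?n) ?d = run 6 ?a (?n + 1 + ?m) ?d" by (simp only: ac_simps)
    ultimately show ?thesis
      unfolding run_add[of 6 ?a "?m + 1" ?n] run_add[of 6 ?a ?m 1] run_add[of 6 ?a "?n + 1" ?m] run_add[of 6 ?a ?n 1]
      by (simp only:)
  qed
  have field: "t / n / (p * q) * (p / s) * ((s * l) * (q * (\<epsilon> * g))) = f * (\<epsilon> * e)"
    if "n \<noteq> 0" "p \<noteq> 0" "q \<noteq> 0" "s \<noteq> 0" "l * t * g = e * n * f" for t n p q s l \<epsilon> g f e :: complex
  proof -
    have "t / n / (p * q) * (p / s) * ((s * l) * (q * (\<epsilon> * g))) = \<epsilon> * (l * t * g) / n"
      using that(1-4) by (simp add: field_simps)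
    also have "\<dots> = f * (\<epsilon> * e)" unfolding that(5) using that(1) by simp
    finally show ?thesis .
  qed
  show ?thesis unfolding pair_factor_def cross m1 m2 g9 plus by (rule field[OF dnz pnz pnz pnz minus])
qed


text \<open>The explicit coefficient, normalised by the values F N (\<xi> i), satisfies the equation
  that \<open>coefficient\<close> gives for \<alpha> k. Since the \<open>newton\<close> values and
  \<open>cubic_wt\<close> at k are nonzero, this identifies the two.\<close>

lemma coefficient_eq:
  assumes R: "R = {1..r}"
  shows "upper r (coeff_pair k) * (\<Prod>i=1..r. coeff_single N (sum k R) (k i) (\<xi> i))
      * (run 2 (- 2 * int N) (sum k R) 0 * run 2 (2 * int N + 2) (2 * sum k R) 0)
      / (\<Prod>i=1..r. \<Prod>j=1..r. run 6 6 (k i) (\<xi> i - \<xi> j))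
      * (\<Prod>i=1..r. F N (\<xi> i)) * (\<Prod>j\<in>R. newton R c (h N) k (c j (k j))) * cubic_wt N k k
    = (\<Prod>j\<in>R. F N (c j (k j))) * run 2 (2 * int N - 2 * int (sum k R) + 2) (3 * sum k R) 0"
proof -
  let ?K = "sum k R"
  have kK: "k i \<le> ?K" if "i \<in> {1..r}" for i using that R by (intro member_le_sum) auto
  define Nw where "Nw i j = (\<Prod>s<k i. s2 (c i s) (c j (k j)))" for i j
  define Hs where "Hs j = (\<Prod>y<?K. s2 (h N y) (c j (k j)))" for j
  define PA where "PA i = (\<Prod>s<k i. \<sigma> (B4 N + - z i s) * \<sigma> (B1 N ?K + - z i s) * \<sigma> (B2 N ?K + - z i s)
      * \<sigma> (B3 N ?K + - z i s) / \<sigma> (2 * - z i s))" for i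
  define PS where "PS i = (\<Prod>s<k i. \<Prod>t<s. \<sigma> (6 * \<zeta> + - z i s + - z i t) / \<sigma> (- z i s + - z i t))" for i
  define PC where "PC i j = (\<Prod>s<k i. \<Prod>t<k j. \<sigma> (6 * \<zeta> + - z i s + - z j t) / \<sigma> (- z i s + - z j t))" for i j
  define g9 where "g9 i j = run 6 6 (k i) (\<xi> i - \<xi> j)" for i j
  have newt: "(\<Prod>j\<in>R. newton R c (h N) k (c j (k j)))
      = (\<Prod>i=1..r. Nw i i) * upper r (\<lambda>i j. Nw i j * Nw j i) / (\<Prod>i=1..r. Hs i)"
  proof -
    have "newton R c (h N) k (c j (k j)) = (\<Prod>i=1..r. Nw i j) / Hs j" for j
      unfolding newton_def Hs_def Nw_def R by (subst prod.Sigma) (auto simp: case_prod_unfold)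
    then have "(\<Prod>j\<in>R. newton R c (h N) k (c j (k j))) = (\<Prod>j=1..r. \<Prod>i=1..r. Nw i j) / (\<Prod>i=1..r. Hs i)"
      unfolding R by (simp add: prod_dividef)
    also have "(\<Prod>j=1..r. \<Prod>i=1..r. Nw i j) = (\<Prod>i=1..r. \<Prod>j=1..r. Nw i j)" by (rule prod.swap)
    finally show ?thesis unfolding prod_square .
  qed
  have wt: "cubic_wt N k k = (\<Prod>i=1..r. PA i) * ((\<Prod>i=1..r. PS i) * upper r PC)"
  proof -
    have "cubic_wt N k k = (\<Prod>x\<in>Sigma {1..r} (\<lambda>i. {..<k i}). \<sigma> (B4 N + - case_prod z x) * \<sigma> (B1 N ?K + - case_prod z x)
        * \<sigma> (B2 N ?K + - case_prod z x) * \<sigma> (B3 N ?K + - case_prod z x) / \<sigma> (2 * - case_prod z x))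
      * pprod (\<lambda>x y. \<sigma> (6 * \<zeta> + - case_prod z x + - case_prod z y) / \<sigma> (- case_prod z x + - case_prod z y))
          (Sigma {1..r} (\<lambda>i. {..<k i}))"
      unfolding cubic_wt_def chain_wt_top wt_def links_def unfolding R ..
    also have "(\<Prod>x\<in>Sigma {1..r} (\<lambda>i. {..<k i}). \<sigma> (B4 N + - case_prod z x) * \<sigma> (B1 N ?K + - case_prod z x)
        * \<sigma> (B2 N ?K + - case_prod z x) * \<sigma> (B3 N ?K + - case_prod z x) / \<sigma> (2 * - case_prod z x))
        = (\<Prod>i=1..r. PA i)"
      unfolding PA_def by (subst prod.Sigma) (auto simp: case_prod_unfold)
    also have "pprod (\<lambda>x y. \<sigma> (6 * \<zeta> + - case_prod z x + - case_prod z y) / \<sigma> (- case_prod z x + - case_prod z y))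
          (Sigma {1..r} (\<lambda>i. {..<k i})) = (\<Prod>i=1..r. PS i) * upper r PC"
      unfolding PS_def PC_def by (subst pprod_rows) (simp_all only: add_ac prod.case)
    finally show ?thesis .
  qed
  have pairs: "upper r (\<lambda>i j. coeff_pair k i j * PC i j * (Nw i j * Nw j i)) = upper r (\<lambda>i j. g9 i j * g9 j i)"
    unfolding PC_def Nw_def g9_def by (intro prod.cong refl newton_pair) (auto simp: R)
  have singles: "(\<Prod>i=1..r. coeff_single N ?K (k i) (\<xi> i) * F N (\<xi> i) * (PA i * PS i * Nw i i))
      = (\<Prod>i=1..r. (-1) ^ k i * F N (c i (k i)) * Hs i * g9 i i)"
  proof (rule prod.cong[OF refl])
    fix i assume i: "i \<in> {1..r}"
    have iR: "i \<in> R" using i R by simp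
    have "PA i * PS i * Nw i i = run 6 (- 3 * int N) (k i) (\<xi> i) * run 2 (int N + 2 * int ?K) (3 * k i) (\<xi> i) * g9 i i"
      unfolding PA_def PS_def Nw_def g9_def using newton_self[OF iR] by simp
    then show "coeff_single N ?K (k i) (\<xi> i) * F N (\<xi> i) * (PA i * PS i * Nw i i)
        = (-1) ^ k i * F N (c i (k i)) * Hs i * g9 i i"
      unfolding Hs_def coeff_single[OF iR kK[OF i], symmetric] by (simp only: mult.assoc)
  qed
  \<comment> \<open>Reflection turns the factor coming from (q^(-N); q)_K into the run that directly
    precedes the one from (q^(N+1); q)_(2K); together they are the closed form of the signed
    sum.\<close>
  have six: "run 2 (- 2 * int N) ?K 0 * run 2 (2 * int N + 2) (2 * ?K) 0
      = (-1) ^ ?K * run 2 (2 * int N - 2 * int ?K + 2) (3 * ?K) 0"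
  proof -
    have "- (- 2 * int N) - 2 * (int ?K - 1) = 2 * int N - 2 * int ?K + 2" by simp
    then have "run 2 (- 2 * int N) ?K (- 0) = (-1) ^ ?K * run 2 (2 * int N - 2 * int ?K + 2) ?K 0"
      by (simp only: run_reflect)
    moreover have "2 * int N - 2 * int ?K + 2 + 2 * int ?K = 2 * int N + 2" "3 * ?K = ?K + 2 * ?K" by simp_all
    then have "run 2 (2 * int N - 2 * int ?K + 2) (3 * ?K) 0
        = run 2 (2 * int N - 2 * int ?K + 2) ?K 0 * run 2 (2 * int N + 2) (2 * ?K) 0"
      by (simp only: run_add)
    ultimately show ?thesis by simp
  qed
  have nz: "(\<Prod>i=1..r. Hs i) \<noteq> 0" "(\<Prod>i=1..r. g9 i i) \<noteq> 0" "upper r (\<lambda>i j. g9 i j * g9 j i) \<noteq> 0"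
  proof -
    have "Hs i \<noteq> 0" if "i \<in> {1..r}" for i
      unfolding Hs_def prod_zero_iff[OF finite_lessThan] using nz_h[of i] that R by blast
    then show "(\<Prod>i=1..r. Hs i) \<noteq> 0" by (simp add: prod_zero_iff)
    have self: "g9 i i \<noteq> 0" for i
    proof -
      have "\<sigma> (0 + of_int (6 + 6 * int y) * \<zeta>) \<noteq> 0" for y
        using nz_zeta[of "3 + 3 * int y"] by (simp add: algebra_simps)
      then show ?thesis unfolding g9_def run_def prod_zero_iff[OF finite_lessThan] by simp
    qed
    then show "(\<Prod>i=1..r. g9 i i) \<noteq> 0" by (simp add: prod_zero_iff)
    have "g9 i j \<noteq> 0" if "i \<in> {1..r}" "j \<in> {1..r}" for i j
    proof (cases "i = j")
      case True then show ?thesis using self by simp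
    next
      case False
      then show ?thesis unfolding g9_def run_def prod_zero_iff[OF finite_lessThan]
        using nz_minus[of i j] that R by blast
    qed
    then show "upper r (\<lambda>i j. g9 i j * g9 j i) \<noteq> 0" by (auto simp: prod_zero_iff)
  qed
  have sgn: "(\<Prod>i=1..r. (-1 :: complex) ^ k i) * (-1) ^ ?K = 1"
    unfolding power_sum[symmetric] R by (simp add: power_mult_distrib[symmetric])
  have g9: "(\<Prod>i=1..r. \<Prod>j=1..r. run 6 6 (k i) (\<xi> i - \<xi> j)) = (\<Prod>i=1..r. g9 i i) * upper r (\<lambda>i j. g9 i j * g9 j i)"
    unfolding g9_def[symmetric] by (rule prod_square)
  have RF: "(\<Prod>j\<in>R. F N (c j (k j))) = (\<Prod>i=1..r. F N (c i (k i)))" by (simp add: R)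
  have "upper r (coeff_pair k) * (\<Prod>i=1..r. coeff_single N ?K (k i) (\<xi> i))
      * (run 2 (- 2 * int N) ?K 0 * run 2 (2 * int N + 2) (2 * ?K) 0)
      / (\<Prod>i=1..r. \<Prod>j=1..r. run 6 6 (k i) (\<xi> i - \<xi> j))
      * (\<Prod>i=1..r. F N (\<xi> i)) * (\<Prod>j\<in>R. newton R c (h N) k (c j (k j))) * cubic_wt N k k
    = upper r (\<lambda>i j. coeff_pair k i j * PC i j * (Nw i j * Nw j i))
      * (\<Prod>i=1..r. coeff_single N ?K (k i) (\<xi> i) * F N (\<xi> i) * (PA i * PS i * Nw i i))
      * ((-1) ^ ?K * run 2 (2 * int N - 2 * int ?K + 2) (3 * ?K) 0)
      / ((\<Prod>i=1..r. g9 i i) * upper r (\<lambda>i j. g9 i j * g9 j i) * (\<Prod>i=1..r. Hs i))"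
    unfolding newt wt six g9 prod.distrib
    by (simp only: divide_inverse inverse_mult_distrib mult_ac)
  also have "\<dots> = ((\<Prod>i=1..r. (-1 :: complex) ^ k i) * (-1) ^ ?K) * ((\<Prod>j\<in>R. F N (c j (k j))) * run 2 (2 * int N - 2 * int ?K + 2) (3 * ?K) 0)"
  proof -
    have "u * (s * f * H * g) * (e * q) / (g * u * H) = (s * e) * (f * q)"
      if "H \<noteq> 0" "g \<noteq> 0" "u \<noteq> 0" for u s f H g e q :: complex
      using that by (simp add: field_simps)
    note cancel = this[OF nz]
    have "(\<Prod>i=1..r. (-1) ^ k i * F N (c i (k i)) * Hs i * g9 i i)
        = (\<Prod>i=1..r. (-1) ^ k i) * (\<Prod>i=1..r. F N (c i (k i))) * (\<Prod>i=1..r. Hs i) * (\<Prod>i=1..r. g9 i i)"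
      by (simp only: prod.distrib)
    then show ?thesis unfolding pairs singles RF by (simp only: cancel)
  qed
  finally show ?thesis unfolding sgn by simp
qed

theorem cubic_sum_generic:
  assumes R: "R = {1..r}"
    and w: "\<And>j. j \<in> {1..r} \<Longrightarrow> run 6 (- 3 * int N) (N + 1) (w j) \<noteq> 0"
      "\<And>j y. j \<in> {1..r} \<Longrightarrow> y < N \<Longrightarrow> s2 (h N y) (w j) \<noteq> 0"
  shows "(\<Sum>k\<in>{k\<in>PiE {1..r} (\<lambda>_. {..N}). sum k {1..r} \<le> N}. cubic_term \<sigma> \<zeta> r N \<xi> w k)
    = (\<Prod>i=1..r. F N (w i) / F N (- \<xi> i))"
proof -
  obtain \<alpha> where \<alpha>:
    "\<And>k. k \<in> PiE R (\<lambda>_. {..N}) \<Longrightarrow> \<alpha> k * (\<Prod>j\<in>R. newton R c (h N) k (c j (k j))) * cubic_wt N k k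
      = (\<Prod>j\<in>R. F N (c j (k j))) * run 2 (2 * int N - 2 * int (sum k R) + 2) (3 * sum k R) 0"
    and expand: "\<And>w. (\<And>j. j \<in> R \<Longrightarrow> run 6 (- 3 * int N) (N + 1) (w j) \<noteq> 0) \<Longrightarrow>
      (\<And>j y. j \<in> R \<Longrightarrow> y < N \<Longrightarrow> s2 (h N y) (w j) \<noteq> 0) \<Longrightarrow>
      (\<Sum>k\<in>{k\<in>PiE R (\<lambda>_. {..N}). sum k R \<le> N}. \<alpha> k * (\<Prod>j\<in>R. newton R c (h N) k (w j)))
      = (\<Prod>j\<in>R. F N (w j))"
  proof (rule expansion[of N], goal_cases)
    case (1 \<alpha>)
    show ?case by (rule 1(1)[OF 1(2) 1(3)])
  qed
  have expand: "(\<Sum>k\<in>{k\<in>PiE R (\<lambda>_. {..N}). sum k R \<le> N}. \<alpha> k * (\<Prod>j\<in>R. newton R c (h N) k (w j)))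
      = (\<Prod>j\<in>R. F N (w j))"
    by (rule expand) (use w R in blast)+
  \<comment> \<open>The coefficient at k = 0, that is, the right-hand side at the first nodes;
    \<open>cubic_term\<close> is normalised to be 1 there.\<close>
  define P where "P = (\<Prod>i=1..r. F N (\<xi> i))"
  have Fnz: "F N (\<xi> i) \<noteq> 0" if "i \<in> {1..r}" for i
    using nz_run[of i _ _ _ 0] that unfolding F_def R by (simp add: c_def)
  then have Pnz: "P \<noteq> 0" by (simp add: P_def prod_zero_iff)
  have "cubic_term \<sigma> \<zeta> r N \<xi> w k * P = \<alpha> k * (\<Prod>j\<in>R. newton R c (h N) k (w j))"
    if k: "k \<in> PiE R (\<lambda>_. {..N})" for k
  proof -
    let ?K = "sum k R"
    let ?C = "upper r (coeff_pair k) * (\<Prod>i=1..r. coeff_single N ?K (k i) (\<xi> i))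
      * (run 2 (- 2 * int N) ?K 0 * run 2 (2 * int N + 2) (2 * ?K) 0)
      / (\<Prod>i=1..r. \<Prod>j=1..r. run 6 6 (k i) (\<xi> i - \<xi> j))"
    let ?n = "\<Prod>j\<in>R. newton R c (h N) k (c j (k j))"
    have "?C * P * ?n * cubic_wt N k k = \<alpha> k * ?n * cubic_wt N k k"
      unfolding P_def \<alpha>[OF k] by (rule coefficient_eq[OF R])
    then have "?C * P * ?n = \<alpha> k * ?n"
      by (rule mult_right_cancel[OF cubic_wt_nz, THEN iffD1])
    moreover have "?n \<noteq> 0"
      using newton_c_nz finite_R by (simp add: prod_zero_iff)
    ultimately have C: "?C * P = \<alpha> k"
      by (rule mult_right_cancel[THEN iffD1, rotated])
    have "newton R c (h N) k (w j) = (\<Prod>i=1..r. run 6 0 (k i) (\<xi> i + w j) * run 6 0 (k i) (\<xi> i - w j))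
        / (run 2 (int N + 2) ?K (- w j) * run 2 (int N + 2) ?K (w j))" for j
    proof -
      have "(\<Prod>x\<in>Sigma R (\<lambda>i. {..<k i}). s2 (case_prod c x) (w j)) = (\<Prod>i=1..r. \<Prod>s<k i. s2 (c i s) (w j))"
        unfolding R by (subst prod.Sigma) (auto simp: case_prod_unfold)
      also have "\<dots> = (\<Prod>i=1..r. run 6 0 (k i) (\<xi> i + w j) * run 6 0 (k i) (\<xi> i - w j))"
        unfolding run_def prod.distrib[symmetric]
        by (intro prod.cong refl) (simp add: s2_def c_def algebra_simps)
      finally have 1: "(\<Prod>x\<in>Sigma R (\<lambda>i. {..<k i}). s2 (case_prod c x) (w j))
          = (\<Prod>i=1..r. run 6 0 (k i) (\<xi> i + w j) * run 6 0 (k i) (\<xi> i - w j))" .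
      have 2: "(\<Prod>y<?K. s2 (h N y) (w j)) = run 2 (int N + 2) ?K (- w j) * run 2 (int N + 2) ?K (w j)"
        unfolding run_def prod.distrib[symmetric]
        by (intro prod.cong refl) (simp add: s2_def h_def algebra_simps)
      show ?thesis unfolding newton_def 1 2 ..
    qed
    then have newt: "(\<Prod>j\<in>R. newton R c (h N) k (w j))
        = (\<Prod>i=1..r. \<Prod>j=1..r. run 6 0 (k i) (\<xi> i + w j) * run 6 0 (k i) (\<xi> i - w j))
        / (\<Prod>j=1..r. run 2 (int N + 2) ?K (- w j) * run 2 (int N + 2) ?K (w j))"
      unfolding R by (simp add: prod_dividef) (subst prod.swap, simp)
    show ?thesis unfolding C[symmetric] newt cubic_term_def Let_def R[symmetric] unfolding R prod_dividef
      by (simp only: divide_inverse inverse_mult_distrib mult_ac)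
  qed
  then have "(\<Sum>k\<in>{k\<in>PiE R (\<lambda>_. {..N}). sum k R \<le> N}. cubic_term \<sigma> \<zeta> r N \<xi> w k) * P = (\<Prod>j\<in>R. F N (w j))"
    unfolding sum_distrib_right expand[symmetric] by (intro sum.cong refl) simp
  moreover have "(\<Prod>i=1..r. F N (- \<xi> i)) = P"
  proof -
    have "- (- int N) - 2 * (int (N + 1) - 1) = - int N" "- (- 3 * int N) - 6 * (int (N + 1) - 1) = - 3 * int N"
      by simp_all
    then have "F N (- u) = F N u" for u unfolding F_def run_reflect by simp
    then show ?thesis by (simp add: P_def)
  qed
  ultimately show ?thesis using Pnz by (simp add: R prod_dividef field_simps)
qed

end

section \<open>Removing genericity\<close>

context odd_sigma
begin

lemma isCont_sigma: 
  assumes "isCont f a"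
  shows "isCont (\<lambda>t. \<sigma> (f t)) a"
proof -
  have "isCont \<sigma> (f a)" using cont by (simp add: continuous_on_eq_continuous_at)
  then show ?thesis by (rule isCont_o2[OF assms])
qed

lemma isCont_run: "isCont f a \<Longrightarrow> isCont (\<lambda>t. sigma_run \<sigma> \<zeta> d e L (f t)) a"
  unfolding sigma_run_def by (intro continuous_prod isCont_sigma isCont_add continuous_const)

theorem cubic_sum:
  fixes \<xi> w :: "nat \<Rightarrow> complex"
  defines "Ks N r \<equiv> {k\<in>PiE {1..r} (\<lambda>_. {..N}). sum k {1..r} \<le> N}"
  assumes r: "r \<ge> 1" and zeta: "\<And>m::int. m \<noteq> 0 \<Longrightarrow> \<sigma> (of_int (2 * m) * \<zeta>) \<noteq> 0"
    and pair1: "\<And>i j. 1 \<le> i \<Longrightarrow> i < j \<Longrightarrow> j \<le> r \<Longrightarrow> sigma_run \<sigma> \<zeta> 6 0 1 (\<xi> i - \<xi> j) \<noteq> 0"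
    and pair2: "\<And>k i j. k \<in> Ks N r \<Longrightarrow> 1 \<le> i \<Longrightarrow> i < j \<Longrightarrow> j \<le> r \<Longrightarrow>
      sigma_run \<sigma> \<zeta> 6 0 (k i + k j) (\<xi> i + \<xi> j) \<noteq> 0"
    and single1: "\<And>i. i \<in> {1..r} \<Longrightarrow> sigma_run \<sigma> \<zeta> 2 (int N) 1 (\<xi> i) \<noteq> 0"
    and single2: "\<And>k i. k \<in> Ks N r \<Longrightarrow> i \<in> {1..r} \<Longrightarrow>
      sigma_run \<sigma> \<zeta> 2 (2 * int (k i) - 2 * int (sum k {1..r}) - int N) (2 * k i) (\<xi> i) \<noteq> 0"
    and single3: "\<And>k i. k \<in> Ks N r \<Longrightarrow> i \<in> {1..r} \<Longrightarrow> sigma_run \<sigma> \<zeta> 6 (3 * int N + 6) (k i) (\<xi> i) \<noteq> 0"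
    and quot: "\<And>k i j. k \<in> Ks N r \<Longrightarrow> i \<in> {1..r} \<Longrightarrow> j \<in> {1..r} \<Longrightarrow>
      sigma_run \<sigma> \<zeta> 6 6 (k i) (\<xi> i - \<xi> j) \<noteq> 0"
    and w1: "\<And>i. i \<in> {1..r} \<Longrightarrow> sigma_run \<sigma> \<zeta> 2 (int N + 2) N (w i) \<noteq> 0"
    and w2: "\<And>i. i \<in> {1..r} \<Longrightarrow> sigma_run \<sigma> \<zeta> 2 (int N + 2) N (- w i) \<noteq> 0"
    and w3: "\<And>i. i \<in> {1..r} \<Longrightarrow> sigma_run \<sigma> \<zeta> 6 (- 3 * int N) (N + 1) (w i) \<noteq> 0"
    and rhs: "\<And>i. i \<in> {1..r} \<Longrightarrow> sigma_run \<sigma> \<zeta> 2 (- int N) (N + 1) (- \<xi> i) \<noteq> 0"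
  shows "(\<Sum>k\<in>Ks N r. cubic_term \<sigma> \<zeta> r N \<xi> w k)
    = (\<Prod>i=1..r. run_ratio \<sigma> \<zeta> N (w i)
        * (sigma_run \<sigma> \<zeta> 6 (- 3 * int N) (N + 1) (- \<xi> i) / sigma_run \<sigma> \<zeta> 2 (- int N) (N + 1) (- \<xi> i)))"
proof -
  let ?run = "sigma_run \<sigma> \<zeta>"
  \<comment> \<open>The slopes i are positive and distinct, so each \<xi> i, each 2 \<xi> i and
    every sum or difference of two of them really moves with t and meets zeros of \<sigma> for
    countably many t only.\<close>
  define \<xi>' where "\<xi>' t i = \<xi> i + of_nat i * t" for t i
  define rh where "rh \<xi> = (\<Prod>i=1..r. run_ratio \<sigma> \<zeta> N (w i)
        * (?run 6 (- 3 * int N) (N + 1) (- \<xi> i) / ?run 2 (- int N) (N + 1) (- \<xi> i)))" for \<xi> :: "nat \<Rightarrow> complex"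
  define G where "G t = (\<Sum>k\<in>Ks N r. cubic_term \<sigma> \<zeta> r N (\<xi>' t) w k) - rh (\<xi>' t)" for t
  have \<xi>0: "\<xi>' 0 = \<xi>" by (simp add: \<xi>'_def fun_eq_iff)
  have \<xi>C: "isCont (\<lambda>t. \<xi>' t i) 0" for i
    unfolding \<xi>'_def by (intro isCont_add isCont_mult continuous_const continuous_ident)
  \<comment> \<open>A shorter run divides a longer one with the same start, so the hypotheses on w
    at length N cover all K \<le> N.\<close>
  have run_le: "?run d e K u \<noteq> 0" if "?run d e N u \<noteq> 0" "K \<le> N" for d e K u
    using that unfolding sigma_run_def by (auto simp: prod_zero_iff)
  have "isCont G 0"
    unfolding G_def rh_def
  proof (intro isCont_diff continuous_sum continuous_prod isCont_mult isCont_divide isCont_run isCont_minus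
      continuous_const \<xi>C)
    fix i assume "i \<in> {1..r}"
    then show "?run 2 (- int N) (N + 1) (- \<xi>' 0 i) \<noteq> 0" unfolding \<xi>0 by (rule rhs)
  next
    fix k assume k: "k \<in> Ks N r"
    have K: "sum k {1..r} \<le> N" using k by (simp add: Ks_def)
    show "isCont (\<lambda>t. cubic_term \<sigma> \<zeta> r N (\<xi>' t) w k) 0"
      unfolding cubic_term_def Let_def pair_factor_def single_factor_def
    proof (intro continuous_prod isCont_mult isCont_divide isCont_run isCont_minus isCont_diff isCont_add
        continuous_const \<xi>C; (unfold \<xi>0)?)
      fix i j assume "i \<in> {1..r}" "j \<in> {i+1..r}"
      then show "?run 6 0 1 (\<xi> i - \<xi> j) \<noteq> 0" "?run 6 0 (k i + k j) (\<xi> i + \<xi> j) \<noteq> 0"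
        using pair1[of i j] pair2[OF k, of i j] by auto
    next
      fix i assume i: "i \<in> {1..r}"
      show "?run 2 (int N) 1 (\<xi> i) \<noteq> 0" by (rule single1[OF i])
      show "?run 2 (2 * int (k i) - 2 * int (sum k {1..r}) - int N) (2 * k i) (\<xi> i) \<noteq> 0"
        by (rule single2[OF k i])
      show "?run 6 (3 * int N + 6) (k i) (\<xi> i) \<noteq> 0" by (rule single3[OF k i])
      show "?run 2 (int N + 2) (sum k {1..r}) (- w i) * ?run 2 (int N + 2) (sum k {1..r}) (w i) \<noteq> 0"
        using run_le[OF w1[OF i] K] run_le[OF w2[OF i] K] by simp
      fix j assume j: "j \<in> {1..r}"
      show "?run 6 6 (k i) (\<xi> i - \<xi> j) \<noteq> 0" by (rule quot[OF k i j])
    qed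
  qed
  moreover have "countable {t. G t \<noteq> 0}"
  proof (rule countable_subset)
    let ?Z = "\<lambda>a c. {t. \<sigma> (a + c * t) = 0}"
    let ?bad = "(\<Union>i\<in>{1..r}. \<Union>m. ?Z (\<xi> i + of_int m * \<zeta>) (of_nat i) \<union> ?Z (2 * \<xi> i + of_int m * \<zeta>) (of_nat (2 * i))
        \<union> (\<Union>j\<in>{1..r}-{i}. ?Z (\<xi> i + \<xi> j + of_int m * \<zeta>) (of_nat i + of_nat j)
          \<union> ?Z (\<xi> i - \<xi> j + of_int m * \<zeta>) (of_nat i - of_nat j)))"
    show "{t. G t \<noteq> 0} \<subseteq> ?bad"
    proof (rule subsetI, rule ccontr)
      fix t assume t: "t \<in> {t. G t \<noteq> 0}" and nb: "t \<notin> ?bad"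
      have good: "\<sigma> (\<xi> i + of_int m * \<zeta> + of_nat i * t) \<noteq> 0"
        "\<sigma> (2 * \<xi> i + of_int m * \<zeta> + of_nat (2 * i) * t) \<noteq> 0"
        "j \<in> {1..r} \<Longrightarrow> i \<noteq> j \<Longrightarrow> \<sigma> (\<xi> i + \<xi> j + of_int m * \<zeta> + (of_nat i + of_nat j) * t) \<noteq> 0"
        "j \<in> {1..r} \<Longrightarrow> i \<noteq> j \<Longrightarrow> \<sigma> (\<xi> i - \<xi> j + of_int m * \<zeta> + (of_nat i - of_nat j) * t) \<noteq> 0"
        if "i \<in> {1..r}" for i j m
        using nb that by auto
      have gen: "generic_chains \<sigma> \<zeta> (\<xi>' t) {1..r}"
      proof unfold_locales
        show "{1..r} \<noteq> {}" using r by simp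
        show "\<sigma> (of_int (2 * m) * \<zeta>) \<noteq> 0" if "m \<noteq> 0" for m by (rule zeta[OF that])
        fix i m assume i: "i \<in> {1..r}"
        show "\<sigma> (\<xi>' t i + of_int m * \<zeta>) \<noteq> 0"
          using good(1)[OF i, of m] by (simp add: \<xi>'_def algebra_simps)
        show "\<sigma> (2 * \<xi>' t i + of_int m * \<zeta>) \<noteq> 0"
          using good(2)[OF i, of m] by (simp add: \<xi>'_def algebra_simps)
        fix j assume j: "j \<in> {1..r}" "i \<noteq> j"
        show "\<sigma> (\<xi>' t i + \<xi>' t j + of_int m * \<zeta>) \<noteq> 0"
          using good(3)[OF i j, of m] by (simp add: \<xi>'_def algebra_simps)
        show "\<sigma> (\<xi>' t i - \<xi>' t j + of_int m * \<zeta>) \<noteq> 0"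
          using good(4)[OF i j, of m] by (simp add: \<xi>'_def algebra_simps)
      qed simp
      interpret g: generic_chains \<sigma> \<zeta> "\<xi>' t" "{1..r}" by (rule gen)
      have "s2 (g.h N y) (w j) \<noteq> 0" if j: "j \<in> {1..r}" and y: "y < N" for j y
      proof -
        have "\<sigma> (w j + of_int (int N + 2 + 2 * int y) * \<zeta>) \<noteq> 0" "\<sigma> (- w j + of_int (int N + 2 + 2 * int y) * \<zeta>) \<noteq> 0"
          using w1[OF j] w2[OF j] y unfolding sigma_run_def prod_zero_iff[OF finite_lessThan] by blast+
        then show ?thesis by (simp add: s2_def g.h_def add.commute)
      qed
      then have "(\<Sum>k\<in>Ks N r. cubic_term \<sigma> \<zeta> r N (\<xi>' t) w k)
          = (\<Prod>i=1..r. run_ratio \<sigma> \<zeta> N (w i) / run_ratio \<sigma> \<zeta> N (- \<xi>' t i))"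
        unfolding Ks_def by (intro g.cubic_sum_generic refl w3)
      also have "\<dots> = rh (\<xi>' t)" unfolding rh_def
        by (intro prod.cong refl) (simp add: run_ratio_def[of _ _ _ "- _"])
      finally show False using t by (simp add: G_def)
    qed
    have cz: "countable (?Z a c)" if "c \<noteq> 0" for a c by (rule countable_zeros_affine[OF that])
    have ne: "(of_nat i :: complex) \<noteq> 0" "(of_nat (2 * i) :: complex) \<noteq> 0"
      "(of_nat i + of_nat j :: complex) \<noteq> 0" if "i \<in> {1..r}" for i j
      using that by (simp_all flip: of_nat_add)
    show "countable ?bad"
    proof (rule countable_UN[OF countable_finite[OF finite_atLeastAtMost]], rule countable_UN[OF countableI_type])
      fix i and m :: int assume i: "i \<in> {1..r}"
      have "countable (\<Union>j\<in>{1..r}-{i}. ?Z (\<xi> i + \<xi> j + of_int m * \<zeta>) (of_nat i + of_nat j)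
          \<union> ?Z (\<xi> i - \<xi> j + of_int m * \<zeta>) (of_nat i - of_nat j))"
        using ne(3)[OF i] by (intro countable_UN[OF countable_finite] countable_Un cz) auto
      then show "countable (?Z (\<xi> i + of_int m * \<zeta>) (of_nat i) \<union> ?Z (2 * \<xi> i + of_int m * \<zeta>) (of_nat (2 * i))
        \<union> (\<Union>j\<in>{1..r}-{i}. ?Z (\<xi> i + \<xi> j + of_int m * \<zeta>) (of_nat i + of_nat j)
          \<union> ?Z (\<xi> i - \<xi> j + of_int m * \<zeta>) (of_nat i - of_nat j)))"
        by (intro countable_Un cz ne(1,2)[OF i])
    qed
  qed
  ultimately have "G 0 = 0" by (rule isCont_zero_off_countable)
  then show ?thesis by (simp add: G_def rh_def \<xi>0)
qed

end

section \<open>Theta functions\<close>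

text \<open>The infinite shifted factorial (x; p)_\<infinity>, one half of the product defining
  \<open>theta\<close>.\<close>

definition half_theta :: "complex \<Rightarrow> complex \<Rightarrow> complex" where
  "half_theta p x = (\<Prod>j. 1 - p ^ j * x)"

lemma half_theta_convergent:
  fixes p x :: complex
  assumes "norm p < 1"
  shows "convergent_prod (\<lambda>j. 1 - p ^ j * x)"
proof -
  have "summable (\<lambda>j. norm p ^ j * norm x)"
    using assms by (intro summable_mult2 summable_geometric) simp
  moreover have "(\<lambda>j. norm (- (p ^ j * x))) = (\<lambda>j. norm p ^ j * norm x)"
    by (simp only: norm_minus_cancel norm_mult norm_power)
  ultimately have "summable (\<lambda>j. norm (- (p ^ j * x)))" by simp
  then have "convergent_prod (\<lambda>j. 1 + - (p ^ j * x))"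
    by (intro abs_convergent_prod_imp_convergent_prod summable_imp_abs_convergent_prod) simp
  then show ?thesis by simp
qed

lemma half_theta_eq_0_iff:
  assumes "norm p < 1"
  shows "half_theta p x = 0 \<longleftrightarrow> (\<exists>j. p ^ j * x = 1)"
proof -
  have "(\<lambda>j. 1 - p ^ j * x) has_prod half_theta p x"
    unfolding half_theta_def by (rule convergent_prod_has_prod[OF half_theta_convergent[OF assms]])
  from has_prod_eq_0_iff[OF this] show ?thesis by (auto simp: image_iff)
qed

lemma half_theta_rec:
  assumes "norm p < 1"
  shows "half_theta p x = (1 - x) * half_theta p (p * x)"
proof (cases "x = 1")
  case True
  then have "p ^ 0 * x = 1" by simp
  then have "half_theta p x = 0" using half_theta_eq_0_iff[OF assms] by blast
  then show ?thesis using True by simp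
next
  case False
  have "(\<Prod>j. 1 - p ^ Suc j * x) = half_theta p x / (1 - p ^ 0 * x)"
    unfolding half_theta_def
    by (rule prodinf_split_head[OF half_theta_convergent[OF assms]]) (use False in simp)
  moreover have "(\<Prod>j. 1 - p ^ Suc j * x) = half_theta p (p * x)"
    unfolding half_theta_def by (intro prodinf_cong) (simp add: mult_ac)
  ultimately show ?thesis using False by (simp add: field_simps)
qed

lemma half_theta_holomorphic:
  assumes "norm p < 1"
  shows "half_theta p holomorphic_on UNIV"
proof (rule holomorphic_uniform_sequence[where f = "\<lambda>N x. \<Prod>j<N. 1 - p ^ j * x"])
  fix x :: complex
  show "\<exists>d>0. cball x d \<subseteq> UNIV \<and> uniform_limit (cball x d) (\<lambda>N x. \<Prod>j<N. 1 - p ^ j * x) (half_theta p) sequentially"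
  proof (intro exI[of _ 1] conjI)
    let ?C = "norm x + 1"
    have unif: "uniformly_convergent_on (cball x 1) (\<lambda>N y. \<Prod>j<N. 1 - p ^ j * y)"
    proof (rule uniformly_convergent_on_prod')
      show "uniformly_convergent_on (cball x 1) (\<lambda>N y. \<Sum>j<N. norm (1 - p ^ j * y - 1))"
      proof (rule Weierstrass_m_test'[where M = "\<lambda>j. norm p ^ j * ?C"])
        show "norm (norm (1 - p ^ j * y - 1)) \<le> norm p ^ j * ?C" if "y \<in> cball x 1" for j y
        proof -
          have "norm y \<le> ?C" using that norm_triangle_ineq2[of y x] by (simp add: dist_norm norm_minus_commute)
          then show ?thesis by (simp add: norm_mult norm_power mult_left_mono)
        qed
        show "summable (\<lambda>j. norm p ^ j * ?C)"
          using assms by (intro summable_mult2 summable_geometric) simp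
      qed
    qed (auto intro!: continuous_intros)
    then obtain l where l: "uniform_limit (cball x 1) (\<lambda>N y. \<Prod>j<N. 1 - p ^ j * y) l sequentially"
      by (auto simp: uniformly_convergent_on_def)
    have "l y = half_theta p y" if "y \<in> cball x 1" for y
    proof -
      have "(\<lambda>N. \<Prod>j<N. 1 - p ^ j * y) \<longlonglongrightarrow> l y" by (rule tendsto_uniform_limitI[OF l that])
      moreover have "(\<lambda>N. \<Prod>j\<le>N. 1 - p ^ j * y) \<longlonglongrightarrow> half_theta p y"
        unfolding half_theta_def by (rule convergent_prod_LIMSEQ[OF half_theta_convergent[OF assms]])
      then have "(\<lambda>N. \<Prod>j<Suc N. 1 - p ^ j * y) \<longlonglongrightarrow> half_theta p y"
        by (simp only: lessThan_Suc_atMost)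
      then have "(\<lambda>N. \<Prod>j<N. 1 - p ^ j * y) \<longlonglongrightarrow> half_theta p y"
        by (rule LIMSEQ_imp_Suc)
      ultimately show ?thesis by (rule LIMSEQ_unique)
    qed
    then show "uniform_limit (cball x 1) (\<lambda>N x. \<Prod>j<N. 1 - p ^ j * x) (half_theta p) sequentially"
      using l by (subst uniform_limit_cong'[where g = "\<lambda>N y. \<Prod>j<N. 1 - p ^ j * y" and i = l]) auto
  qed simp_all
qed (auto intro!: holomorphic_intros)

lemma theta_half_theta:
  assumes "norm p < 1"
  shows "theta x p = half_theta p x * half_theta p (p / x)"
proof -
  have "half_theta p (p / x) = (\<Prod>j. 1 - p ^ Suc j / x)"
    unfolding half_theta_def by (intro prodinf_cong) (simp add: mult_ac)
  moreover have "convergent_prod (\<lambda>j. 1 - p ^ Suc j / x)"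
    using half_theta_convergent[OF assms, of "p / x"] by (simp add: mult_ac)
  ultimately show ?thesis
    unfolding theta_def half_theta_def[of p x]
    using prodinf_mult[OF half_theta_convergent[OF assms]] by metis
qed

text \<open>With 1 - x split off, the remaining factor is invariant under x -> 1 / x. The oddness of
  \<open>odd_theta\<close> and its holomorphy follow from this form, also for p = 0.\<close>

lemma theta_factor:
  assumes "norm p < 1"
  shows "theta x p = (1 - x) * (half_theta p (p * x) * half_theta p (p / x))"
  unfolding theta_half_theta[OF assms] half_theta_rec[OF assms, of x] by (simp only: mult.assoc)

lemma theta_shift:
  assumes "norm p < 1" "p \<noteq> 0" "x \<noteq> 0"
  shows "theta (p * x) p = - theta x p / x"
proof -
  have "theta (p * x) p = half_theta p (p * x) * half_theta p (1 / x)"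
    using theta_half_theta[OF assms(1), of "p * x"] assms by simp
  also have "half_theta p (1 / x) = (1 - 1 / x) * half_theta p (p / x)"
    using half_theta_rec[OF assms(1), of "1 / x"] by simp
  finally show ?thesis unfolding theta_factor[OF assms(1), of x] using assms(3) by (simp add: field_simps)
qed

lemma theta_eq_0D:
  assumes "norm p < 1" "x \<noteq> 0" "theta x p = 0"
  shows "\<exists>m::int. x = p powi m"
proof -
  consider j where "p ^ j * x = 1" | j where "p ^ j * (p / x) = 1"
    using assms half_theta_eq_0_iff[OF assms(1)] unfolding theta_half_theta[OF assms(1)] by auto
  then show ?thesis
  proof cases
    case 1
    then have "x = inverse (p ^ j)" using inverse_unique by metis
    also have "\<dots> = p powi (- int j)" by (simp add: power_int_minus)
    finally show ?thesis by blast
  next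
    case 2
    then have "x = p powi (int (Suc j))" using assms(2) by (simp add: field_simps del: of_nat_Suc)
    then show ?thesis by blast
  qed
qed

text \<open>The factor exp (- u) symmetrises 1 - exp (2 u) to exp (- u) - exp u.\<close>

definition odd_theta :: "complex \<Rightarrow> complex \<Rightarrow> complex" where
  "odd_theta p u = exp (- u) * theta (exp (2 * u)) p"

lemma odd_theta_factor:
  assumes "norm p < 1"
  shows "odd_theta p u = (exp (- u) - exp u) * (half_theta p (p * exp (2 * u)) * half_theta p (p * exp (- (2 * u))))"
proof -
  have "exp (- u) * (1 - exp (2 * u)) = exp (- u) - exp u"
    by (simp add: right_diff_distrib exp_add[symmetric])
  moreover have "p / exp (2 * u) = p * exp (- (2 * u))" by (simp add: exp_minus divide_inverse)
  ultimately show ?thesis unfolding odd_theta_def theta_factor[OF assms] by (simp only: mult.assoc[symmetric])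
qed

lemma odd_theta_odd: "norm p < 1 \<Longrightarrow> odd_theta p (- u) = - odd_theta p u"
  unfolding odd_theta_factor by (simp add: algebra_simps)

lemma odd_theta_holomorphic: "norm p < 1 \<Longrightarrow> odd_theta p holomorphic_on UNIV"
proof -
  assume p: "norm p < 1"
  have comp: "(\<lambda>u. half_theta p (f u)) holomorphic_on UNIV" if "f holomorphic_on UNIV" for f
    using holomorphic_on_compose_gen[OF that half_theta_holomorphic[OF p]] by (simp add: o_def)
  have "(\<lambda>u. (exp (- u) - exp u) * (half_theta p (p * exp (2 * u)) * half_theta p (p * exp (- (2 * u))))) holomorphic_on UNIV"
    by (intro holomorphic_intros comp)
  then show ?thesis using odd_theta_factor[OF p] by presburger
qed

lemma odd_theta_period: "odd_theta p (u + pi * \<i>) = - odd_theta p u"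
proof -
  have "exp (2 * (u + pi * \<i>)) = exp (2 * u)" using exp_plus_2pin[of "2 * u" 1] by (simp add: algebra_simps)
  moreover have "exp (- (u + pi * \<i>)) = - exp (- u)"
    by (simp add: exp_add exp_diff exp_minus field_simps)
  ultimately show ?thesis by (simp add: odd_theta_def)
qed

lemma odd_theta_quasi_period:
  assumes "norm p < 1" "p = exp (2 * t)"
  shows "odd_theta p (u + t) = - exp (- (2 * u) - t) * odd_theta p u"
proof -
  have "exp (2 * (u + t)) = p * exp (2 * u)" by (simp add: assms(2) exp_add[symmetric] algebra_simps)
  then have "theta (exp (2 * (u + t))) p = - theta (exp (2 * u)) p / exp (2 * u)"
    using theta_shift[OF assms(1), of "exp (2 * u)"] assms(2) by simp
  then have "odd_theta p (u + t) = - (exp (- (u + t)) * exp (- (2 * u))) * theta (exp (2 * u)) p"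
    by (simp add: odd_theta_def exp_minus divide_inverse)
  also have "exp (- (u + t)) * exp (- (2 * u)) = exp (- (2 * u) - t) * exp (- u)"
    by (simp add: exp_add[symmetric])
  finally show ?thesis by (simp add: odd_theta_def)
qed

lemma odd_theta_countable_zeros:
  assumes "norm p < 1"
  shows "countable {u. odd_theta p u = 0}"
proof (rule countable_subset)
  let ?E = "\<lambda>m::int. {u. exp (2 * u) = p powi m}"
  show "{u. odd_theta p u = 0} \<subseteq> (\<Union>m. ?E m)"
    using theta_eq_0D[OF assms, of "exp (2 * _)"] by (auto simp: odd_theta_def)
  have "countable (?E m)" for m
  proof (cases "\<exists>v. exp (2 * v) = p powi m")
    case True
    then obtain v where v: "exp (2 * v) = p powi m" by blast
    have "?E m \<subseteq> range (\<lambda>n::int. v + of_int n * pi * \<i>)"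
    proof
      fix u assume "u \<in> ?E m"
      then have "exp (2 * u) = exp (2 * v)" using v by simp
      then obtain n :: int where "2 * u = 2 * v + (of_int (2 * n) * pi) * \<i>" by (auto simp: exp_eq)
      then have "2 * u = 2 * (v + of_int n * pi * \<i>)" by (simp add: algebra_simps)
      then have "u = v + of_int n * pi * \<i>" by (simp only: mult_cancel_left) simp
      then show "u \<in> range (\<lambda>n::int. v + of_int n * pi * \<i>)" by blast
    qed
    then show ?thesis by (rule countable_subset) simp
  qed auto
  then show "countable (\<Union>m. ?E m)" by simp
qed

section \<open>Zeros, elliptic quotients and the three-term relation\<close>

lemma odd_theta_zero_cases:
  assumes "norm p < 1" "p = exp (2 * t)" "odd_theta p u = 0"
  obtains m n :: int where "u = of_int m * t + of_int n * (pi * \<i>)"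
proof -
  have "theta (exp (2 * u)) p = 0" using assms(3) by (simp add: odd_theta_def)
  then obtain m :: int where "exp (2 * u) = p powi m" using theta_eq_0D[OF assms(1) exp_not_eq_zero] by blast
  also have "\<dots> = exp (2 * (of_int m * t))"
    unfolding assms(2) by (simp add: exp_power_int mult_ac)
  finally obtain n :: int where "2 * u = 2 * (of_int m * t) + (of_int (2 * n) * pi) * \<i>" by (auto simp: exp_eq)
  then have "2 * u = 2 * (of_int m * t + of_int n * (pi * \<i>))" by (simp add: algebra_simps)
  then have "u = of_int m * t + of_int n * (pi * \<i>)" by (simp only: mult_cancel_left) simp
  then show thesis by (rule that)
qed

text \<open>The value type is arbitrary because the statement is also applied to predicates, such as
  the vanishing of a quasi-periodic function.\<close>

lemma lattice_periodic:
  fixes f :: "complex \<Rightarrow> 'a"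
  assumes "\<And>x. f (x + a) = f x" "\<And>x. f (x + b) = f x"
  shows "f (x + of_int m * a + of_int n * b) = f x"
proof -
  have shift: "g (x + of_int m * d) = g x" if "\<And>x. g (x + d) = g x"
    for g :: "complex \<Rightarrow> 'a" and d x and m :: int
  proof (induction m rule: int_induct[where k = 0])
    case base then show ?case by simp
  next
    case (step1 i)
    have "x + of_int (i + 1) * d = x + of_int i * d + d" by (simp add: algebra_simps)
    then have "g (x + of_int (i + 1) * d) = g (x + of_int i * d + d)" by (simp only:)
    then show ?case using step1(2) that by (simp only:)
  next
    case (step2 i)
    have "x + of_int i * d = x + of_int (i - 1) * d + d" by (simp add: algebra_simps)
    then have "g (x + of_int i * d) = g (x + of_int (i - 1) * d + d)" by (simp only:)
    then show ?case using step2(2) that by (simp only:)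
  qed
  show ?thesis by (simp only: shift[where g = f and d = a, OF assms(1)] shift[where g = f and d = b, OF assms(2)])
qed

text \<open>At a zero of g the quotient tends to deriv f / deriv g, so the prescribed value removes
  the singularity.\<close>

lemma holomorphic_quotient_simple_zeros:
  assumes f: "f holomorphic_on UNIV" and g: "g holomorphic_on UNIV"
    and zeros: "\<And>z. g z = 0 \<Longrightarrow> f z = 0 \<and> deriv g z \<noteq> 0"
  shows "(\<lambda>z. if g z = 0 then deriv f z / deriv g z else f z / g z) holomorphic_on UNIV" (is "?h holomorphic_on _")
proof -
  have "\<exists>U. open U \<and> z \<in> U \<and> ?h holomorphic_on U" for z
  proof (cases "g z = 0")
    case False
    let ?U = "- (g -` {0})"
    have "closed (g -` {0})"
      using g by (intro closed_vimage holomorphic_on_imp_continuous_on) auto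
    then have op: "open ?U" by (rule open_Compl)
    have "(\<lambda>z. f z / g z) holomorphic_on ?U"
      by (intro holomorphic_intros holomorphic_on_subset[OF f] holomorphic_on_subset[OF g]) auto
    then have "?h holomorphic_on ?U" by (rule holomorphic_transform) auto
    then show ?thesis using op False by blast
  next
    case True
    then have fz: "f z = 0" and g': "deriv g z \<noteq> 0" using zeros by auto
    have df: "(f has_field_derivative deriv f z) (at z)" and dg: "(g has_field_derivative deriv g z) (at z)"
      using f g by (auto intro: holomorphic_derivI)
    have lf: "((\<lambda>y. f y / (y - z)) \<longlongrightarrow> deriv f z) (at z)"
      using df fz by (simp add: has_field_derivative_iff)
    have lg: "((\<lambda>y. g y / (y - z)) \<longlongrightarrow> deriv g z) (at z)"
      using dg True by (simp add: has_field_derivative_iff)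
    have "eventually (\<lambda>y. g y / (y - z) \<noteq> 0) (at z)"
      using lg g' by (rule tendsto_imp_eventually_ne)
    then have "eventually (\<lambda>y. g y \<noteq> 0) (at z)" by (rule eventually_mono) auto
    then obtain e where e: "e > 0" "\<And>y. y \<in> ball z e \<Longrightarrow> y \<noteq> z \<Longrightarrow> g y \<noteq> 0"
      unfolding eventually_at by (auto simp: dist_commute)
    have "?h holomorphic_on ball z e"
    proof (rule no_isolated_singularity')
      show "finite {z}" by simp
      have "(\<lambda>y. f y / g y) holomorphic_on ball z e - {z}"
        by (intro holomorphic_intros holomorphic_on_subset[OF f] holomorphic_on_subset[OF g]) (use e in auto)
      then show "?h holomorphic_on ball z e - {z}"
        by (rule holomorphic_transform) (use e in auto)
      fix y assume "y \<in> {z}"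
      then have y: "y = z" by simp
      have "((\<lambda>y. (f y / (y - z)) / (g y / (y - z))) \<longlongrightarrow> deriv f z / deriv g z) (at z)"
        by (intro tendsto_divide lf lg g')
      then have "(?h \<longlongrightarrow> deriv f z / deriv g z) (at z)"
      proof (rule Lim_transform_eventually)
        show "eventually (\<lambda>y. (f y / (y - z)) / (g y / (y - z)) = ?h y) (at z)"
          unfolding eventually_at using e by (intro exI[of _ e]) (auto simp: dist_commute)
      qed
      then show "(?h \<longlongrightarrow> ?h y) (at y within ball z e)"
        unfolding y using True by (auto intro: tendsto_within_subset)
    qed simp
    then show ?thesis using e(1) by (intro exI[of _ "ball z e"]) auto
  qed
  then have "?h analytic_on UNIV"
    unfolding analytic_on_def by (meson holomorphic_on_subset open_contains_ball)
  then show ?thesis by (rule analytic_imp_holomorphic)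
qed

text \<open>Continuity bounds h on a compact period parallelogram, the periodicity of q spreads the
  bound over all points that are not bad, and continuity of h extends it to the bad ones. Re t < 0
  makes t and pi \<i> linearly independent over the reals.\<close>

lemma elliptic_bounded:
  fixes h :: "complex \<Rightarrow> complex"
  assumes h: "continuous_on UNIV h" and per: "\<And>x. q (x + t) = q x" "\<And>x. q (x + pi * \<i>) = q x"
    and t: "Re t < 0" and eq: "\<And>x. \<not> bad x \<Longrightarrow> h x = q x" and bad: "countable {x. bad x}"
    and bad_per: "\<And>x. bad (x + t) = bad x" "\<And>x. bad (x + pi * \<i>) = bad x"
  shows "bounded (range h)"
proof -
  let ?K = "(\<lambda>(a, b). of_real a * t + of_real b * (pi * \<i>)) ` ({0..1} \<times> {0..1})"
  have "compact ?K"
    by (intro compact_continuous_image compact_Times compact_Icc)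
      (auto simp: case_prod_unfold intro!: continuous_intros)
  then have "compact (h ` ?K)"
    by (rule compact_continuous_image[OF continuous_on_subset[OF h subset_UNIV]])
  then have "bounded (h ` ?K)" by (rule compact_imp_bounded)
  then obtain M where "\<And>y. y \<in> h ` ?K \<Longrightarrow> norm y \<le> M" unfolding bounded_iff by blast
  then have M: "norm (h x) \<le> M" if "x \<in> ?K" for x using imageI[OF that, of h] by blast
  have le: "norm (h x) \<le> M" if nb: "\<not> bad x" for x
  proof -
    \<comment> \<open>Real coordinates of x with respect to t and pi \<i>; as pi \<i> has real part
      0, the first is read off from Re x.\<close>
    define a where "a = Re x / Re t"
    define b where "b = (Im x - a * Im t) / pi"
    have x: "x = of_real a * t + of_real b * (pi * \<i>)"
      using t by (intro complex_eqI) (simp_all add: a_def b_def)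
    define x' where "x' = of_real (frac a) * t + of_real (frac b) * (pi * \<i>)"
    have xx': "x = x' + of_int \<lfloor>a\<rfloor> * t + of_int \<lfloor>b\<rfloor> * (pi * \<i>)"
      unfolding x x'_def by (simp add: frac_def algebra_simps)
    have "x' \<in> ?K" unfolding x'_def
      by (rule image_eqI[of _ _ "(frac a, frac b)"]) (auto simp: frac_ge_0 less_imp_le[OF frac_lt_1])
    moreover have "bad x = bad x'" unfolding xx' by (rule lattice_periodic[OF bad_per])
    moreover have "q x = q x'" unfolding xx' by (rule lattice_periodic[OF per])
    ultimately show ?thesis using M[of x'] eq[OF nb] eq[of x'] nb by simp
  qed
  have "norm (h x) \<le> M" for x
  proof -
    define G where "G x = complex_of_real (max 0 (norm (h x) - M))" for x
    have "isCont G x"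
      unfolding G_def using h by (intro continuous_intros) (simp add: continuous_on_eq_continuous_at)
    moreover have "{x. G x \<noteq> 0} \<subseteq> {x. bad x}" using le by (fastforce simp: G_def)
    then have "countable {x. G x \<noteq> 0}" using bad countable_subset by blast
    ultimately have "G x = 0" by (rule isCont_zero_off_countable)
    then show ?thesis by (simp add: G_def)
  qed
  then show ?thesis unfolding bounded_iff by blast
qed

lemma odd_theta_0 [simp]: "norm p < 1 \<Longrightarrow> odd_theta p 0 = 0"
  using odd_theta_odd[of p 0] by simp

text \<open>All zeros are lattice points m t + n pi \<i>. At 0 the factor exp (- x) - exp x gives
  the derivative -2 E 0, which is nonzero, and simplicity of the zero is carried along by both
  periods.\<close>

lemma odd_theta_deriv:
  assumes p: "norm p < 1" "p = exp (2 * t)" and z: "odd_theta p u = 0"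
  shows "deriv (odd_theta p) u \<noteq> 0"
proof -
  define E where "E x = half_theta p (p * exp (2 * x)) * half_theta p (p * exp (- (2 * x)))" for x
  have hp: "half_theta p p \<noteq> 0"
  proof
    assume "half_theta p p = 0"
    then obtain j where "p ^ Suc j = 1" using half_theta_eq_0_iff[OF p(1)] by (auto simp: mult.commute)
    then have "norm p ^ Suc j = 1" by (metis norm_one norm_power)
    moreover have "norm p ^ Suc j < 1" using p(1) by (intro power_Suc_less_one) (auto simp: p(2))
    ultimately show False by simp
  qed
  have E_hol: "E holomorphic_on UNIV"
  proof -
    have comp: "(\<lambda>u. half_theta p (f u)) holomorphic_on UNIV" if "f holomorphic_on UNIV" for f
      using holomorphic_on_compose_gen[OF that half_theta_holomorphic[OF p(1)]] by (simp add: o_def)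
    show ?thesis unfolding E_def by (intro holomorphic_intros comp)
  qed
  have "(E has_field_derivative deriv E 0) (at 0)" using E_hol by (auto intro: holomorphic_derivI)
  then have "((\<lambda>x. (exp (- x) - exp x) * E x) has_field_derivative - 2 * E 0) (at 0)"
    by (auto intro!: derivative_eq_intros)
  moreover have "odd_theta p = (\<lambda>x. (exp (- x) - exp x) * E x)"
    by (intro ext) (simp only: odd_theta_factor[OF p(1)] E_def)
  ultimately have d0: "(odd_theta p has_field_derivative - 2 * E 0) (at 0)" by (simp only:)
  have E0: "E 0 \<noteq> 0" using hp by (simp add: E_def)
  have step1: "deriv (odd_theta p) (x + pi * \<i>) = - deriv (odd_theta p) x" for x
  proof -
    have dx: "(odd_theta p has_field_derivative deriv (odd_theta p) y) (at y)" for y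
      using odd_theta_holomorphic[OF p(1)] by (auto intro: holomorphic_derivI)
    have "((\<lambda>y. odd_theta p (y + pi * \<i>)) has_field_derivative deriv (odd_theta p) (x + pi * \<i>)) (at x)"
      using dx[of "x + pi * \<i>"] by (simp add: DERIV_shift)
    moreover have "((\<lambda>y. - odd_theta p y) has_field_derivative - deriv (odd_theta p) x) (at x)"
      by (intro DERIV_minus dx)
    ultimately show ?thesis unfolding odd_theta_period by (rule DERIV_unique)
  qed
  \<comment> \<open>Differentiating the quasi-periodicity produces an extra multiple of
    \<open>odd_theta p x\<close>; the condition that x is a zero removes it.\<close>
  have step2: "(odd_theta p x = 0 \<and> deriv (odd_theta p) (x + t) \<noteq> 0) = (odd_theta p x = 0 \<and> deriv (odd_theta p) x \<noteq> 0)" for x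
  proof -
    have dx: "(odd_theta p has_field_derivative deriv (odd_theta p) y) (at y)" for y
      using odd_theta_holomorphic[OF p(1)] by (auto intro: holomorphic_derivI)
    have "((\<lambda>y. odd_theta p (y + t)) has_field_derivative deriv (odd_theta p) (x + t)) (at x)"
      using dx[of "x + t"] by (simp add: DERIV_shift)
    moreover have "((\<lambda>y. - exp (- (2 * y) - t) * odd_theta p y) has_field_derivative
        (2 * exp (- (2 * x) - t) * odd_theta p x + - exp (- (2 * x) - t) * deriv (odd_theta p) x)) (at x)"
      by (rule derivative_eq_intros dx refl | simp)+
    ultimately have "deriv (odd_theta p) (x + t) = 2 * exp (- (2 * x) - t) * odd_theta p x + - exp (- (2 * x) - t) * deriv (odd_theta p) x"
      unfolding odd_theta_quasi_period[OF p] by (rule DERIV_unique)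
    then show ?thesis by auto
  qed
  obtain m n :: int where u: "u = of_int m * t + of_int n * (pi * \<i>)" using odd_theta_zero_cases[OF p z] by blast
  let ?P = "\<lambda>x. odd_theta p x = 0 \<and> deriv (odd_theta p) x \<noteq> 0"
  have "?P (0 + of_int m * t + of_int n * (pi * \<i>)) = ?P 0"
  proof (rule lattice_periodic)
    show "?P (x + t) = ?P x" for x using step2[of x] by (simp add: odd_theta_quasi_period[OF p])
    show "?P (x + pi * \<i>) = ?P x" for x by (simp add: odd_theta_period step1)
  qed
  moreover have "?P 0" using E0 DERIV_imp_deriv[OF d0] p(1) by simp
  ultimately show ?thesis using u by simp
qed

text \<open>As functions of x, the difference f of the two sides and g = s x u have the same
  quasi-periods, and f vanishes at the zeros of g. The hypothesis on 2 u makes these zeros simple,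
  so f / g extends to a bounded entire function and is constant by Liouville. At x = v, where f = 0
  and g \<noteq> 0 by the two other hypotheses, the constant is seen to be 0.\<close>

lemma odd_theta_three_term_generic:
  fixes y u v :: complex
  assumes p: "norm p < 1" "p \<noteq> 0" and gen: "odd_theta p (2 * u) \<noteq> 0" "odd_theta p (u + v) \<noteq> 0" "odd_theta p (u - v) \<noteq> 0"
  defines "s \<equiv> \<lambda>a b. odd_theta p (a + b) * odd_theta p (a - b)"
  shows "s x y * s u v - s x v * s u y = s x u * s y v"
proof -
  define t where "t = Ln p / 2"
  have pt: "p = exp (2 * t)" using p(2) by (simp add: t_def)
  have "norm p = exp (Re (2 * t))" unfolding pt by simp
  then have Ret: "Re t < 0" using p(1) by simp
  have per1: "s (x + pi * \<i>) y = s x y" for x y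
  proof -
    have "x + pi * \<i> + y = x + y + pi * \<i>" "x + pi * \<i> - y = x - y + pi * \<i>" by simp_all
    then show ?thesis unfolding s_def by (simp only: odd_theta_period) simp
  qed
  have per2: "s (x + t) y = exp (- 4 * x - 2 * t) * s x y" for x y
  proof -
    have "x + t + y = x + y + t" "x + t - y = x - y + t" by simp_all
    then have "s (x + t) y = (exp (- (2 * (x + y)) - t) * exp (- (2 * (x - y)) - t)) * s x y"
      unfolding s_def by (simp only: odd_theta_quasi_period[OF p(1) pt]) simp
    also have "exp (- (2 * (x + y)) - t) * exp (- (2 * (x - y)) - t) = exp (- 4 * x - 2 * t)"
    proof -
      have "- (2 * (x + y)) - t + (- (2 * (x - y)) - t) = - 4 * x - 2 * t" by simp
      then show ?thesis by (simp only: exp_add[symmetric])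
    qed
    finally show ?thesis .
  qed
  have swap: "s x y = - s y x" for x y
    using odd_theta_odd[OF p(1), of "x - y"] by (simp add: s_def add.commute)
  have even: "s (- x) y = s x y" for x y
    using odd_theta_odd[OF p(1), of "x - y"] odd_theta_odd[OF p(1), of "x + y"] by (simp add: s_def algebra_simps)
  have self: "s x x = 0" for x using p(1) by (simp add: s_def)
  define f where "f x = s x y * s u v - s x v * s u y - s x u * s y v" for x
  define g where "g x = s x u" for x
  have comp: "(\<lambda>x. odd_theta p (k x)) holomorphic_on UNIV" if "k holomorphic_on UNIV" for k
    using holomorphic_on_compose_gen[OF that odd_theta_holomorphic[OF p(1)]] by (simp add: o_def)
  have s_hol: "(\<lambda>x. s x a) holomorphic_on UNIV" for a
    unfolding s_def by (intro holomorphic_intros comp)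
  have f_hol: "f holomorphic_on UNIV" unfolding f_def by (intro holomorphic_intros s_hol)
  have g_hol: "g holomorphic_on UNIV" unfolding g_def by (rule s_hol)
  have f_per: "f (x + pi * \<i>) = f x" "f (x + t) = exp (- 4 * x - 2 * t) * f x" for x
    unfolding f_def per1 per2 by (simp_all add: algebra_simps)
  have g_per: "g (x + pi * \<i>) = g x" "g (x + t) = exp (- 4 * x - 2 * t) * g x" for x
    unfolding g_def per1 per2 by simp_all
  have fu: "f u = 0" using swap[of v y] by (simp add: f_def self mult.commute)
  have odd_theta_zero_shift: "(odd_theta p (x + of_int m * t + of_int n * (pi * \<i>)) = 0) = (odd_theta p x = 0)" for x and m n :: int
    by (rule lattice_periodic) (simp_all add: odd_theta_period odd_theta_quasi_period[OF p(1) pt])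
  have f_zero_shift: "(f (x + of_int m * t + of_int n * (pi * \<i>)) = 0) = (f x = 0)" for x and m n :: int
    by (rule lattice_periodic) (simp_all add: f_per)
  have zeros: "f x = 0 \<and> deriv g x \<noteq> 0" if gx: "g x = 0" for x
  proof -
    have d: "deriv g x = deriv (odd_theta p) (x + u) * odd_theta p (x - u) + odd_theta p (x + u) * deriv (odd_theta p) (x - u)"
    proof (rule DERIV_imp_deriv)
      have dS: "(odd_theta p has_field_derivative deriv (odd_theta p) y) (at y)" for y
        using odd_theta_holomorphic[OF p(1)] by (auto intro: holomorphic_derivI)
      have "((\<lambda>x. odd_theta p (x + u)) has_field_derivative deriv (odd_theta p) (x + u)) (at x)"
        using dS[of "x + u"] by (simp add: DERIV_shift)
      moreover have "((\<lambda>x. odd_theta p (x - u)) has_field_derivative deriv (odd_theta p) (x - u)) (at x)"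
        using dS[of "x + - u"] unfolding DERIV_shift by simp
      ultimately show "(g has_field_derivative deriv (odd_theta p) (x + u) * odd_theta p (x - u) + odd_theta p (x + u) * deriv (odd_theta p) (x - u)) (at x)"
        unfolding g_def s_def by (auto intro!: derivative_eq_intros)
    qed
    have u2: "odd_theta p (2 * u) \<noteq> 0" "odd_theta p (- (2 * u)) \<noteq> 0" using gen(1) odd_theta_odd[OF p(1), of "2 * u"] by auto
    from gx consider "odd_theta p (x + u) = 0" | "odd_theta p (x - u) = 0" by (auto simp: g_def s_def)
    then show ?thesis
    proof cases
      case 1
      then obtain m n :: int where "x + u = of_int m * t + of_int n * (pi * \<i>)"
        using odd_theta_zero_cases[OF p(1) pt] by blast
      then have x: "x = - u + of_int m * t + of_int n * (pi * \<i>)" by (simp add: algebra_simps)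
      have "f (- u) = f u" unfolding f_def even ..
      then have "f x = 0" unfolding x f_zero_shift using fu by simp
      moreover have "x - u = - (2 * u) + of_int m * t + of_int n * (pi * \<i>)" by (simp add: x)
      then have "odd_theta p (x - u) \<noteq> 0" using odd_theta_zero_shift[of "- (2 * u)" m n] u2 by (simp only:) simp
      ultimately show ?thesis using odd_theta_deriv[OF p(1) pt 1] 1 by (simp add: d)
    next
      case 2
      then obtain m n :: int where "x - u = of_int m * t + of_int n * (pi * \<i>)"
        using odd_theta_zero_cases[OF p(1) pt] by blast
      then have x: "x = u + of_int m * t + of_int n * (pi * \<i>)" by (simp add: algebra_simps)
      have "f x = 0" unfolding x f_zero_shift using fu by simp
      moreover have "x + u = 2 * u + of_int m * t + of_int n * (pi * \<i>)" by (simp add: x)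
      then have "odd_theta p (x + u) \<noteq> 0" using odd_theta_zero_shift[of "2 * u" m n] u2 by (simp only:) simp
      ultimately show ?thesis using odd_theta_deriv[OF p(1) pt 2] 2 by (simp add: d)
    qed
  qed
  let ?h = "\<lambda>z. if g z = 0 then deriv f z / deriv g z else f z / g z"
  have h_hol: "?h holomorphic_on UNIV"
    by (rule holomorphic_quotient_simple_zeros[OF f_hol g_hol zeros])
  have "countable {x. g x = 0}"
  proof (rule countable_subset)
    show "{x. g x = 0} \<subseteq> (\<lambda>x. x - u) ` {x. odd_theta p x = 0} \<union> (\<lambda>x. x + u) ` {x. odd_theta p x = 0}"
    proof
      fix x assume "x \<in> {x. g x = 0}"
      then have "x + u \<in> {x. odd_theta p x = 0} \<or> x - u \<in> {x. odd_theta p x = 0}" by (auto simp: g_def s_def)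
      then show "x \<in> (\<lambda>x. x - u) ` {x. odd_theta p x = 0} \<union> (\<lambda>x. x + u) ` {x. odd_theta p x = 0}"
      proof
        assume "x + u \<in> {x. odd_theta p x = 0}"
        then show ?thesis by (intro UnI1 image_eqI[of _ _ "x + u"]) simp
      next
        assume "x - u \<in> {x. odd_theta p x = 0}"
        then show ?thesis by (intro UnI2 image_eqI[of _ _ "x - u"]) simp
      qed
    qed
    show "countable ((\<lambda>x. x - u) ` {x. odd_theta p x = 0} \<union> (\<lambda>x. x + u) ` {x. odd_theta p x = 0})"
      using odd_theta_countable_zeros[OF p(1)] by simp
  qed
  then have "bounded (range ?h)"
    by (intro elliptic_bounded[where q = "\<lambda>x. f x / g x" and t = t and bad = "\<lambda>x. g x = 0"]
        holomorphic_on_imp_continuous_on[OF h_hol]) (auto simp: f_per g_per Ret)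
  then obtain C where C: "\<And>x. ?h x = C"
    using Liouville_theorem[OF h_hol] by (auto simp: constant_on_def)
  have fg: "f x = C * g x" for x
    using C[of x] zeros[of x] by (auto split: if_splits)
  have "f v = 0" unfolding f_def using swap[of v u] swap[of y v] by (simp add: self)
  moreover have "g v \<noteq> 0"
  proof -
    have "s u v \<noteq> 0" using gen by (simp add: s_def)
    then show ?thesis using swap[of v u] by (simp add: g_def)
  qed
  ultimately have "C = 0" using fg[of v] by simp
  then have "f x = 0" using fg by simp
  then show ?thesis by (simp add: f_def)
qed

lemma odd_theta_isCont: "norm p < 1 \<Longrightarrow> isCont f a \<Longrightarrow> isCont (\<lambda>x. odd_theta p (f x)) a"
proof -
  assume p: "norm p < 1" and f: "isCont f a"
  have "continuous_on UNIV (odd_theta p)" by (rule holomorphic_on_imp_continuous_on[OF odd_theta_holomorphic[OF p]])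
  then have "isCont (odd_theta p) (f a)" by (simp add: continuous_on_eq_continuous_at)
  then show ?thesis by (rule isCont_o2[OF f])
qed

text \<open>For p = 0 there is no second period; there each product is a difference of values of exp
  (2 a) + exp (- (2 a)), and the relation is plain algebra. For p \<noteq> 0 the restrictions on u
  are removed by continuity.\<close>

theorem odd_theta_three_term:
  assumes p: "norm p < 1"
  shows "odd_theta p (x + y) * odd_theta p (x - y) * (odd_theta p (u + v) * odd_theta p (u - v))
      - odd_theta p (x + v) * odd_theta p (x - v) * (odd_theta p (u + y) * odd_theta p (u - y))
      = odd_theta p (x + u) * odd_theta p (x - u) * (odd_theta p (y + v) * odd_theta p (y - v))"
proof (cases "p = 0")
  case True
  have "half_theta 0 0 = 1" by (simp add: half_theta_def)
  then have theta0: "odd_theta p a = exp (- a) - exp a" for a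
    using odd_theta_factor[OF p, of a] by (simp add: True)
  have "odd_theta p (a + b) * odd_theta p (a - b) = (exp (2 * a) + exp (- (2 * a))) - (exp (2 * b) + exp (- (2 * b)))" for a b
  proof -
    have "odd_theta p (a + b) * odd_theta p (a - b)
        = exp (- (a + b)) * exp (- (a - b)) - exp (- (a + b)) * exp (a - b)
          - exp (a + b) * exp (- (a - b)) + exp (a + b) * exp (a - b)"
      unfolding theta0 by (simp add: algebra_simps)
    also have "\<dots> = exp (- (2 * a)) - exp (- (2 * b)) - exp (2 * b) + exp (2 * a)"
      unfolding exp_add[symmetric] by (simp add: algebra_simps)
    finally show ?thesis by simp
  qed
  then show ?thesis by (simp only:) (simp add: algebra_simps)
next
  case False
  define G where "G u = odd_theta p (x + y) * odd_theta p (x - y) * (odd_theta p (u + v) * odd_theta p (u - v))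
      - odd_theta p (x + v) * odd_theta p (x - v) * (odd_theta p (u + y) * odd_theta p (u - y))
      - odd_theta p (x + u) * odd_theta p (x - u) * (odd_theta p (y + v) * odd_theta p (y - v))" for u
  have "isCont G u"
    unfolding G_def by (intro isCont_diff isCont_mult isCont_add odd_theta_isCont[OF p] continuous_const continuous_ident)
  moreover have "countable {u. G u \<noteq> 0}"
  proof (rule countable_subset)
    let ?Z = "{x. odd_theta p x = 0}"
    show "{u. G u \<noteq> 0} \<subseteq> (\<lambda>x. x / 2) ` ?Z \<union> (\<lambda>x. x - v) ` ?Z \<union> (\<lambda>x. x + v) ` ?Z"
    proof
      fix u assume "u \<in> {u. G u \<noteq> 0}"
      then consider "2 * u \<in> ?Z" | "u + v \<in> ?Z" | "u - v \<in> ?Z"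
        using odd_theta_three_term_generic[OF p False, of u v x y] by (auto simp: G_def)
      then show "u \<in> (\<lambda>x. x / 2) ` ?Z \<union> (\<lambda>x. x - v) ` ?Z \<union> (\<lambda>x. x + v) ` ?Z"
      proof cases
        case 1 then show ?thesis by (intro UnI1 image_eqI[of _ _ "2 * u"]) simp
      next
        case 2 then show ?thesis by (intro UnI1 UnI2 image_eqI[of _ _ "u + v"]) simp
      next
        case 3 then show ?thesis by (intro UnI2 image_eqI[of _ _ "u - v"]) simp
      qed
    qed
    show "countable ((\<lambda>x. x / 2) ` ?Z \<union> (\<lambda>x. x - v) ` ?Z \<union> (\<lambda>x. x + v) ` ?Z)"
      using odd_theta_countable_zeros[OF p] by simp
  qed
  ultimately have "G u = 0" by (rule isCont_zero_off_countable)
  then show ?thesis by (simp add: G_def)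
qed

theorem odd_sigma_odd_theta:
  assumes "norm p < 1"
  shows "odd_sigma (odd_theta p)"
proof
  show "odd_theta p (- x) = - odd_theta p x" for x by (rule odd_theta_odd[OF assms])
  show "continuous_on UNIV (odd_theta p)" by (rule holomorphic_on_imp_continuous_on[OF odd_theta_holomorphic[OF assms]])
  show "countable {x. odd_theta p x = 0}" by (rule odd_theta_countable_zeros[OF assms])
qed (rule odd_theta_three_term[OF assms])

section \<open>The cubic summation formula\<close>

text \<open>The sum of the arguments of the k factors of a run: each factor of \<open>theta\<close>
  contributes the exponential of its argument.\<close>

definition run_exp :: "complex \<Rightarrow> int \<Rightarrow> int \<Rightarrow> nat \<Rightarrow> complex \<Rightarrow> complex" where
  "run_exp \<zeta> d a k u = of_nat k * (u + of_int a * \<zeta>) + of_int d * \<zeta> * (of_nat k * (of_nat k - 1)) / 2"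

lemma theta_odd_theta: "theta (exp (2 * u)) p = exp u * odd_theta p u"
  by (simp add: odd_theta_def exp_minus)

lemma ell_poch_run:
  assumes "y = exp (2 * (u + of_int a * \<zeta>))" "Q = exp (2 * of_int d * \<zeta>)"
  shows "ell_poch y Q p k = exp (run_exp \<zeta> d a k u) * sigma_run (odd_theta p) \<zeta> d a k u"
proof (induction k)
  case 0 then show ?case by (simp add: ell_poch_def sigma_run_def run_exp_def)
next
  case (Suc k)
  let ?v = "u + of_int (a + d * int k) * \<zeta>"
  have "y * Q ^ k = exp (2 * ?v)"
    unfolding assms exp_of_nat_mult[symmetric] exp_add[symmetric] by (simp add: algebra_simps)
  then have "theta (y * Q ^ k) p = exp ?v * odd_theta p ?v" by (simp only: theta_odd_theta)
  then have "ell_poch y Q p (Suc k) = exp (run_exp \<zeta> d a k u) * exp ?v * (sigma_run (odd_theta p) \<zeta> d a k u * odd_theta p ?v)"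
    using Suc by (simp add: ell_poch_def)
  also have "exp (run_exp \<zeta> d a k u) * exp ?v = exp (run_exp \<zeta> d a (Suc k) u)"
    unfolding exp_add[symmetric] by (simp add: run_exp_def field_simps)
  finally show ?case by (simp add: sigma_run_def)
qed

lemma upper_distrib: "upper r (\<lambda>i j. f i j * g i j) = upper r f * upper r g"
  for f :: "nat \<Rightarrow> nat \<Rightarrow> complex"
  by (simp add: prod.distrib)

lemma upper_exp: "upper r (\<lambda>i j. exp (f i j)) = exp (\<Sum>i=1..r. \<Sum>j=i+1..r. f i j :: complex)"
  by (simp add: exp_sum)

lemma upper_sum_Suc:
  "(\<Sum>i=1..Suc r. \<Sum>j=i+1..Suc r. f i j) = (\<Sum>i=1..r. \<Sum>j=i+1..r. f i j) + (\<Sum>i=1..r. f i (Suc r))"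
  for f :: "nat \<Rightarrow> nat \<Rightarrow> 'a::comm_monoid_add"
proof -
  have "(\<Sum>i=1..r. \<Sum>j=i+1..Suc r. f i j) = (\<Sum>i=1..r. (\<Sum>j=i+1..r. f i j) + f i (Suc r))"
    by (intro sum.cong refl) simp
  then show ?thesis by (simp add: sum.distrib)
qed

lemma upper_sum_product:
  fixes f g :: "nat \<Rightarrow> complex"
  shows "(\<Sum>i=1..r. \<Sum>j=i+1..r. (f i + f j) * (g i + g j))
    = (of_nat r - 2) * (\<Sum>i=1..r. f i * g i) + (\<Sum>i=1..r. f i) * (\<Sum>i=1..r. g i)"
proof (induction r)
  case (Suc r)
  have "(\<Sum>i=1..r. (f i + f (Suc r)) * (g i + g (Suc r)))
      = (\<Sum>i=1..r. f i * g i) + (\<Sum>i=1..r. f i) * g (Suc r) + f (Suc r) * (\<Sum>i=1..r. g i)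
        + of_nat r * (f (Suc r) * g (Suc r))"
    by (simp add: ring_distribs sum.distrib sum_distrib_left sum_distrib_right)
  then show ?case unfolding upper_sum_Suc Suc by (simp add: algebra_simps)
qed simp

lemma upper_sum_add:
  fixes f :: "nat \<Rightarrow> complex"
  shows "(\<Sum>i=1..r. \<Sum>j=i+1..r. f i + f j) = (of_nat r - 1) * (\<Sum>i=1..r. f i)"
proof (induction r)
  case (Suc r)
  then show ?case unfolding upper_sum_Suc Suc by (simp add: sum.distrib algebra_simps)
qed simp

lemma square_sum_upper:
  fixes f :: "nat \<Rightarrow> complex"
  shows "(\<Sum>i=1..r. f i) * (\<Sum>i=1..r. f i) = (\<Sum>i=1..r. f i * f i) + 2 * (\<Sum>i=1..r. \<Sum>j=i+1..r. f i * f j)"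
proof (induction r)
  case (Suc r)
  have "(\<Sum>i=1..r. f i * f (Suc r)) = (\<Sum>i=1..r. f i) * f (Suc r)" by (simp add: sum_distrib_right)
  then show ?case using Suc unfolding upper_sum_Suc by (simp add: algebra_simps)
qed simp

lemma exponent_single:
  assumes "m \<le> K"
  shows "of_int (2 * int K + 6 * int m) * \<zeta> + run_exp \<zeta> 2 (int N) K u + run_exp \<zeta> 2 (int N + 2) (K - m) (- u)
      - run_exp \<zeta> 2 (int N + 2) K (- w) - run_exp \<zeta> 2 (int N + 2) K w
      - run_exp \<zeta> 2 (2 * int m - 2 * int K - int N) (2 * m) u - run_exp \<zeta> 6 (3 * int N + 6) m u
    = - 2 * (of_nat m * u) + \<zeta> * (2 * (of_nat K * of_nat m) + 4 * of_nat m - 2 * of_nat N * of_nat m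
        - 10 * (of_nat m * of_nat m))"
  using assms by (simp add: run_exp_def of_nat_diff field_simps)

text \<open>Both sides are even in each w i up to these exponentials, so w drops out, and the terms
  in \<xi> balance. The multiples of \<zeta> reduce to the square of |k| being the sum of the
  squares of the k i plus twice \<open>e2\<close>; the power q^(|k| - 2 e2) of the summand is what
  makes this come out as 0.\<close>

lemma exponents_cancel:
  fixes k :: "nat \<Rightarrow> nat" and \<xi> w :: "nat \<Rightarrow> complex" and r :: nat
  defines "K \<equiv> sum k {1..r}"
  shows "(\<Sum>i=1..r. \<Sum>j=i+1..r. of_nat (k i + k j) * (6 * \<zeta>) - run_exp \<zeta> 6 0 (k i + k j) (\<xi> i + \<xi> j))
    + 4 * \<zeta> * (of_nat K - 2 * of_nat (e2 r k))
    + (\<Sum>i=1..r. of_int (2 * int K + 6 * int (k i)) * \<zeta> + run_exp \<zeta> 2 (int N) K (\<xi> i)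
        + run_exp \<zeta> 2 (int N + 2) (K - k i) (- \<xi> i)
        - run_exp \<zeta> 2 (int N + 2) K (- w i) - run_exp \<zeta> 2 (int N + 2) K (w i)
        - run_exp \<zeta> 2 (2 * int (k i) - 2 * int K - int N) (2 * k i) (\<xi> i) - run_exp \<zeta> 6 (3 * int N + 6) (k i) (\<xi> i))
    + (run_exp \<zeta> 2 (- 2 * int N) K 0 + run_exp \<zeta> 2 (2 * int N + 2) (2 * K) 0)
    + (\<Sum>i=1..r. \<Sum>j=1..r. run_exp \<zeta> 6 0 (k i) (\<xi> i + w j) + run_exp \<zeta> 6 0 (k i) (\<xi> i - w j)
        - run_exp \<zeta> 6 6 (k i) (\<xi> i - \<xi> j)) = 0"
proof -
  define f where "f i = (of_nat (k i) :: complex)" for i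
  define \<kappa> where "\<kappa> = (\<Sum>i=1..r. f i)"
  define X where "X = (\<Sum>i=1..r. \<xi> i)"
  define D where "D = (\<Sum>i=1..r. f i * \<xi> i)"
  define Q where "Q = (\<Sum>i=1..r. f i * f i)"
  define e where "e = (\<Sum>i=1..r. \<Sum>j=i+1..r. f i * f j)"
  have K: "of_nat K = \<kappa>" by (simp add: K_def \<kappa>_def f_def)
  have e2: "of_nat (e2 r k) = e" by (simp add: e2_def e_def f_def)
  have kK: "k i \<le> K" if "i \<in> {1..r}" for i unfolding K_def using that by (intro member_le_sum) auto
  have sq: "\<kappa> * \<kappa> = Q + 2 * e" unfolding \<kappa>_def Q_def e_def by (rule square_sum_upper)
  have 1: "(\<Sum>i=1..r. \<Sum>j=i+1..r. of_nat (k i + k j) * (6 * \<zeta>) - run_exp \<zeta> 6 0 (k i + k j) (\<xi> i + \<xi> j))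
      = 9 * \<zeta> * ((of_nat r - 1) * \<kappa>) - ((of_nat r - 2) * D + \<kappa> * X) - 3 * \<zeta> * ((of_nat r - 2) * Q + \<kappa> * \<kappa>)"
  proof -
    have "(\<Sum>i=1..r. \<Sum>j=i+1..r. of_nat (k i + k j) * (6 * \<zeta>) - run_exp \<zeta> 6 0 (k i + k j) (\<xi> i + \<xi> j))
        = (\<Sum>i=1..r. \<Sum>j=i+1..r. 9 * \<zeta> * (f i + f j) - (f i + f j) * (\<xi> i + \<xi> j) - 3 * \<zeta> * ((f i + f j) * (f i + f j)))"
      by (intro sum.cong refl) (simp add: run_exp_def f_def field_simps)
    also have "\<dots> = 9 * \<zeta> * (\<Sum>i=1..r. \<Sum>j=i+1..r. f i + f j) - (\<Sum>i=1..r. \<Sum>j=i+1..r. (f i + f j) * (\<xi> i + \<xi> j))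
        - 3 * \<zeta> * (\<Sum>i=1..r. \<Sum>j=i+1..r. (f i + f j) * (f i + f j))"
      by (simp only: sum_subtractf sum_distrib_left)
    finally show ?thesis unfolding upper_sum_add upper_sum_product \<kappa>_def X_def D_def Q_def .
  qed
  have 2: "(\<Sum>i=1..r. of_int (2 * int K + 6 * int (k i)) * \<zeta> + run_exp \<zeta> 2 (int N) K (\<xi> i)
        + run_exp \<zeta> 2 (int N + 2) (K - k i) (- \<xi> i)
        - run_exp \<zeta> 2 (int N + 2) K (- w i) - run_exp \<zeta> 2 (int N + 2) K (w i)
        - run_exp \<zeta> 2 (2 * int (k i) - 2 * int K - int N) (2 * k i) (\<xi> i) - run_exp \<zeta> 6 (3 * int N + 6) (k i) (\<xi> i))
      = - 2 * D + \<zeta> * (2 * (\<kappa> * \<kappa>) + 4 * \<kappa> - 2 * of_nat N * \<kappa> - 10 * Q)"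
  proof -
    have "(\<Sum>i=1..r. of_int (2 * int K + 6 * int (k i)) * \<zeta> + run_exp \<zeta> 2 (int N) K (\<xi> i)
        + run_exp \<zeta> 2 (int N + 2) (K - k i) (- \<xi> i)
        - run_exp \<zeta> 2 (int N + 2) K (- w i) - run_exp \<zeta> 2 (int N + 2) K (w i)
        - run_exp \<zeta> 2 (2 * int (k i) - 2 * int K - int N) (2 * k i) (\<xi> i) - run_exp \<zeta> 6 (3 * int N + 6) (k i) (\<xi> i))
      = (\<Sum>i=1..r. - 2 * (f i * \<xi> i) + \<zeta> * (2 * (\<kappa> * f i) + 4 * f i - 2 * of_nat N * f i - 10 * (f i * f i)))"
      unfolding f_def K[symmetric] by (rule sum.cong[OF refl exponent_single[OF kK]])
    also have "\<dots> = - 2 * D + \<zeta> * (2 * (\<kappa> * (\<Sum>i=1..r. f i)) + 4 * (\<Sum>i=1..r. f i) - 2 * of_nat N * (\<Sum>i=1..r. f i) - 10 * Q)"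
      unfolding D_def Q_def
      by (simp only: sum.distrib sum_subtractf sum_distrib_left[symmetric] mult.assoc)
    finally show ?thesis unfolding \<kappa>_def[symmetric] .
  qed
  have 3: "run_exp \<zeta> 2 (- 2 * int N) K 0 + run_exp \<zeta> 2 (2 * int N + 2) (2 * K) 0
      = \<zeta> * (2 * of_nat N * \<kappa> + 5 * (\<kappa> * \<kappa>) + \<kappa>)"
    unfolding K[symmetric] by (simp add: run_exp_def field_simps)
  have 4: "(\<Sum>i=1..r. \<Sum>j=1..r. run_exp \<zeta> 6 0 (k i) (\<xi> i + w j) + run_exp \<zeta> 6 0 (k i) (\<xi> i - w j)
        - run_exp \<zeta> 6 6 (k i) (\<xi> i - \<xi> j))
      = of_nat r * D + \<kappa> * X + of_nat r * (\<zeta> * (3 * Q - 9 * \<kappa>))"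
  proof -
    have "(\<Sum>i=1..r. \<Sum>j=1..r. run_exp \<zeta> 6 0 (k i) (\<xi> i + w j) + run_exp \<zeta> 6 0 (k i) (\<xi> i - w j)
        - run_exp \<zeta> 6 6 (k i) (\<xi> i - \<xi> j))
      = (\<Sum>i=1..r. \<Sum>j=1..r. f i * \<xi> j + (f i * \<xi> i + \<zeta> * (3 * (f i * f i) - 9 * f i)))"
      by (intro sum.cong refl) (simp add: run_exp_def f_def field_simps)
    also have "\<dots> = (\<Sum>i=1..r. f i * X + of_nat r * (f i * \<xi> i + \<zeta> * (3 * (f i * f i) - 9 * f i)))"
      by (simp add: sum.distrib X_def sum_distrib_left)
    also have "\<dots> = (\<Sum>i=1..r. f i) * X + of_nat r * (D + \<zeta> * (3 * Q - 9 * (\<Sum>i=1..r. f i)))"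
      unfolding D_def Q_def by (simp only: sum.distrib sum_subtractf sum_distrib_left[symmetric] sum_distrib_right[symmetric])
    finally show ?thesis unfolding \<kappa>_def[symmetric] by (simp add: algebra_simps)
  qed
  have e: "2 * e = \<kappa> * \<kappa> - Q" using sq by simp
  show ?thesis unfolding 1 2 3 4 unfolding K e2 e by (simp add: algebra_simps)
qed


section \<open>Translation of the summand and conclusion\<close>

lemma theta_bases:
  fixes q \<zeta> :: complex
  assumes "q = exp (4 * \<zeta>)"
  shows "q = exp (2 * of_int 2 * \<zeta>)" "q ^ 3 = exp (2 * of_int 6 * \<zeta>)"
  by (simp_all add: assms exp_of_nat_mult[symmetric])

text \<open>The shifts by N \<zeta> in the choice of \<xi> and w centre the runs: a^2 x i x j q^(-N)
  gets offset 0, and the runs of length N + 1 on the right-hand side start at -N and -3N.\<close>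

lemma theta_arguments:
  fixes q a \<zeta> \<alpha> :: complex and b x \<xi> w :: "nat \<Rightarrow> complex" and K m :: nat
  assumes q: "q = exp (4 * \<zeta>)" and a: "a = exp (2 * \<alpha>)"
    and ax: "\<forall>i\<in>{1..r}. a * x i = exp (2 * (\<xi> i + of_nat N * \<zeta>))"
    and ba: "\<forall>i\<in>{1..r}. b i = a * exp (2 * (w i - of_nat N * \<zeta>))"
  shows "\<And>i j. i \<in> {1..r} \<Longrightarrow> j \<in> {1..r} \<Longrightarrow> x i / x j = exp (2 * (\<xi> i - \<xi> j))"
    and "\<And>i j. i \<in> {1..r} \<Longrightarrow> j \<in> {1..r} \<Longrightarrow>
      a\<^sup>2 * x i * x j * q powi (- int N) = exp (2 * (\<xi> i + \<xi> j + of_int 0 * \<zeta>))"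
    and "\<And>i. i \<in> {1..r} \<Longrightarrow> a * x i = exp (2 * (\<xi> i + of_int (int N) * \<zeta>))"
    and "\<And>i. i \<in> {1..r} \<Longrightarrow>
      q powi (int m - int K - int N) * a * x i = exp (2 * (\<xi> i + of_int (2 * int m - 2 * int K - int N) * \<zeta>))"
    and "\<And>i. i \<in> {1..r} \<Longrightarrow> a * x i * q ^ (N + 3) = exp (2 * (\<xi> i + of_int (3 * int N + 6) * \<zeta>))"
    and "\<And>i j. i \<in> {1..r} \<Longrightarrow> j \<in> {1..r} \<Longrightarrow> q ^ 3 * x i / x j = exp (2 * (\<xi> i - \<xi> j + of_int 6 * \<zeta>))"
    and "\<And>i. i \<in> {1..r} \<Longrightarrow> b i * q ^ (N + 1) / a = exp (2 * (w i + of_int (int N + 2) * \<zeta>))"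
    and "\<And>i. i \<in> {1..r} \<Longrightarrow> a * q / b i = exp (2 * (- w i + of_int (int N + 2) * \<zeta>))"
    and "\<And>i. i \<in> {1..r} \<Longrightarrow> b i * q powi (- int N) / a = exp (2 * (w i + of_int (- 3 * int N) * \<zeta>))"
    and "\<And>i. i \<in> {1..r} \<Longrightarrow> 1 / (a * x i) = exp (2 * (- \<xi> i + of_int (- int N) * \<zeta>))"
    and "\<And>i. i \<in> {1..r} \<Longrightarrow> b i / a = exp (2 * (w i + of_int (- int N) * \<zeta>))"
    and "\<And>i. i \<in> {1..r} \<Longrightarrow> q powi (- int N) / (a * x i) = exp (2 * (- \<xi> i + of_int (- 3 * int N) * \<zeta>))"
    and "\<And>i. i \<in> {1..r} \<Longrightarrow> q ^ (N + 1) / (a * x i) = exp (2 * (- \<xi> i + of_int (int N + 2) * \<zeta>))"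
    and "\<And>i j. i \<in> {1..r} \<Longrightarrow> j \<in> {1..r} \<Longrightarrow> b j * x i = exp (2 * (\<xi> i + w j + of_int 0 * \<zeta>))"
    and "\<And>i j. i \<in> {1..r} \<Longrightarrow> j \<in> {1..r} \<Longrightarrow>
      a\<^sup>2 * x i * q powi (- int N) / b j = exp (2 * (\<xi> i - w j + of_int 0 * \<zeta>))"
    and "q powi (- int N) = exp (2 * (0 + of_int (- 2 * int N) * \<zeta>))"
    and "q ^ (N + 1) = exp (2 * (0 + of_int (2 * int N + 2) * \<zeta>))"
    and "\<And>i. i \<in> {1..r} \<Longrightarrow> x i = exp (2 * (\<xi> i + of_nat N * \<zeta> - \<alpha>))"
proof -
  have x: "x i = exp (2 * (\<xi> i + of_nat N * \<zeta> - \<alpha>))" if "i \<in> {1..r}" for i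
  proof -
    have "x i = a * x i / a" using a by simp
    also have "\<dots> = exp (2 * (\<xi> i + of_nat N * \<zeta>) - 2 * \<alpha>)" unfolding ax[rule_format, OF that] unfolding a by (simp only: exp_diff)
    finally show ?thesis by (simp add: algebra_simps)
  qed
  have b: "b i = exp (2 * (w i - of_nat N * \<zeta> + \<alpha>))" if "i \<in> {1..r}" for i
    unfolding ba[rule_format, OF that] unfolding a exp_add[symmetric] by (simp add: algebra_simps)
  have qn: "q ^ n = exp (of_nat n * (4 * \<zeta>))" for n unfolding q by (rule exp_of_nat_mult[symmetric])
  have qi: "q powi n = exp (of_int n * (4 * \<zeta>))" for n unfolding q by (simp add: exp_power_int)
  have a2: "a\<^sup>2 = exp (4 * \<alpha>)" unfolding a by (simp add: exp_of_nat_mult[symmetric])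
  have one: "1 = exp (0 :: complex)" by simp
  note rules = exp_add[symmetric] exp_diff[symmetric]
  fix i assume i: "i \<in> {1..r}"
  show "x i = exp (2 * (\<xi> i + of_nat N * \<zeta> - \<alpha>))" by (rule x[OF i])
  show "a * x i = exp (2 * (\<xi> i + of_int (int N) * \<zeta>))" using ax[rule_format, OF i] by simp
  show "q powi (int m - int K - int N) * a * x i = exp (2 * (\<xi> i + of_int (2 * int m - 2 * int K - int N) * \<zeta>))"
    unfolding x[OF i] qi a rules by (simp add: algebra_simps)
  show "a * x i * q ^ (N + 3) = exp (2 * (\<xi> i + of_int (3 * int N + 6) * \<zeta>))"
    unfolding x[OF i] qn a rules by (simp add: algebra_simps)
  show "b i * q ^ (N + 1) / a = exp (2 * (w i + of_int (int N + 2) * \<zeta>))"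
    unfolding b[OF i] qn a rules by (simp add: algebra_simps)
  show "a * q / b i = exp (2 * (- w i + of_int (int N + 2) * \<zeta>))"
    unfolding b[OF i] q a rules by (simp add: algebra_simps)
  show "b i * q powi (- int N) / a = exp (2 * (w i + of_int (- 3 * int N) * \<zeta>))"
    unfolding b[OF i] qi a rules by (simp add: algebra_simps)
  show "1 / (a * x i) = exp (2 * (- \<xi> i + of_int (- int N) * \<zeta>))"
    unfolding x[OF i] a rules by (subst one) (simp only: rules, simp add: algebra_simps)
  show "b i / a = exp (2 * (w i + of_int (- int N) * \<zeta>))"
    unfolding b[OF i] a rules by (simp add: algebra_simps)
  show "q powi (- int N) / (a * x i) = exp (2 * (- \<xi> i + of_int (- 3 * int N) * \<zeta>))"
    unfolding x[OF i] qi a rules by (simp add: algebra_simps)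
  show "q ^ (N + 1) / (a * x i) = exp (2 * (- \<xi> i + of_int (int N + 2) * \<zeta>))"
    unfolding x[OF i] qn a rules by (simp add: algebra_simps)
  fix j assume j: "j \<in> {1..r}"
  show "x i / x j = exp (2 * (\<xi> i - \<xi> j))"
    unfolding x[OF i] x[OF j] rules by (simp add: algebra_simps)
  show "a\<^sup>2 * x i * x j * q powi (- int N) = exp (2 * (\<xi> i + \<xi> j + of_int 0 * \<zeta>))"
    unfolding x[OF i] x[OF j] a2 qi rules by (simp add: algebra_simps)
  show "q ^ 3 * x i / x j = exp (2 * (\<xi> i - \<xi> j + of_int 6 * \<zeta>))"
    unfolding x[OF i] x[OF j] qn rules by (simp add: algebra_simps)
  show "b j * x i = exp (2 * (\<xi> i + w j + of_int 0 * \<zeta>))"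
    unfolding x[OF i] b[OF j] rules by (simp add: algebra_simps)
  show "a\<^sup>2 * x i * q powi (- int N) / b j = exp (2 * (\<xi> i - w j + of_int 0 * \<zeta>))"
    unfolding x[OF i] b[OF j] a2 qi rules by (simp add: algebra_simps)
next
  have qn: "q ^ n = exp (of_nat n * (4 * \<zeta>))" for n unfolding q by (rule exp_of_nat_mult[symmetric])
  have qi: "q powi n = exp (of_int n * (4 * \<zeta>))" for n unfolding q by (simp add: exp_power_int)
  show "q powi (- int N) = exp (2 * (0 + of_int (- 2 * int N) * \<zeta>))" unfolding qi by (simp add: algebra_simps)
  show "q ^ (N + 1) = exp (2 * (0 + of_int (2 * int N + 2) * \<zeta>))" unfolding qn by (simp add: algebra_simps)
qed

lemma cubic_term_theta:
  fixes p q a \<zeta> \<alpha> :: complex and b x \<xi> w :: "nat \<Rightarrow> complex" and k :: "nat \<Rightarrow> nat"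
  assumes q: "q = exp (4 * \<zeta>)" and a: "a = exp (2 * \<alpha>)"
    and ax: "\<forall>i\<in>{1..r}. a * x i = exp (2 * (\<xi> i + of_nat N * \<zeta>))"
    and ba: "\<forall>i\<in>{1..r}. b i = a * exp (2 * (w i - of_nat N * \<zeta>))"
  shows "ell_Delta r (\<lambda>i. x i * q ^ (3 * k i)) p / ell_Delta r x p
        * q powi (int (vsum r k) - 2 * int (e2 r k))
        * (\<Prod>i=1..r. \<Prod>j=i+1..r.
             1 / ell_poch (a\<^sup>2 * x i * x j * q powi (- int N)) (q ^ 3) p (k i + k j))
        * (\<Prod>i=1..r.
             theta (a * x i * q ^ (vsum r k + 3 * k i)) p / theta (a * x i) p
             * (ell_poch (a * x i) q p (vsum r k)
                * ell_poch (q ^ (N + 1) / (a * x i)) q p (vsum r k - k i))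
             / (ell_pochs [a * q / b i, b i * q ^ (N + 1) / a] q p (vsum r k)
                * ell_poch (q powi (int (k i) - int (vsum r k) - int N) * a * x i) q p (2 * k i)))
        * (ell_poch (q powi (- int N)) q p (vsum r k) * ell_poch (q ^ (N + 1)) q p (2 * vsum r k)
           / (\<Prod>i=1..r. ell_poch (a * x i * q ^ (N + 3)) (q ^ 3) p (k i)))
        * (\<Prod>i=1..r. \<Prod>j=1..r.
             ell_pochs [b j * x i, a\<^sup>2 * x i * q powi (- int N) / b j] (q ^ 3) p (k i)
             / ell_poch (q ^ 3 * x i / x j) (q ^ 3) p (k i))
    = cubic_term (odd_theta p) \<zeta> r N \<xi> w k"
proof -
  define K where "K = sum k {1..r}"
  have vK: "vsum r k = K" by (simp add: vsum_def K_def)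
  let ?run = "sigma_run (odd_theta p) \<zeta>" and ?e = "run_exp \<zeta>"
  note conv = theta_arguments[where q = q and a = a and b = b and x = x and \<xi> = \<xi> and w = w and \<zeta> = \<zeta> and \<alpha> = \<alpha> and r = r and N = N, OF q a ax ba]
  note bases = theta_bases[OF q]
  have pair: "x j * q ^ (3 * k j) * theta (x i * q ^ (3 * k i) / (x j * q ^ (3 * k j))) p / (x j * theta (x i / x j) p)
      * (1 / ell_poch (a\<^sup>2 * x i * x j * q powi (- int N)) (q ^ 3) p (k i + k j))
    = exp (of_nat (k i + k j) * (6 * \<zeta>) - ?e 6 0 (k i + k j) (\<xi> i + \<xi> j)) * pair_factor (odd_theta p) \<zeta> \<xi> k i j"
    if i: "i \<in> {1..r}" and j: "j \<in> {1..r}" for i j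
  proof -
    let ?v = "\<xi> i - \<xi> j + of_int (6 * int (k i) - 6 * int (k j)) * \<zeta>"
    have qn: "q ^ n = exp (of_nat n * (4 * \<zeta>))" for n unfolding q by (rule exp_of_nat_mult[symmetric])
    have xi: "x i = exp (2 * (\<xi> i + of_nat N * \<zeta> - \<alpha>))" and xj: "x j = exp (2 * (\<xi> j + of_nat N * \<zeta> - \<alpha>))"
      by (rule conv(18)[OF i]) (rule conv(18)[OF j])
    have "x i * q ^ (3 * k i) / (x j * q ^ (3 * k j))
        = exp (2 * (\<xi> i + of_nat N * \<zeta> - \<alpha>) + of_nat (3 * k i) * (4 * \<zeta>)
            - (2 * (\<xi> j + of_nat N * \<zeta> - \<alpha>) + of_nat (3 * k j) * (4 * \<zeta>)))"
      by (simp only: exp_diff exp_add xi xj qn)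
    also have "\<dots> = exp (2 * ?v)" by (simp add: algebra_simps)
    finally have "x i * q ^ (3 * k i) / (x j * q ^ (3 * k j)) = exp (2 * ?v)" .
    then have 1: "theta (x i * q ^ (3 * k i) / (x j * q ^ (3 * k j))) p = exp ?v * odd_theta p ?v" by (simp only: theta_odd_theta)
    have 2: "theta (x i / x j) p = exp (\<xi> i - \<xi> j) * odd_theta p (\<xi> i - \<xi> j)" unfolding conv(1)[OF i j] theta_odd_theta ..
    have 3: "x j \<noteq> 0" using conv(18)[OF j] by simp
    have 4: "q ^ (3 * k j) * exp ?v / exp (\<xi> i - \<xi> j) = exp (of_nat (k i + k j) * (6 * \<zeta>))"
      unfolding qn exp_add[symmetric] exp_diff[symmetric] by (simp add: algebra_simps)
    have 5: "x j * q ^ (3 * k j) * theta (x i * q ^ (3 * k i) / (x j * q ^ (3 * k j))) p / (x j * theta (x i / x j) p)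
        = (q ^ (3 * k j) * exp ?v / exp (\<xi> i - \<xi> j)) * (odd_theta p ?v / odd_theta p (\<xi> i - \<xi> j))"
      unfolding 1 2 using 3 by simp
    have 6: "?run 6 (6 * int (k i) - 6 * int (k j)) 1 (\<xi> i - \<xi> j) = odd_theta p ?v" "?run 6 0 1 (\<xi> i - \<xi> j) = odd_theta p (\<xi> i - \<xi> j)"
      by (simp_all add: sigma_run_def)
    show ?thesis
      unfolding 5 4 ell_poch_run[OF conv(2)[OF i j] bases(2)] pair_factor_def 6 exp_diff[of "of_nat (k i + k j) * (6 * \<zeta>)"]
      by (simp only: divide_inverse inverse_mult_distrib mult_ac mult_1_left mult_1_right)
  qed
  have pairs: "ell_Delta r (\<lambda>i. x i * q ^ (3 * k i)) p / ell_Delta r x p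
        * (\<Prod>i=1..r. \<Prod>j=i+1..r. 1 / ell_poch (a\<^sup>2 * x i * x j * q powi (- int N)) (q ^ 3) p (k i + k j))
      = exp (\<Sum>i=1..r. \<Sum>j=i+1..r. of_nat (k i + k j) * (6 * \<zeta>) - ?e 6 0 (k i + k j) (\<xi> i + \<xi> j))
        * upper r (pair_factor (odd_theta p) \<zeta> \<xi> k)"
  proof -
    have "ell_Delta r (\<lambda>i. x i * q ^ (3 * k i)) p / ell_Delta r x p
        * (\<Prod>i=1..r. \<Prod>j=i+1..r. 1 / ell_poch (a\<^sup>2 * x i * x j * q powi (- int N)) (q ^ 3) p (k i + k j))
      = upper r (\<lambda>i j. x j * q ^ (3 * k j) * theta (x i * q ^ (3 * k i) / (x j * q ^ (3 * k j))) p / (x j * theta (x i / x j) p)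
          * (1 / ell_poch (a\<^sup>2 * x i * x j * q powi (- int N)) (q ^ 3) p (k i + k j)))"
      unfolding ell_Delta_def by (simp only: prod.distrib prod_dividef)
    also have "\<dots> = upper r (\<lambda>i j. exp (of_nat (k i + k j) * (6 * \<zeta>) - ?e 6 0 (k i + k j) (\<xi> i + \<xi> j))
          * pair_factor (odd_theta p) \<zeta> \<xi> k i j)"
      by (intro prod.cong refl pair) auto
    finally show ?thesis unfolding upper_distrib upper_exp .
  qed
  have qpow: "q powi (int K - 2 * int (e2 r k)) = exp (4 * \<zeta> * (of_nat K - 2 * of_nat (e2 r k)))"
    unfolding q by (simp add: exp_power_int mult_ac)
  define A where "A i = theta (a * x i * q ^ (K + 3 * k i)) p / theta (a * x i) p
             * (ell_poch (a * x i) q p K * ell_poch (q ^ (N + 1) / (a * x i)) q p (K - k i))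
             / (ell_pochs [a * q / b i, b i * q ^ (N + 1) / a] q p K
                * ell_poch (q powi (int (k i) - int K - int N) * a * x i) q p (2 * k i))" for i
  define C where "C i = ell_poch (a * x i * q ^ (N + 3)) (q ^ 3) p (k i)" for i
  define E where "E i = of_int (2 * int K + 6 * int (k i)) * \<zeta> + ?e 2 (int N) K (\<xi> i)
        + ?e 2 (int N + 2) (K - k i) (- \<xi> i)
        - ?e 2 (int N + 2) K (- w i) - ?e 2 (int N + 2) K (w i)
        - ?e 2 (2 * int (k i) - 2 * int K - int N) (2 * k i) (\<xi> i) - ?e 6 (3 * int N + 6) (k i) (\<xi> i)" for i
  have single: "A i / C i = exp (E i) * (single_factor (odd_theta p) \<zeta> N K (k i) (\<xi> i)
          / (?run 2 (int N + 2) K (- w i) * ?run 2 (int N + 2) K (w i)))" if i: "i \<in> {1..r}" for i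
  proof -
    let ?a = "int N + 2 * int K + 6 * int (k i)"
    have arg: "a * x i * q ^ (K + 3 * k i) = exp (2 * (\<xi> i + of_int ?a * \<zeta>))"
      unfolding conv(3)[OF i] unfolding q exp_of_nat_mult[symmetric] exp_add[symmetric] by (simp add: algebra_simps)
    \<comment> \<open>Single theta functions become runs of length 1, so that one conversion rule
      handles every factor.\<close>
    have one: "theta y p = ell_poch y q p 1" for y by (simp add: ell_poch_def)
    have e1: "?e 2 ?a 1 (\<xi> i) - ?e 2 (int N) 1 (\<xi> i) = of_int (2 * int K + 6 * int (k i)) * \<zeta>"
      by (simp add: run_exp_def algebra_simps)
    have pochs: "ell_pochs [y, y'] q p K = ell_poch y q p K * ell_poch y' q p K" for y y' by (simp add: ell_pochs_def)
    have "(exp a1 * R1) / (exp a2 * R2) * ((exp a3 * R3) * (exp a4 * R4)) / (((exp a5 * R5) * (exp a6 * R6)) * (exp a7 * R7)) / (exp a8 * R8)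
        = exp ((a1 - a2) + a3 + a4 - a5 - a6 - a7 - a8) * (R1 / R2 * (R3 * R4) / R7 / R8 / (R5 * R6))"
      for a1 a2 a3 a4 a5 a6 a7 a8 R1 R2 R3 R4 R5 R6 R7 R8 :: complex
      by (simp only: exp_add exp_diff divide_inverse inverse_mult_distrib mult_ac)
    note collect = this
    show ?thesis
      unfolding A_def C_def E_def pochs one ell_poch_run[OF arg bases(1)] ell_poch_run[OF conv(3)[OF i] bases(1)]
        ell_poch_run[OF conv(4)[OF i] bases(1)] ell_poch_run[OF conv(5)[OF i] bases(2)]
        ell_poch_run[OF conv(7)[OF i] bases(1)] ell_poch_run[OF conv(8)[OF i] bases(1)]
        ell_poch_run[OF conv(13)[OF i] bases(1)] collect e1 single_factor_def ..
  qed
  have six: "ell_poch (q powi (- int N)) q p K * ell_poch (q ^ (N + 1)) q p (2 * K)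
      = exp (?e 2 (- 2 * int N) K 0 + ?e 2 (2 * int N + 2) (2 * K) 0)
        * (?run 2 (- 2 * int N) K 0 * ?run 2 (2 * int N + 2) (2 * K) 0)"
    unfolding ell_poch_run[OF conv(16) bases(1)] ell_poch_run[OF conv(17) bases(1)] exp_add by (simp only: mult_ac)
  define G where "G i j = ?e 6 0 (k i) (\<xi> i + w j) + ?e 6 0 (k i) (\<xi> i - w j) - ?e 6 6 (k i) (\<xi> i - \<xi> j)" for i j
  have square: "(\<Prod>i=1..r. \<Prod>j=1..r. ell_pochs [b j * x i, a\<^sup>2 * x i * q powi (- int N) / b j] (q ^ 3) p (k i)
             / ell_poch (q ^ 3 * x i / x j) (q ^ 3) p (k i))
      = exp (\<Sum>i=1..r. \<Sum>j=1..r. G i j)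
        * (\<Prod>i=1..r. \<Prod>j=1..r. ?run 6 0 (k i) (\<xi> i + w j) * ?run 6 0 (k i) (\<xi> i - w j) / ?run 6 6 (k i) (\<xi> i - \<xi> j))"
  proof -
    have pochs: "ell_pochs [y, y'] (q ^ 3) p n = ell_poch y (q ^ 3) p n * ell_poch y' (q ^ 3) p n" for y y' n
      by (simp add: ell_pochs_def)
    have "ell_pochs [b j * x i, a\<^sup>2 * x i * q powi (- int N) / b j] (q ^ 3) p (k i) / ell_poch (q ^ 3 * x i / x j) (q ^ 3) p (k i)
        = exp (G i j) * (?run 6 0 (k i) (\<xi> i + w j) * ?run 6 0 (k i) (\<xi> i - w j) / ?run 6 6 (k i) (\<xi> i - \<xi> j))"
      if i: "i \<in> {1..r}" and j: "j \<in> {1..r}" for i j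
      unfolding pochs ell_poch_run[OF conv(14)[OF i j] bases(2)] ell_poch_run[OF conv(15)[OF i j] bases(2)]
        ell_poch_run[OF conv(6)[OF i j] bases(2)] G_def
      by (simp only: exp_add exp_diff divide_inverse inverse_mult_distrib mult_ac)
    then have "(\<Prod>i=1..r. \<Prod>j=1..r. ell_pochs [b j * x i, a\<^sup>2 * x i * q powi (- int N) / b j] (q ^ 3) p (k i)
             / ell_poch (q ^ 3 * x i / x j) (q ^ 3) p (k i))
      = (\<Prod>i=1..r. \<Prod>j=1..r. exp (G i j) * (?run 6 0 (k i) (\<xi> i + w j) * ?run 6 0 (k i) (\<xi> i - w j)
          / ?run 6 6 (k i) (\<xi> i - \<xi> j)))"
      by (intro prod.cong refl) blast
    then show ?thesis by (simp only: prod.distrib exp_sum[OF finite_atLeastAtMost])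
  qed
  have singles: "(\<Prod>i=1..r. A i / C i) = exp (\<Sum>i=1..r. E i) * (\<Prod>i=1..r. single_factor (odd_theta p) \<zeta> N K (k i) (\<xi> i)
          / (?run 2 (int N + 2) K (- w i) * ?run 2 (int N + 2) K (w i)))"
    unfolding exp_sum[OF finite_atLeastAtMost] prod.distrib[symmetric] by (rule prod.cong[OF refl single])
  have arrange: "d * t * u * v * (s / c) * g = (d * u) * t * (v / c) * s * g" for d t u v s c g :: complex
    by (simp add: mult_ac)
  have total: "exp (e1 :: complex) * R1 * exp e2' * (exp e3 * R3) * (exp e4 * R4) * (exp e5 * R5) = R1 * R3 * R4 * R5"
    if "e1 + e2' + e3 + e4 + e5 = 0" for e1 e2' e3 e4 e5 R1 R3 R4 R5
  proof -
    have "exp e1 * R1 * exp e2' * (exp e3 * R3) * (exp e4 * R4) * (exp e5 * R5)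
        = exp (e1 + e2' + e3 + e4 + e5) * (R1 * R3 * R4 * R5)"
      by (simp only: exp_add mult_ac)
    then show ?thesis unfolding that by simp
  qed
  have zero: "(\<Sum>i=1..r. \<Sum>j=i+1..r. of_nat (k i + k j) * (6 * \<zeta>) - ?e 6 0 (k i + k j) (\<xi> i + \<xi> j))
      + 4 * \<zeta> * (of_nat K - 2 * of_nat (e2 r k)) + (\<Sum>i=1..r. E i)
      + (?e 2 (- 2 * int N) K 0 + ?e 2 (2 * int N + 2) (2 * K) 0) + (\<Sum>i=1..r. \<Sum>j=1..r. G i j) = 0"
    unfolding E_def G_def K_def by (rule exponents_cancel)
  show ?thesis
    unfolding vK A_def[symmetric] C_def[symmetric] arrange pairs qpow prod_dividef[symmetric] 
    unfolding singles six square total[OF zero] cubic_term_def Let_def K_def[symmetric] ..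
qed

theorem corollary4p11:
  fixes p q a :: complex and b x :: "nat \<Rightarrow> complex" and r N :: nat
  assumes base: "elliptic_base p q"
    and r: "r \<ge> 1"
    and a_nz: "a \<noteq> 0"
    and b_nz: "\<forall>i\<in>{1..r}. b i \<noteq> 0"
    and x_nz: "\<forall>i\<in>{1..r}. x i \<noteq> 0"
    \<comment> \<open>genericity: no denominator on either side vanishes\<close>
    and gen_Delta: "ell_Delta r x p \<noteq> 0"
    and gen_pairs: "\<forall>k\<in>simplex_indices r N. \<forall>i\<in>{1..r}. \<forall>j\<in>{i+1..r}.
          ell_poch (a\<^sup>2 * x i * x j * q powi (- int N)) (q ^ 3) p (k i + k j) \<noteq> 0"
    and gen_theta: "\<forall>i\<in>{1..r}. theta (a * x i) p \<noteq> 0"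
    and gen_b: "\<forall>k\<in>simplex_indices r N. \<forall>i\<in>{1..r}.
          ell_pochs [a * q / b i, b i * q ^ (N + 1) / a] q p (vsum r k) \<noteq> 0"
    and gen_2k: "\<forall>k\<in>simplex_indices r N. \<forall>i\<in>{1..r}.
          ell_poch (q powi (int (k i) - int (vsum r k) - int N) * a * x i) q p (2 * k i) \<noteq> 0"
    and gen_ax: "\<forall>k\<in>simplex_indices r N. \<forall>i\<in>{1..r}.
          ell_poch (a * x i * q ^ (N + 3)) (q ^ 3) p (k i) \<noteq> 0"
    and gen_xx: "\<forall>k\<in>simplex_indices r N. \<forall>i\<in>{1..r}. \<forall>j\<in>{1..r}.
          ell_poch (q ^ 3 * x i / x j) (q ^ 3) p (k i) \<noteq> 0"
    and gen_rhs1: "\<forall>i\<in>{1..r}. ell_poch (1 / (a * x i)) q p (N + 1) \<noteq> 0"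
    and gen_rhs2: "\<forall>i\<in>{1..r}. ell_poch (b i * q powi (- int N) / a) (q ^ 3) p (N + 1) \<noteq> 0"
  shows
    "(\<Sum>k\<in>simplex_indices r N.
        ell_Delta r (\<lambda>i. x i * q ^ (3 * k i)) p / ell_Delta r x p
        * q powi (int (vsum r k) - 2 * int (e2 r k))
        * (\<Prod>i=1..r. \<Prod>j=i+1..r.
             1 / ell_poch (a\<^sup>2 * x i * x j * q powi (- int N)) (q ^ 3) p (k i + k j))
        * (\<Prod>i=1..r.
             theta (a * x i * q ^ (vsum r k + 3 * k i)) p / theta (a * x i) p
             * (ell_poch (a * x i) q p (vsum r k)
                * ell_poch (q ^ (N + 1) / (a * x i)) q p (vsum r k - k i))
             / (ell_pochs [a * q / b i, b i * q ^ (N + 1) / a] q p (vsum r k)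
                * ell_poch (q powi (int (k i) - int (vsum r k) - int N) * a * x i) q p (2 * k i)))
        * (ell_poch (q powi (- int N)) q p (vsum r k) * ell_poch (q ^ (N + 1)) q p (2 * vsum r k)
           / (\<Prod>i=1..r. ell_poch (a * x i * q ^ (N + 3)) (q ^ 3) p (k i)))
        * (\<Prod>i=1..r. \<Prod>j=1..r.
             ell_pochs [b j * x i, a\<^sup>2 * x i * q powi (- int N) / b j] (q ^ 3) p (k i)
             / ell_poch (q ^ 3 * x i / x j) (q ^ 3) p (k i)))
     = (\<Prod>i=1..r.
          ell_poch (b i / a) q p (N + 1) * ell_poch (q powi (- int N) / (a * x i)) (q ^ 3) p (N + 1)
          / (ell_poch (1 / (a * x i)) q p (N + 1)
             * ell_poch (b i * q powi (- int N) / a) (q ^ 3) p (N + 1)))"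
proof -
  have p: "norm p < 1" and q0: "q \<noteq> 0" and qp: "\<And>k::nat. \<And>m::int. k > 0 \<Longrightarrow> q ^ k \<noteq> p powi m"
    using base by (auto simp: elliptic_base_def)
  interpret odd_sigma "odd_theta p" by (rule odd_sigma_odd_theta[OF p])
  define \<zeta> where "\<zeta> = Ln q / 4"
  define \<alpha> where "\<alpha> = Ln a / 2"
  define \<xi> where "\<xi> i = Ln (a * x i) / 2 - of_nat N * \<zeta>" for i
  define w where "w i = Ln (b i / a) / 2 + of_nat N * \<zeta>" for i
  have q: "q = exp (4 * \<zeta>)" using q0 by (simp add: \<zeta>_def)
  have a: "a = exp (2 * \<alpha>)" using a_nz by (simp add: \<alpha>_def)
  have ax: "\<forall>i\<in>{1..r}. a * x i = exp (2 * (\<xi> i + of_nat N * \<zeta>))"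
    using a_nz x_nz by (simp add: \<xi>_def)
  have ba: "\<forall>i\<in>{1..r}. b i = a * exp (2 * (w i - of_nat N * \<zeta>))"
    using a_nz b_nz by (simp add: w_def)
  note conv = theta_arguments[where q = q and a = a and b = b and x = x and \<xi> = \<xi> and w = w and \<zeta> = \<zeta> and \<alpha> = \<alpha> and r = r and N = N, OF q a ax ba]
  let ?run = "sigma_run (odd_theta p) \<zeta>"
  have base2: "q = exp (2 * of_int 2 * \<zeta>)" and base6: "q ^ 3 = exp (2 * of_int 6 * \<zeta>)"
    using theta_bases[OF q] .
  have nz: "?run d e n u \<noteq> 0" if "ell_poch y Q p n \<noteq> 0" "y = exp (2 * (u + of_int e * \<zeta>))"
    "Q = exp (2 * of_int d * \<zeta>)" for d e n u y Q
    using that(1) unfolding ell_poch_run[OF that(2,3)] by simp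
  have Ks: "simplex_indices r N = {k \<in> PiE {1..r} (\<lambda>_. {..N}). sum k {1..r} \<le> N}"
  proof -
    have "k i \<le> N" if "sum k {1..r} \<le> N" "i \<in> {1..r}" for k i
      using member_le_sum[OF that(2), of k] that(1) by simp
    then show ?thesis by (auto simp: simplex_indices_def vsum_def PiE_iff)
  qed
  have x_a: "x i \<noteq> 0" if "i \<in> {1..r}" for i using x_nz that by blast
  have Delta_nz: "theta (x i / x j) p \<noteq> 0" if "1 \<le> i" "i < j" "j \<le> r" for i j
    using gen_Delta that unfolding ell_Delta_def by (auto simp: prod_zero_iff)
  \<comment> \<open>An index vector with |k| = N turns the genericity condition on b into
    nonvanishing at the full length N.\<close>
  obtain k0 where k0: "k0 \<in> simplex_indices r N" "vsum r k0 = N"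
  proof
    let ?k = "restrict (\<lambda>i. if i = 1 then N else 0) {1..r}"
    have "vsum r ?k = N" using r by (simp add: vsum_def sum.delta)
    then show "?k \<in> simplex_indices r N" "vsum r ?k = N" by (simp_all add: simplex_indices_def)
  qed
  have b_nz': "ell_poch (a * q / b i) q p N \<noteq> 0" "ell_poch (b i * q ^ (N + 1) / a) q p N \<noteq> 0" if "i \<in> {1..r}" for i
    using gen_b[rule_format, OF k0(1) that] k0(2) by (simp_all add: ell_pochs_def)
  have sum_eq: "(\<Sum>k\<in>{k \<in> PiE {1..r} (\<lambda>_. {..N}). sum k {1..r} \<le> N}. cubic_term (odd_theta p) \<zeta> r N \<xi> w k)
    = (\<Prod>i=1..r. run_ratio (odd_theta p) \<zeta> N (w i)
        * (?run 6 (- 3 * int N) (N + 1) (- \<xi> i) / ?run 2 (- int N) (N + 1) (- \<xi> i)))"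
  proof (rule cubic_sum[OF r], unfold Ks[symmetric])
    \<comment> \<open>A zero would make q^m a power of p; for negative m the reciprocal equation
      contradicts the hypothesis on positive powers of q.\<close>
    show "odd_theta p (of_int (2 * m) * \<zeta>) \<noteq> 0" if m: "m \<noteq> 0" for m :: int
    proof
      assume "odd_theta p (of_int (2 * m) * \<zeta>) = 0"
      then have "theta (exp (2 * (of_int (2 * m) * \<zeta>))) p = 0" by (simp add: odd_theta_def)
      then obtain l :: int where "exp (2 * (of_int (2 * m) * \<zeta>)) = p powi l"
        using theta_eq_0D[OF p exp_not_eq_zero] by blast
      moreover have "exp (2 * (of_int (2 * m) * \<zeta>)) = q powi m" by (simp add: q exp_power_int mult_ac)
      ultimately have l: "q powi m = p powi l" by simp
      show False
      proof (cases "m > 0")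
        case True
        then have "q powi m = q ^ nat m" by (simp add: power_int_def)
        then show False using l qp[of "nat m" l] True by simp
      next
        case False
        then have "q powi (- m) = q ^ nat (- m)" using m by (simp add: power_int_def)
        moreover have "q powi (- m) = p powi (- l)" using l by (simp add: power_int_minus)
        ultimately show False using qp[of "nat (- m)" "- l"] m False by simp
      qed
    qed
    show "?run 6 0 1 (\<xi> i - \<xi> j) \<noteq> 0" if ij: "1 \<le> i" "i < j" "j \<le> r" for i j
    proof -
      have "x i / x j = exp (2 * (\<xi> i - \<xi> j))" by (rule conv(1)) (use ij in auto)
      then have "theta (x i / x j) p = exp (\<xi> i - \<xi> j) * odd_theta p (\<xi> i - \<xi> j)" by (simp only: theta_odd_theta)
      then show ?thesis using Delta_nz[OF ij] by (simp add: sigma_run_def)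
    qed
    show "?run 6 0 (k i + k j) (\<xi> i + \<xi> j) \<noteq> 0"
      if "k \<in> simplex_indices r N" "1 \<le> i" "i < j" "j \<le> r" for k i j
      by (rule nz[OF _ conv(2) base6]) (use gen_pairs that in auto)
    show "?run 2 (int N) 1 (\<xi> i) \<noteq> 0" if i: "i \<in> {1..r}" for i
      by (rule nz[OF _ conv(3) base2]) (use gen_theta i in \<open>simp_all add: ell_poch_def\<close>)
    show "?run 2 (2 * int (k i) - 2 * int (sum k {1..r}) - int N) (2 * k i) (\<xi> i) \<noteq> 0"
      if "k \<in> simplex_indices r N" "i \<in> {1..r}" for k i
      by (rule nz[OF _ conv(4) base2]) (use gen_2k that in \<open>auto simp: vsum_def\<close>)
    show "?run 6 (3 * int N + 6) (k i) (\<xi> i) \<noteq> 0" if "k \<in> simplex_indices r N" "i \<in> {1..r}" for k i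
      by (rule nz[OF _ conv(5) base6]) (use gen_ax that in auto)
    show "?run 6 6 (k i) (\<xi> i - \<xi> j) \<noteq> 0" if "k \<in> simplex_indices r N" "i \<in> {1..r}" "j \<in> {1..r}" for k i j
      by (rule nz[OF _ conv(6) base6]) (use gen_xx that in auto)
    show "?run 2 (int N + 2) N (w i) \<noteq> 0" if i: "i \<in> {1..r}" for i
      by (rule nz[OF b_nz'(2)[OF i] conv(7)[OF i] base2])
    show "?run 2 (int N + 2) N (- w i) \<noteq> 0" if i: "i \<in> {1..r}" for i
      by (rule nz[OF b_nz'(1)[OF i] conv(8)[OF i] base2])
    show "?run 6 (- 3 * int N) (N + 1) (w i) \<noteq> 0" if i: "i \<in> {1..r}" for i
      by (rule nz[OF _ conv(9)[OF i] base6]) (use gen_rhs2 i in auto)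
    show "?run 2 (- int N) (N + 1) (- \<xi> i) \<noteq> 0" if i: "i \<in> {1..r}" for i
      by (rule nz[OF _ conv(10)[OF i] base2]) (use gen_rhs1 i in auto)
  qed
  have rhs: "ell_poch (b i / a) q p (N + 1) * ell_poch (q powi (- int N) / (a * x i)) (q ^ 3) p (N + 1)
          / (ell_poch (1 / (a * x i)) q p (N + 1) * ell_poch (b i * q powi (- int N) / a) (q ^ 3) p (N + 1))
      = run_ratio (odd_theta p) \<zeta> N (w i)
        * (?run 6 (- 3 * int N) (N + 1) (- \<xi> i) / ?run 2 (- int N) (N + 1) (- \<xi> i))"
    if i: "i \<in> {1..r}" for i
  proof -
    \<comment> \<open>The runs are centred, so their offsets add up to 0; the exponentials depend on
      w and \<xi> alone and cancel in the quotient.\<close>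
    have e: "run_exp \<zeta> 2 (- int N) (N + 1) u = of_nat (N + 1) * u" "run_exp \<zeta> 6 (- 3 * int N) (N + 1) u = of_nat (N + 1) * u" for u
      by (simp_all add: run_exp_def field_simps)
    show ?thesis
      unfolding ell_poch_run[OF conv(11)[OF i] base2] ell_poch_run[OF conv(12)[OF i] base6]
        ell_poch_run[OF conv(10)[OF i] base2] ell_poch_run[OF conv(9)[OF i] base6] e run_ratio_def
      by (simp add: field_simps)
  qed
  show ?thesis
    unfolding cubic_term_theta[where q = q and a = a and b = b and x = x and \<xi> = \<xi> and w = w and \<zeta> = \<zeta> and \<alpha> = \<alpha> and r = r and N = N, OF q a ax ba] Ks sum_eq by (rule prod.cong[OF refl rhs[symmetric]])
qed

end
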